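(* There is a unique family of bijections $K:JT_n\to UD_{n+1}$, one for each integer $n\ge -1$, such that $K(@)=\emptyset$, $K(\emptyset)=L$, and for all Janus threads $\gamma$: if $\gamma=1\ominus\gamma_1$ for a Janus thread $\gamma_1$ then $K(\gamma)=L\,K(\gamma_1)$, and if $\gamma=(1\oplus c(\gamma_1)\oplus 1)\ominus 1\ominus\gamma_2$ for Janus threads $\gamma_1,\gamma_2$ with $\gamma_1$ of nonnegative length then $K(\gamma)=U\,K(\gamma_1)\,D\,K(\gamma_2)$.
   Context: Permutations are written in one-line notation; $S_n$ is the set of permutations of $\{1,\dots,n\}$, $|\pi|$ is the length of $\pi$, and $1$ denotes the permutation of length one. For $\pi\in S_n$ the complement $c(\pi)\in S_n$ is $c(\pi)(j)=n+1-\pi(j)$. For $\pi\in S_n$, $\sigma\in S_m$: $\pi\oplus\sigma\in S_{n+m}$ has $(\pi\oplus\sigma)(j)=\pi(j)$ for $j\le n$ and $n+\sigma(j-n)$ for $j>n$; $\pi\ominus\sigma\in S_{n+m}$ has $(\pi\ominus\sigma)(j)=m+\pi(j)$ for $j\le n$ and $\sigma(j-n)$ for $j>n$. $\emptyset$ is the empty permutation (length $0$), an identity for $\oplus$ and $\ominus$. $@$ is a formal symbol, the "antipermutation", regarded as the unique permutation of length $-1$, with $c(@)=@$, $1\oplus @=@\oplus 1=1\ominus @=@\ominus 1=\emptyset$ and $\emptyset\ominus @=@\ominus\emptyset=@$; in an iterated sum each $@$ is combined with an adjacent $1$ first (so $1\oplus @\oplus 1=1$, $\sigma\ominus 1\ominus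 @=\sigma$, $@\ominus 1\ominus\sigma=\sigma$). The permutation induced by $\pi$ on a set of its entries is the standardization of the corresponding subsequence. A complete Baxter permutation is a permutation $\pi$ of length $2n+1$ such that $\pi(i)$ is even iff $i$ is even, and whenever $\pi(x)=i$, $\pi(y)=i+1$ and $z$ lies strictly between $x$ and $y$, then $\pi(z)<i$ if $i$ is odd and $\pi(z)>i+1$ if $i$ is even. A permutation is alternating if it begins with an ascent and its ascents and descents alternate; it is doubly alternating if it and its inverse are alternating (permutations of length $\le 1$ are doubly alternating). A permutation $\sigma$ of length $n\ge 0$ is a snow leopard permutation if there is a complete Baxter permutation of length $2n+1$ whose even entries induce $\sigma$ and whose odd entries induce a doubly alternating permutation (of length $n+1$). By convention $@$ is also a snow leopard permutation; "odd length" includes length $-1$. Snow leopard permutations preserve parity ($\pi(j)$ is even iff $j$ is even). For a parity-preserving $\pi$, $\pi^e$ and $\pi^o$ are the permutations induced by $\pi$ on its even and odd entries; if $|\pi|=2n+1\ge 1$ then $|\pi^e|=n$, $|\pi^o|=n+1$. By convention $@^e=@$, $@^o=\emptyset$. An even thread (resp. odd thread) is a permutation of the form $\pi^e$ (resp. $\pi^o$) for some snow leopard permutation $\pi$ of odd length. A Janus thread is a permutation that is both an even thread and an odd thread; by convention $@$ is also a Janus thread (of length $-1$). $JT_n$ is the set of Janus threads of length $n$. A Motzkin path of length $n$ is a lattice path from $(0,0)$ to $(n,0)$ with steps $U=(1,1)$, $D=(1,-1)$, $L=(1,0)$ that does not pass below the $x$-axis; it is peakless if no $U$ is immediately followed by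 a $D$. $UD_n$ is the set of peakless Motzkin paths of length $n$, written as words; $\emptyset$ also denotes the empty path. *)

theory Defs
  imports Main "HOL-Library.FuncSet" "HOL-Combinatorics.Multiset_Permutations"
begin

text \<open>
  Permutations are written in one-line notation, as lists over \<open>{1..n}\<close>; the value \<open>\<pi>(j)\<close> is
  \<open>pval \<pi> j\<close>, with positions \<open>j\<close> counted from 1.
\<close>

definition is_perm :: "nat list \<Rightarrow> bool" where
  "is_perm \<pi> \<longleftrightarrow> \<pi> \<in> permutations_of_set {1..length \<pi>}"

definition pval :: "nat list \<Rightarrow> nat \<Rightarrow> nat" where
  "pval \<pi> j = \<pi> ! (j - 1)"

definition perm_inverse :: "nat list \<Rightarrow> nat list" where
  "perm_inverse \<pi> = map (inv_into {1..length \<pi>} (pval \<pi>)) [1..<length \<pi> + 1]"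

definition standardize :: "nat list \<Rightarrow> nat list" where
  "standardize xs = map (\<lambda>x. card {y \<in> set xs. y \<le> x}) xs"

definition even_part :: "nat list \<Rightarrow> nat list" where
  "even_part \<pi> = standardize (filter even \<pi>)"

definition odd_part :: "nat list \<Rightarrow> nat list" where
  "odd_part \<pi> = standardize (filter odd \<pi>)"

definition complete_Baxter :: "nat list \<Rightarrow> bool" where
  "complete_Baxter \<pi> \<longleftrightarrow>
     is_perm \<pi> \<and> odd (length \<pi>) \<and>
     (\<forall>i\<in>{1..length \<pi>}. even (pval \<pi> i) \<longleftrightarrow> even i) \<and>
     (\<forall>x\<in>{1..length \<pi>}. \<forall>y\<in>{1..length \<pi>}. \<forall>z i.
        pval \<pi> x = i \<and> pval \<pi> y = i + 1 \<and> (x < z \<and> z < y \<or> y < z \<and> z < x) \<longrightarrow>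
          (if odd i then pval \<pi> z < i else pval \<pi> z > i + 1))"

definition alternating :: "nat list \<Rightarrow> bool" where
  "alternating \<pi> \<longleftrightarrow>
     (\<forall>j. 1 \<le> j \<and> j < length \<pi> \<longrightarrow>
        (if odd j then pval \<pi> j < pval \<pi> (j + 1) else pval \<pi> j > pval \<pi> (j + 1)))"

definition doubly_alternating :: "nat list \<Rightarrow> bool" where
  "doubly_alternating \<pi> \<longleftrightarrow> alternating \<pi> \<and> alternating (perm_inverse \<pi>)"

text \<open>Permutations together with the antipermutation \<open>Anti\<close>, of length \<open>-1\<close>.\<close>

datatype aperm = Anti | Perm "nat list"

fun plength :: "aperm \<Rightarrow> int" where
  "plength Anti = -1"
| "plength (Perm \<pi>) = int (length \<pi>)"

fun complement :: "aperm \<Rightarrow> aperm" where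
  "complement Anti = Anti"
| "complement (Perm \<pi>) = Perm (map (\<lambda>v. length \<pi> + 1 - v) \<pi>)"

text \<open>
  Sums involving \<open>Anti\<close> are specified only when the other summand is empty or of length one.
  Both operators associate to the right, so that in \<open>\<sigma> \<ominus> Perm [1] \<ominus> Anti\<close> the
  antipermutation is combined with the adjacent \<open>Perm [1]\<close> first.
\<close>

fun psum :: "aperm \<Rightarrow> aperm \<Rightarrow> aperm"  (infixr "\<oplus>" 65) where
  "Perm \<pi> \<oplus> Perm \<sigma> = Perm (\<pi> @ map (\<lambda>v. length \<pi> + v) \<sigma>)"
| "Perm \<pi> \<oplus> Anti = (if \<pi> = [1] then Perm [] else if \<pi> = [] then Anti else undefined)"
| "Anti \<oplus> Perm \<sigma> = (if \<sigma> = [1] then Perm [] else if \<sigma> = [] then Anti else undefined)"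
| "Anti \<oplus> Anti = undefined"

fun pskew :: "aperm \<Rightarrow> aperm \<Rightarrow> aperm"  (infixr "\<ominus>" 65) where
  "Perm \<pi> \<ominus> Perm \<sigma> = Perm (map (\<lambda>v. length \<sigma> + v) \<pi> @ \<sigma>)"
| "Perm \<pi> \<ominus> Anti = (if \<pi> = [1] then Perm [] else if \<pi> = [] then Anti else undefined)"
| "Anti \<ominus> Perm \<sigma> = (if \<sigma> = [1] then Perm [] else if \<sigma> = [] then Anti else undefined)"
| "Anti \<ominus> Anti = undefined"

fun snow_leopard :: "aperm \<Rightarrow> bool" where
  "snow_leopard Anti \<longleftrightarrow> True"
| "snow_leopard (Perm \<sigma>) \<longleftrightarrow>
     (\<exists>\<pi>. complete_Baxter \<pi> \<and> length \<pi> = 2 * length \<sigma> + 1 \<and>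
          even_part \<pi> = \<sigma> \<and> doubly_alternating (odd_part \<pi>))"

fun aeven :: "aperm \<Rightarrow> aperm" where
  "aeven Anti = Anti"
| "aeven (Perm \<pi>) = Perm (even_part \<pi>)"

fun aodd :: "aperm \<Rightarrow> aperm" where
  "aodd Anti = Perm []"
| "aodd (Perm \<pi>) = Perm (odd_part \<pi>)"

definition even_thread :: "aperm \<Rightarrow> bool" where
  "even_thread \<gamma> \<longleftrightarrow> (\<exists>\<pi>. snow_leopard \<pi> \<and> odd (plength \<pi>) \<and> \<gamma> = aeven \<pi>)"

definition odd_thread :: "aperm \<Rightarrow> bool" where
  "odd_thread \<gamma> \<longleftrightarrow> (\<exists>\<pi>. snow_leopard \<pi> \<and> odd (plength \<pi>) \<and> \<gamma> = aodd \<pi>)"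

definition Janus_thread :: "aperm \<Rightarrow> bool" where
  "Janus_thread \<gamma> \<longleftrightarrow> \<gamma> = Anti \<or> even_thread \<gamma> \<and> odd_thread \<gamma>"

definition JT :: "int \<Rightarrow> aperm set" where
  "JT n = {\<gamma>. Janus_thread \<gamma> \<and> plength \<gamma> = n}"

datatype step = U | D | L

fun rise :: "step \<Rightarrow> int" where
  "rise U = 1"
| "rise D = -1"
| "rise L = 0"

definition height :: "step list \<Rightarrow> int" where
  "height w = (\<Sum>s\<leftarrow>w. rise s)"

definition Motzkin_path :: "step list \<Rightarrow> bool" where
  "Motzkin_path w \<longleftrightarrow> height w = 0 \<and> (\<forall>k\<le>length w. height (take k w) \<ge> 0)"

definition peakless :: "step list \<Rightarrow> bool" where
  "peakless w \<longleftrightarrow> \<not> (\<exists>k. k + 1 < length w \<and> w ! k = U \<and> w ! (k + 1) = D)"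

definition UD :: "int \<Rightarrow> step list set" where
  "UD n = {w. Motzkin_path w \<and> peakless w \<and> int (length w) = n}"

end

theory Submission
  imports Defs
begin

text \<open>
Janus threads and peakless Motzkin paths are indexed by the same trees (\<open>jtree\<close>): a tree is a tip, a
level step followed by a tree, or an arch over a tree other than the tip, followed by a tree. On
paths this is the decomposition at the first return to the axis, and a peak is an arch over nothing.
On Janus threads a level step stands for \<open>1 \<ominus> \<gamma>1\<close> and an arch for
\<open>(1 \<oplus> c(\<gamma>1) \<oplus> 1) \<ominus> 1 \<ominus> \<gamma>2\<close>. Once both encodings are known to be bijective, \<open>K\<close> is the one
composed with the inverse of the other, and the two recursive clauses determine it by induction on
trees. The clause for paths is elementary; the substance is the decomposition of Janus threads
(\<open>threads_imp_tree\<close>), which takes three steps.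

The first step concerns a complete Baxter permutation \<open>\<pi>\<close> of length \<open>4k + 3\<close> whose odd entries are doubly
alternating. Alternation fixes the residues modulo 4 of the even entries that go up or down, and a
count of these residues shows (\<open>first_entry_splits\<close>) that all entries not less than \<open>\<pi>(1)\<close> come
before all smaller ones. By symmetry the block in front begins with its two smallest entries and ends with its
two largest ones, and the complement of what these enclose is of the same kind as \<open>\<pi>\<close>. With
\<open>frame A = 1 \<oplus> A \<oplus> 1\<close>, these permutations together with \<open>@\<close> are thus exactly those generated from
\<open>@\<close> by \<open>frame (frame (c A)) \<ominus> 1 \<ominus> B\<close>.

In the second step, a frame exchanges the even and the odd entries of its core while complements in
odd length preserve parity. Taking even entries therefore turns the grammar above into
\<open>frame (c A) \<ominus> 1 \<ominus> B\<close> for snow leopard permutations of odd length, and taking even or odd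
entries once more gives the mutual grammars \<open>c(p) \<ominus> 1 \<ominus> e\<close> of even threads and
\<open>frame (c e) \<ominus> p\<close> of odd threads.

Finally, a Janus thread other than \<open>@\<close> has a parse in each of these two grammars. The first
frame of a nonempty odd thread is determined by the permutation, being formed by all entries that are at least as large as the first one.
Comparing it with the first block of the even parse leaves only the two shapes of the recursion.
\<close>

section \<open>Alternating Baxter functions\<close>

definition between :: "nat \<Rightarrow> nat \<Rightarrow> nat \<Rightarrow> bool" where
  "between x z y \<longleftrightarrow> x < z \<and> z < y \<or> y < z \<and> z < x"

text \<open>
Complete Baxter permutations of length \<open>4k + 3\<close> with doubly alternating odd entries, in a local
form. The position of an even value \<open>w\<close> separates the positions of \<open>w - 1\<close> and \<open>w + 1\<close>: between
\<open>w - 1\<close> and \<open>w\<close> stand only smaller entries, between \<open>w\<close> and \<open>w + 1\<close> only larger ones. Double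
alternation amounts to two further facts: \<open>w mod 4\<close> decides on which side \<open>w - 1\<close> stands, and
position and value of an even entry agree modulo 4. Apart from bijectivity, everything is
universally quantified over entries and so passes to blocks of entries.
\<close>

definition alt_Baxter :: "nat \<Rightarrow> (nat \<Rightarrow> nat) \<Rightarrow> bool" where
  "alt_Baxter N f \<longleftrightarrow> N mod 4 = 3 \<and> bij_betw f {1..N} {1..N} \<and>
     (\<forall>y\<in>{1..N}. if even y then f y mod 4 = y mod 4 else odd (f y)) \<and>
     (\<forall>x\<in>{1..N}. \<forall>y\<in>{1..N}. even (f y) \<and> f y = f x + 1 \<longrightarrow>
        (if f y mod 4 = 2 then x < y else y < x) \<and> (\<forall>z. between x z y \<longrightarrow> f z < f y)) \<and>
     (\<forall>x\<in>{1..N}. \<forall>y\<in>{1..N}. even (f x) \<and> f y = f x + 1 \<longrightarrow>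
        (if f x mod 4 = 2 then x < y else y < x) \<and> (\<forall>z. between x z y \<longrightarrow> f x < f z))"

lemma alt_BaxterI:
  assumes "N mod 4 = 3" "inj_on f {1..N}" "\<And>x. \<lbrakk>1 \<le> x; x \<le> N\<rbrakk> \<Longrightarrow> 1 \<le> f x \<and> f x \<le> N"
    "\<And>y. \<lbrakk>1 \<le> y; y \<le> N; even y\<rbrakk> \<Longrightarrow> f y mod 4 = y mod 4"
    "\<And>y. \<lbrakk>1 \<le> y; y \<le> N; odd y\<rbrakk> \<Longrightarrow> odd (f y)"
    "\<And>x y. \<lbrakk>1 \<le> x; x \<le> N; 1 \<le> y; y \<le> N; even (f y); f y = f x + 1\<rbrakk> \<Longrightarrow>
        (if f y mod 4 = 2 then x < y else y < x) \<and> (\<forall>z. between x z y \<longrightarrow> f z < f y)"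
    "\<And>x y. \<lbrakk>1 \<le> x; x \<le> N; 1 \<le> y; y \<le> N; even (f x); f y = f x + 1\<rbrakk> \<Longrightarrow>
        (if f x mod 4 = 2 then x < y else y < x) \<and> (\<forall>z. between x z y \<longrightarrow> f x < f z)"
  shows "alt_Baxter N f"
proof -
  have "f ` {1..N} \<subseteq> {1..N}" using assms(3) by fastforce
  then have "bij_betw f {1..N} {1..N}"
    using assms(2) by (simp add: bij_betw_def endo_inj_surj)
  moreover have "\<forall>y\<in>{1..N}. if even y then f y mod 4 = y mod 4 else odd (f y)"
    using assms(4,5) by simp
  moreover have "\<forall>x\<in>{1..N}. \<forall>y\<in>{1..N}. even (f y) \<and> f y = f x + 1 \<longrightarrow>
        (if f y mod 4 = 2 then x < y else y < x) \<and> (\<forall>z. between x z y \<longrightarrow> f z < f y)"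
    by (intro ballI impI assms(6)) auto
  moreover have "\<forall>x\<in>{1..N}. \<forall>y\<in>{1..N}. even (f x) \<and> f y = f x + 1 \<longrightarrow>
        (if f x mod 4 = 2 then x < y else y < x) \<and> (\<forall>z. between x z y \<longrightarrow> f x < f z)"
    by (intro ballI impI assms(7)) auto
  ultimately show ?thesis
    unfolding alt_Baxter_def using assms(1) by (intro conjI)
qed

lemma complement_mod4:
  fixes N a :: nat
  assumes "N mod 4 = 3" "a \<le> N"
  shows "(N + 1 - a) mod 4 = (4 - a mod 4) mod 4"
proof -
  have "(N + 1 - a + a) mod 4 = 0" using assms by (simp add: mod_Suc)
  then have "((N + 1 - a) mod 4 + a mod 4) mod 4 = 0" by (metis mod_add_eq)
  moreover have "u = (4 - v) mod 4" if uv: "(u + v) mod 4 = 0" "u < 4" "v < 4" for u v :: nat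
  proof -
    obtain k where k: "u + v = 4 * k" using uv(1) by auto
    then have "k = 0 \<or> k = 1" using uv by linarith
    then show ?thesis using k uv by auto
  qed
  ultimately show ?thesis by simp
qed

lemma complement_even:
  fixes N a :: nat
  assumes "odd N" "a \<le> N"
  shows "even (N + 1 - a) \<longleftrightarrow> even a"
  using assms by simp

lemma
  fixes N a b :: nat
  assumes "a \<le> N" "b \<le> N"
  shows complement_eq_iff: "N + 1 - a = N + 1 - b \<longleftrightarrow> a = b"
    and complement_less_iff: "N + 1 - a < N + 1 - b \<longleftrightarrow> b < a"
    and complement_Suc: "N + 1 - a = (N + 1 - b) + 1 \<longleftrightarrow> b = a + 1"
    and complement_le: "1 \<le> N + 1 - a"
    and complement_ge: "1 \<le> a \<Longrightarrow> N + 1 - a \<le> N"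
  using assms by auto

context
  fixes N f assumes A: "alt_Baxter N f"
begin

lemma alt_Baxter_mod: "N mod 4 = 3" and alt_Baxter_bij: "bij_betw f {1..N} {1..N}"
  using A unfolding alt_Baxter_def by blast+

lemma alt_Baxter_range: "1 \<le> x \<Longrightarrow> x \<le> N \<Longrightarrow> 1 \<le> f x \<and> f x \<le> N"
  using alt_Baxter_bij by (fastforce simp: bij_betw_def)

lemma alt_Baxter_inj: "\<lbrakk>f x = f y; 1 \<le> x; x \<le> N; 1 \<le> y; y \<le> N\<rbrakk> \<Longrightarrow> x = y"
  by (rule inj_onD[OF bij_betw_imp_inj_on[OF alt_Baxter_bij]]) auto

lemma alt_Baxter_position: "\<lbrakk>1 \<le> v; v \<le> N\<rbrakk> \<Longrightarrow> \<exists>x. 1 \<le> x \<and> x \<le> N \<and> f x = v"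
  using bij_betw_imp_surj_on[OF alt_Baxter_bij] by (metis atLeastAtMost_iff imageE)

lemma alt_Baxter_even: "\<lbrakk>1 \<le> y; y \<le> N; even y\<rbrakk> \<Longrightarrow> f y mod 4 = y mod 4"
  using bspec[OF A[unfolded alt_Baxter_def, THEN conjunct2, THEN conjunct2, THEN conjunct1], of y] by simp

lemma alt_Baxter_odd: "\<lbrakk>1 \<le> y; y \<le> N; odd y\<rbrakk> \<Longrightarrow> odd (f y)"
  using bspec[OF A[unfolded alt_Baxter_def, THEN conjunct2, THEN conjunct2, THEN conjunct1], of y] by simp

lemma even_mod_4_iff: "even (n mod 4) \<longleftrightarrow> even n" for n :: nat
  by (simp add: dvd_mod_iff)

lemma alt_Baxter_parity: "\<lbrakk>1 \<le> y; y \<le> N\<rbrakk> \<Longrightarrow> even (f y) \<longleftrightarrow> even y"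
  using alt_Baxter_odd[of y] alt_Baxter_even[of y] by (metis even_mod_4_iff)

lemma alt_Baxter_even_value: "\<lbrakk>1 \<le> y; y \<le> N; even (f y)\<rbrakk> \<Longrightarrow> f y mod 4 = y mod 4"
  using alt_Baxter_even[of y] alt_Baxter_parity[of y] by auto

lemma alt_Baxter_below: "\<lbrakk>1 \<le> x; x \<le> N; 1 \<le> y; y \<le> N; even (f y); f y = f x + 1\<rbrakk> \<Longrightarrow>
        (if f y mod 4 = 2 then x < y else y < x) \<and> (\<forall>z. between x z y \<longrightarrow> f z < f y)"
  by (rule A[unfolded alt_Baxter_def, THEN conjunct2, THEN conjunct2, THEN conjunct2, THEN conjunct1,
        THEN bspec, THEN bspec, THEN mp]) auto

lemma alt_Baxter_above: "\<lbrakk>1 \<le> x; x \<le> N; 1 \<le> y; y \<le> N; even (f x); f y = f x + 1\<rbrakk> \<Longrightarrow>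
        (if f x mod 4 = 2 then x < y else y < x) \<and> (\<forall>z. between x z y \<longrightarrow> f x < f z)"
  by (rule A[unfolded alt_Baxter_def, THEN conjunct2, THEN conjunct2, THEN conjunct2, THEN conjunct2,
        THEN bspec, THEN bspec, THEN mp]) auto

end

lemma alt_Baxter_cong:
  assumes "alt_Baxter N f" "\<And>x. \<lbrakk>1 \<le> x; x \<le> N\<rbrakk> \<Longrightarrow> g x = f x"
  shows "alt_Baxter N g"
proof (rule alt_BaxterI)
  note A = assms(1) and e = assms(2)
  show "N mod 4 = 3" by (rule alt_Baxter_mod[OF A])
  show "inj_on g {1..N}" 
    using alt_Baxter_inj[OF A] e unfolding inj_on_def by (metis atLeastAtMost_iff)
  show "1 \<le> g x \<and> g x \<le> N" if "1 \<le> x" "x \<le> N" for x using that alt_Baxter_range[OF A] e by simp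
  show "g y mod 4 = y mod 4" if "1 \<le> y" "y \<le> N" "even y" for y using that alt_Baxter_even[OF A] e by simp
  show "odd (g y)" if "1 \<le> y" "y \<le> N" "odd y" for y using that alt_Baxter_odd[OF A] e by simp
next
  fix x y assume h: "1 \<le> x" "x \<le> N" "1 \<le> y" "y \<le> N" "even (g y)" "g y = g x + 1"
  have "g z = f z" if "between x z y" for z
    by (rule assms(2)) (use that h(1-4) in \<open>auto simp: between_def\<close>)
  then show "(if g y mod 4 = 2 then x < y else y < x) \<and> (\<forall>z. between x z y \<longrightarrow> g z < g y)"
    using alt_Baxter_below[OF assms(1) h(1-4)] h(5,6) unfolding assms(2)[OF h(1,2)] assms(2)[OF h(3,4)] by simp
next
  fix x y assume h: "1 \<le> x" "x \<le> N" "1 \<le> y" "y \<le> N" "even (g x)" "g y = g x + 1"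
  have "g z = f z" if "between x z y" for z
    by (rule assms(2)) (use that h(1-4) in \<open>auto simp: between_def\<close>)
  then show "(if g x mod 4 = 2 then x < y else y < x) \<and> (\<forall>z. between x z y \<longrightarrow> g x < g z)"
    using alt_Baxter_above[OF assms(1) h(1-4)] h(5,6) unfolding assms(2)[OF h(1,2)] assms(2)[OF h(3,4)] by simp
qed

text \<open>
As \<open>N + 1\<close> is a multiple of 4, a half turn of the diagram fixes the residues 0 and 2 modulo 4. It
exchanges \<open>w - 1\<close> with \<open>w + 1\<close>, smaller with larger and left with right, so the two
separation conditions turn into each other.
\<close>

lemma alt_Baxter_reverse_complement:
  assumes A: "alt_Baxter N f"
  shows "alt_Baxter N (\<lambda>x. N + 1 - f (N + 1 - x))" (is "alt_Baxter N ?g")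
proof (rule alt_BaxterI)
  note m = alt_Baxter_mod[OF A]
  have oN: "odd N" using m by presburger
  show "N mod 4 = 3" by (rule m)
  have r: "1 \<le> f (N+1-x)" "f (N+1-x) \<le> N" if "1 \<le> x" "x \<le> N" for x
    using alt_Baxter_range[OF A, of "N+1-x"] that by auto
  show "inj_on ?g {1..N}"
  proof (rule inj_onI)
    fix x y assume h: "x \<in> {1..N}" "y \<in> {1..N}" "?g x = ?g y"
    then have "f (N+1-x) = f (N+1-y)" using complement_eq_iff[OF r(2) r(2), of x y] by simp
    then have "N+1-x = N+1-y" by (rule alt_Baxter_inj[OF A]) (use h in auto)
    then show "x = y" using h by auto
  qed
  show "1 \<le> ?g x \<and> ?g x \<le> N" if "1 \<le> x" "x \<le> N" for x
    using complement_le[OF r(2)[OF that] le_refl] complement_ge[OF r(2)[OF that] le_refl r(1)[OF that]] by blast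
  show "?g y mod 4 = y mod 4" if h: "1 \<le> y" "y \<le> N" "even y" for y
  proof -
    have e: "even (N+1-y)" using h oN complement_even by blast
    have "f (N+1-y) mod 4 = (N+1-y) mod 4" by (rule alt_Baxter_even[OF A _ _ e]) (use h in auto)
    then have "?g y mod 4 = (4 - (4 - y mod 4) mod 4) mod 4"
      using complement_mod4[OF m r(2)[OF h(1,2)]] complement_mod4[OF m h(2)] by simp
    moreover have "(4 - (4 - r) mod 4) mod 4 = r" if "r < 4" for r :: nat
      using that by (cases "r = 0") auto
    ultimately show ?thesis by simp
  qed
  show "odd (?g y)" if h: "1 \<le> y" "y \<le> N" "odd y" for y
  proof -
    have e: "odd (N+1-y)" using h oN complement_even by blast
    have "odd (f (N+1-y))" by (rule alt_Baxter_odd[OF A _ _ e]) (use h in auto)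
    then show ?thesis using complement_even[OF oN r(2)[OF h(1,2)]] by blast
  qed
  fix x y assume h: "1 \<le> x" "x \<le> N" "1 \<le> y" "y \<le> N" "?g y = ?g x + 1"
  have e: "f (N+1-x) = f (N+1-y) + 1" 
    using h(5) complement_Suc[OF r(2)[OF h(3,4)] r(2)[OF h(1,2)]] by blast
  have b: "between (N+1-y) (N+1-z) (N+1-x)" if "between x z y" for z
    using that h(1-4) by (auto simp: between_def)
  have rz: "f (N+1-z) \<le> N" if "between x z y" for z
    using that h(1-4) by (intro r) (auto simp: between_def)
  have md: "?g u mod 4 = 2 \<longleftrightarrow> f (N+1-u) mod 4 = 2" if "1 \<le> u" "u \<le> N" for u
  proof -
    have "(4 - v) mod 4 = 2 \<longleftrightarrow> v = 2" if "v < 4" for v :: nat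
      using that by (cases "v = 0") auto
    then show ?thesis using complement_mod4[OF m r(2)[OF that]] by simp
  qed
  have ord: "N+1-u < N+1-v \<longleftrightarrow> v < u" if "u \<le> N" "v \<le> N" for u v
    using complement_less_iff[OF that] .
  have flip: "?g u < ?g v \<longleftrightarrow> f (N+1-v) < f (N+1-u)"
    if "f (N+1-u) \<le> N" "f (N+1-v) \<le> N" for u v using complement_less_iff[OF that] .
  {
    assume "even (?g y)"
    then have "even (f (N+1-y))" using complement_even[OF oN r(2)[OF h(3,4)]] by blast
    from alt_Baxter_above[OF A _ _ _ _ this e] h
    have *: "(if f (N+1-y) mod 4 = 2 then N+1-y < N+1-x else N+1-x < N+1-y)"
       "\<And>z. between (N+1-y) z (N+1-x) \<Longrightarrow> f (N+1-y) < f z" by auto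
    have "?g z < ?g y" if "between x z y" for z
      using *(2)[OF b[OF that]] flip[OF rz[OF that] r(2)[OF h(3,4)]] by blast
    then show "(if ?g y mod 4 = 2 then x < y else y < x) \<and> (\<forall>z. between x z y \<longrightarrow> ?g z < ?g y)"
      using *(1) unfolding md[OF h(3,4)] ord[OF h(2,4)] ord[OF h(4,2)] by blast
  }
  {
    assume "even (?g x)"
    then have "even (f (N+1-x))" using complement_even[OF oN r(2)[OF h(1,2)]] by blast
    from alt_Baxter_below[OF A _ _ _ _ this e] h
    have *: "(if f (N+1-x) mod 4 = 2 then N+1-y < N+1-x else N+1-x < N+1-y)"
       "\<And>z. between (N+1-y) z (N+1-x) \<Longrightarrow> f z < f (N+1-x)" by auto
    have "?g x < ?g z" if "between x z y" for z
      using *(2)[OF b[OF that]] flip[OF r(2)[OF h(1,2)] rz[OF that]] by blast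
    then show "(if ?g x mod 4 = 2 then x < y else y < x) \<and> (\<forall>z. between x z y \<longrightarrow> ?g x < ?g z)"
      using *(1) unfolding md[OF h(1,2)] ord[OF h(2,4)] ord[OF h(4,2)] by blast
  }
qed

section \<open>The first entry splits an alternating Baxter function\<close>

text \<open>
In an alternating Baxter function the sum of these weights over some entries is the number of even
values at ascents minus the number of even values at descents.
\<close>

definition balance :: "nat \<Rightarrow> int" where
  "balance v = (if v mod 4 = 2 then 1 else if v mod 4 = 0 then - 1 else 0)"

lemma sum_balance: "(\<Sum>x = 1..<4 * Suc m. balance x) = 1"
proof (induction m)
  case 0
  have "{1..<4 * Suc 0} = {1, 2, 3::nat}" by auto
  then show ?case by (simp add: balance_def)
next
  case (Suc m)
  have "{1..<4 * Suc (Suc m)} =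
      {1..<4 * Suc m} \<union> {4*m+4, 4*m+5, 4*m+6, 4*m+7}" by auto
  also have "(\<Sum>x\<in>\<dots>. balance x) = (\<Sum>x = 1..<4 * Suc m. balance x)
      + (\<Sum>x\<in>{4*m+4, 4*m+5, 4*m+6, 4*m+7}. balance x)"
    by (rule sum.union_disjoint) auto
  also have "(\<Sum>x\<in>{4*m+4, 4*m+5, 4*m+6, 4*m+7}. balance x) = 0"
    by (simp add: balance_def mod_Suc)
  finally show ?case using Suc by simp
qed

text \<open>
Gaps cost balance. Decompose \<open>V\<close> into maximal intervals. Each interval ends just before a number
that is 2 modulo 4, or at \<open>N\<close>; each interval other than the first begins at a multiple of 4. So the
first interval has balance 0 if it stops before \<open>N\<close>, and every later one has balance \<open>-1\<close>, or 0 if it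
reaches \<open>N\<close>. The total 1 arises only from \<open>{s..N}\<close> itself.
\<close>

lemma alternating_gaps_filled:
  assumes st: "s mod 4 = 1" "N mod 4 = 3" "s \<le> N" "V \<subseteq> {s..N}" "s \<in> V"
    and leave: "\<And>v. \<lbrakk>s \<le> v; v < N; v \<in> V; Suc v \<notin> V\<rbrakk> \<Longrightarrow> Suc v mod 4 = 2"
    and enter: "\<And>v. \<lbrakk>s \<le> v; v < N; v \<notin> V; Suc v \<in> V\<rbrakk> \<Longrightarrow> Suc v mod 4 = 0"
    and total: "(\<Sum>v\<in>V. balance v) = 1"
  shows "V = {s..N}"
proof -
  define F where "F k = (\<Sum>v\<in>V \<inter> {s..k}. balance v)" for k
  \<comment> \<open>The value 1 is reached only while no number is missing; after the first gap the balance
    is at most 0, and smaller by one inside an interval that still needs a number that is 2 modulo 4.\<close>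
  define I where "I k \<longleftrightarrow> {s..k} \<subseteq> V \<and> F k = (if k mod 4 \<in> {2, 3} then 1 else 0) \<or>
      \<not> {s..k} \<subseteq> V \<and> F k \<le> (if k \<in> V \<and> k mod 4 \<in> {0, 1} then - 1 else 0)" for k
  have F_Suc: "F (Suc k) = F k + (if Suc k \<in> V then balance (Suc k) else 0)" if "s \<le> k" for k
  proof -
    have "V \<inter> {s..Suc k} = (if Suc k \<in> V then insert (Suc k) (V \<inter> {s..k}) else V \<inter> {s..k})"
      using that by (auto simp: le_Suc_eq)
    then show ?thesis by (simp add: F_def)
  qed
  have "k \<le> N \<longrightarrow> I k" if "s \<le> k" for k
    using that
  proof (induction k rule: dec_induct)
    case base
    have "V \<inter> {s..s} = {s}" using st by auto
    then show ?case using st by (simp add: I_def F_def balance_def)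
  next
    case (step k)
    show ?case
    proof
      assume k: "Suc k \<le> N"
      then have I: "I k" using step by simp
      have full: "{s..Suc k} \<subseteq> V \<longleftrightarrow> {s..k} \<subseteq> V \<and> Suc k \<in> V"
        using step(1) by (auto simp: le_Suc_eq)
      have kV: "k \<in> V" if "{s..k} \<subseteq> V" using that step(1) by auto
      have l: "Suc k mod 4 = 2" if "k \<in> V" "Suc k \<notin> V" using leave that k step(1) by simp
      have e: "Suc k mod 4 = 0" if "k \<notin> V" "Suc k \<in> V" using enter that k step(1) by simp
      consider "k mod 4 = 0" "Suc k mod 4 = 1" | "k mod 4 = 1" "Suc k mod 4 = 2"
        | "k mod 4 = 2" "Suc k mod 4 = 3" | "k mod 4 = 3" "Suc k mod 4 = 0"
        by (simp add: mod_Suc) linarith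
      then show "I (Suc k)"
        using I l e kV unfolding I_def full F_Suc[OF step(1)] balance_def
        by cases (simp_all split: if_splits, (blast | linarith)+)
    qed
  qed
  then have "I N" using st by simp
  moreover have "V \<inter> {s..N} = V" using st by auto
  then have "F N = 1" using total by (simp add: F_def)
  ultimately have "{s..N} \<subseteq> V" using st by (simp add: I_def split: if_splits)
  then show ?thesis using st by auto
qed

text \<open>
Let \<open>P\<close> be the position of the value \<open>f 1 - 1\<close>, or \<open>N + 1\<close> if \<open>f 1 = 1\<close>. Separation at this even
value leaves only larger entries before \<open>P\<close>; the point is that all larger entries are there. If
exactly one of two consecutive values \<open>v\<close>, \<open>v + 1\<close> above \<open>f 1 - 1\<close> stands before \<open>P\<close>, then the small
entry at \<open>P\<close> lies between them. This excludes that \<open>v\<close> is even, and the residue of \<open>v + 1\<close> tells which of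
the two comes first. So the values before \<open>P\<close> have gaps as in \<open>alternating_gaps_filled\<close>, and their
balance equals that of the positions before \<open>P\<close>, which is 1.
\<close>

lemma first_entry_splits:
  assumes A: "alt_Baxter N f"
  obtains P where "P mod 4 = 0" "4 \<le> P" "P \<le> N + 1" "P + f 1 = N + 2"
    "\<And>x. \<lbrakk>1 \<le> x; x < P\<rbrakk> \<Longrightarrow> f 1 \<le> f x" "\<And>x. \<lbrakk>P \<le> x; x \<le> N\<rbrakk> \<Longrightarrow> f x < f 1"
    "P \<le> N \<Longrightarrow> f P + 1 = f 1" "f 1 mod 4 = 1"
proof -
  define s where "s = f 1"
  have N: "N mod 4 = 3" by (rule alt_Baxter_mod[OF A])
  then have N3: "3 \<le> N" using mod_less_eq_dividend[of N 4] by simp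
  have s: "1 \<le> s" "s \<le> N" using alt_Baxter_range[OF A, of 1] N3 by (auto simp: s_def)
  have odd_s: "odd s" using alt_Baxter_odd[OF A, of 1] N3 by (simp add: s_def)
  have "\<exists>P. P mod 4 = 0 \<and> 4 \<le> P \<and> P \<le> N + 1 \<and> s mod 4 = 1 \<and> (P \<le> N \<longrightarrow> f P + 1 = s) \<and>
      (\<forall>x. 1 \<le> x \<and> x < P \<longrightarrow> s \<le> f x)"
  proof (cases "s = 1")
    case True
    then have "\<forall>x. 1 \<le> x \<and> x < N + 1 \<longrightarrow> s \<le> f x" using alt_Baxter_range[OF A] by simp
    moreover have "(N + 1) mod 4 = 0" using N by (simp add: mod_Suc)
    ultimately show ?thesis using N3 True by (intro exI[of _ "N + 1"]) auto
  next
    case False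
    have "1 \<le> s - 1" "s - 1 \<le> N" using s False by auto
    then obtain P where P: "1 \<le> P" "P \<le> N" "f P = s - 1" using alt_Baxter_position[OF A] by blast
    have ev: "even (f P)" using P odd_s s by simp
    have e: "f 1 = f P + 1" using P s by (simp add: s_def)
    have ab: "(if f P mod 4 = 2 then P < 1 else 1 < P)" "\<And>z. between P z 1 \<Longrightarrow> f P < f z"
      using alt_Baxter_above[OF A P(1,2) _ _ ev e] N3 by auto
    have fP: "f P mod 4 = 0" using ab(1) P(1) ev by (simp split: if_splits) presburger
    have P0: "P mod 4 = 0" using alt_Baxter_even_value[OF A P(1,2) ev] fP by simp
    then have P4: "4 \<le> P" using P(1) mod_less_eq_dividend[of P 4] by (cases "P < 4") auto
    have "s \<le> f x" if "1 \<le> x" "x < P" for x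
      using ab(2)[of x] that P(3) s by (cases "x = 1") (auto simp: between_def s_def)
    moreover have "s mod 4 = 1" using fP e by (simp add: s_def mod_Suc)
    ultimately show ?thesis using P P0 P4 s by (intro exI[of _ P]) auto
  qed
  then obtain P where X: "P mod 4 = 0 \<and> 4 \<le> P \<and> P \<le> N + 1 \<and> s mod 4 = 1 \<and> (P \<le> N \<longrightarrow> f P + 1 = s) \<and>
      (\<forall>x. 1 \<le> x \<and> x < P \<longrightarrow> s \<le> f x)" by (rule exE)
  then have P: "P mod 4 = 0" "4 \<le> P" "P \<le> N + 1" and s1: "s mod 4 = 1" by simp_all
  have fP: "f P + 1 = s" if "P \<le> N" using X that by blast
  have ge: "s \<le> f x" if "1 \<le> x" "x < P" for x using X that by blast
  define V where "V = f ` {1..<P}"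
  have inV: "x < P" if "f x \<in> V" "1 \<le> x" "x \<le> N" for x
  proof -
    obtain y where y: "1 \<le> y" "y < P" "f x = f y" using \<open>f x \<in> V\<close> by (auto simp: V_def)
    then have "y \<le> N" using P by linarith
    then have "x = y" using alt_Baxter_inj[OF A y(3) that(2,3) y(1)] by blast
    then show ?thesis using y by simp
  qed
  have inV2: "f x \<in> V" if "1 \<le> x" "x < P" for x using that by (simp add: V_def)
  have inj: "inj_on f {1..<P}" using P by (intro inj_on_subset[OF bij_betw_imp_inj_on[OF alt_Baxter_bij[OF A]]]) auto
  have V: "V \<subseteq> {s..N}" using ge alt_Baxter_range[OF A] P by (fastforce simp: V_def)
  have cross: "(v \<in> V \<longrightarrow> Suc v mod 4 = 2) \<and> (v \<notin> V \<longrightarrow> Suc v mod 4 = 0)"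
    if v: "s \<le> v" "v < N" and c: "v \<in> V \<longleftrightarrow> Suc v \<notin> V" for v
  proof -
    have "1 \<le> v" "v \<le> N" "1 \<le> Suc v" "Suc v \<le> N" using v s by auto
    then obtain x y where x: "1 \<le> x" "x \<le> N" "f x = v" and y: "1 \<le> y" "y \<le> N" "f y = Suc v"
      using alt_Baxter_position[OF A] by meson
    have xV: "v \<in> V \<longleftrightarrow> x < P" using inV[of x] inV2[of x] x by auto
    have yV: "Suc v \<in> V \<longleftrightarrow> y < P" using inV[of y] inV2[of y] y by auto
    have "P \<le> N" using xV yV c x y P by linarith
    then have fP': "f P < s" using fP by simp
    then have "x \<noteq> P" "y \<noteq> P" using x y v by auto
    then have b: "between x P y" using xV yV c by (auto simp: between_def)
    have "odd v"
      using alt_Baxter_above[OF A x(1,2) y(1,2)] x y b fP' v by (metis Suc_eq_plus1 leD less_le_trans less_imp_le)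
    then have "even (f y)" using y by simp
    then have o: "if Suc v mod 4 = 2 then x < y else y < x"
      using alt_Baxter_below[OF A x(1,2) y(1,2)] x y by simp
    have "Suc v mod 4 = 0 \<or> Suc v mod 4 = 2" using \<open>odd v\<close> by presburger
    then show ?thesis using o xV yV c by (auto split: if_splits)
  qed
  \<comment> \<open>Positions and values of even entries agree modulo 4, so the balance can be taken over positions.\<close>
  have "sum balance V = (\<Sum>x = 1..<P. balance (f x))"
    unfolding V_def using sum.reindex[OF inj, of balance] by (simp only: comp_def)
  also have "\<dots> = (\<Sum>x = 1..<P. balance x)"
  proof (intro sum.cong refl)
    fix x assume x: "x \<in> {1..<P}"
    then have x': "1 \<le> x" "x \<le> N" using P by auto
    show "balance (f x) = balance x"
    proof (cases "even x")
      case True then show ?thesis using alt_Baxter_even[OF A x'] by (simp add: balance_def)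
    next
      case False
      then have "odd (f x)" by (rule alt_Baxter_odd[OF A x'])
      then show ?thesis using False by (simp add: balance_def) presburger
    qed
  qed
  also have "P = 4 * Suc (P div 4 - 1)" using P by auto
  then have "(\<Sum>x = 1..<P. balance x) = 1" using sum_balance by metis
  finally have tot: "sum balance V = 1" .
  have "s \<in> V" using P(2) by (auto simp: V_def s_def)
  have Veq: "V = {s..N}"
  proof (rule alternating_gaps_filled[OF s1 N s(2) V \<open>s \<in> V\<close> _ _ tot])
    show "Suc v mod 4 = 2" if "s \<le> v" "v < N" "v \<in> V" "Suc v \<notin> V" for v
      using cross[of v] that by blast
    show "Suc v mod 4 = 0" if "s \<le> v" "v < N" "v \<notin> V" "Suc v \<in> V" for v
      using cross[of v] that by blast
  qed
  have "card V = P - 1" using inj by (simp add: V_def card_image)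
  then have size: "P + s = N + 2" using Veq P s by simp
  show ?thesis
  proof (rule that[OF P])
    show "f x < f 1" if "P \<le> x" "x \<le> N" for x
    proof (rule ccontr)
      assume "\<not> f x < f 1"
      then have "f x \<in> V" using alt_Baxter_range[OF A, of x] that P Veq by (simp add: s_def)
      then show False using inV[of x] that P by simp
    qed
  qed (use size ge fP s1 in \<open>simp_all add: s_def\<close>)
qed

section \<open>Blocks of alternating Baxter functions\<close>

lemma
  fixes a b :: nat
  assumes "b mod 4 = 0"
  shows add_mod4: "(a + b) mod 4 = a mod 4" and even_add_mod4: "even (a + b) \<longleftrightarrow> even a"
    and sub_mod4: "b \<le> a \<Longrightarrow> (a - b) mod 4 = a mod 4" and even_sub_mod4: "b \<le> a \<Longrightarrow> even (a - b) \<longleftrightarrow> even a"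
proof -
  obtain c where b: "b = 4 * c" using assms by auto
  show "(a + b) mod 4 = a mod 4" "even (a + b) \<longleftrightarrow> even a" by (simp_all add: b)
  show "(a - b) mod 4 = a mod 4" "even (a - b) \<longleftrightarrow> even a" if "b \<le> a"
    using that unfolding b by (metis le_add_diff_inverse2 mod_mult_self2, simp)
qed

text \<open>
Shifts by multiples of 4 preserve all congruences, so consecutive positions that carry consecutive
values form an alternating Baxter function again.
\<close>

lemma alt_Baxter_restrict:
  assumes A: "alt_Baxter N f" and ab: "a mod 4 = 0" "b mod 4 = 0" and M: "M mod 4 = 3" "M + a \<le> N"
    and r: "\<And>x. \<lbrakk>1 \<le> x; x \<le> M\<rbrakk> \<Longrightarrow> b < f (x + a) \<and> f (x + a) \<le> b + M"
  shows "alt_Baxter M (\<lambda>x. f (x + a) - b)" (is "alt_Baxter M ?g")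
proof (rule alt_BaxterI)
  have g: "f (x + a) = ?g x + b" if "1 \<le> x" "x \<le> M" for x using r[OF that] by simp
  have p: "1 \<le> x + a" "x + a \<le> N" if "1 \<le> x" "x \<le> M" for x using that M by auto
  have gm: "?g x mod 4 = f (x + a) mod 4" "even (?g x) \<longleftrightarrow> even (f (x + a))" if "1 \<le> x" "x \<le> M" for x
    using r[OF that] by (simp_all only: sub_mod4[OF ab(2)] even_sub_mod4[OF ab(2)] less_imp_le)
  show "M mod 4 = 3" by fact
  show "inj_on ?g {1..M}"
  proof (rule inj_onI)
    fix x y assume h: "x \<in> {1..M}" "y \<in> {1..M}" "?g x = ?g y"
    then have "f (x + a) = f (y + a)" using g[of x] g[of y] by simp
    then have "x + a = y + a" by (rule alt_Baxter_inj[OF A]) (use h M in auto)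
    then show "x = y" by simp
  qed
  show "1 \<le> ?g x \<and> ?g x \<le> M" if "1 \<le> x" "x \<le> M" for x using r[OF that] by auto
  show "?g y mod 4 = y mod 4" if h: "1 \<le> y" "y \<le> M" "even y" for y
    using alt_Baxter_even[OF A p[OF h(1,2)]] h(3) unfolding gm[OF h(1,2)] add_mod4[OF ab(1)] even_add_mod4[OF ab(1)] by blast
  show "odd (?g y)" if h: "1 \<le> y" "y \<le> M" "odd y" for y
    using alt_Baxter_odd[OF A p[OF h(1,2)]] h(3) unfolding gm[OF h(1,2)] even_add_mod4[OF ab(1)] by blast
  fix x y assume h: "1 \<le> x" "x \<le> M" "1 \<le> y" "y \<le> M" and "?g y = ?g x + 1"
  then have s: "f (y + a) = f (x + a) + 1" using g[OF h(1,2)] g[OF h(3,4)] by simp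
  have b: "between (x + a) (z + a) (y + a)" "1 \<le> z" "z \<le> M" if "between x z y" for z
    using that h by (auto simp: between_def)
  have less: "?g u < ?g v \<longleftrightarrow> f (u + a) < f (v + a)" if "1 \<le> u" "u \<le> M" "1 \<le> v" "v \<le> M" for u v
    using r[OF that(1,2)] r[OF that(3,4)] by linarith
  {
    assume "even (?g y)"
    then have "even (f (y + a))" using gm[OF h(3,4)] by simp
    note * = alt_Baxter_below[OF A p[OF h(1,2)] p[OF h(3,4)] this s]
    have "?g z < ?g y" if "between x z y" for z using * b[OF that] less[OF b(2,3)[OF that] h(3,4)] by blast
    then show "(if ?g y mod 4 = 2 then x < y else y < x) \<and> (\<forall>z. between x z y \<longrightarrow> ?g z < ?g y)"
      using conjunct1[OF *] unfolding gm[OF h(3,4)] add_less_cancel_right by blast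
  }
  {
    assume "even (?g x)"
    then have "even (f (x + a))" using gm[OF h(1,2)] by simp
    note * = alt_Baxter_above[OF A p[OF h(1,2)] p[OF h(3,4)] this s]
    have "?g x < ?g z" if "between x z y" for z using * b[OF that] less[OF h(1,2) b(2,3)[OF that]] by blast
    then show "(if ?g x mod 4 = 2 then x < y else y < x) \<and> (\<forall>z. between x z y \<longrightarrow> ?g x < ?g z)"
      using conjunct1[OF *] unfolding gm[OF h(1,2)] add_less_cancel_right by blast
  }
qed

text \<open>
Shifting positions by 2 exchanges the residues 0 and 2 of even positions, and complementing the
values exchanges them for even values. Complementation also reverses the order of values, which
swaps the two separation conditions.
\<close>

lemma alt_Baxter_core:
  assumes A: "alt_Baxter N f" and M: "N = M + 4" "M mod 4 = 3"
    and r: "\<And>x. \<lbrakk>1 \<le> x; x \<le> M\<rbrakk> \<Longrightarrow> 3 \<le> f (x + 2) \<and> f (x + 2) \<le> M + 2"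
  shows "alt_Baxter M (\<lambda>x. M + 3 - f (x + 2))" (is "alt_Baxter M ?g")
proof (rule alt_BaxterI)
  have p: "1 \<le> x + 2" "x + 2 \<le> N" if "1 \<le> x" "x \<le> M" for x using that M by auto
  have g: "?g x + f (x + 2) = M + 3" if "1 \<le> x" "x \<le> M" for x using r[OF that] by simp
  have sum2: "u mod 4 = 2 \<longleftrightarrow> v mod 4 = 0" "even u \<longleftrightarrow> even v" if "u + v = M + 3" for u v
    using that M(2) by presburger+
  note ge = sum2[OF g]
  have e: "u mod 4 = 2 \<longleftrightarrow> u mod 4 \<noteq> 0" if "even u" for u :: nat using that by presburger
  show "M mod 4 = 3" by (rule M)
  show "inj_on ?g {1..M}"
  proof (rule inj_onI)
    fix x y assume h: "x \<in> {1..M}" "y \<in> {1..M}" "?g x = ?g y"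
    then have "f (x + 2) = f (y + 2)" using g[of x] g[of y] by simp
    then have "x + 2 = y + 2" by (rule alt_Baxter_inj[OF A]) (use h M in auto)
    then show "x = y" by simp
  qed
  show "1 \<le> ?g x \<and> ?g x \<le> M" if "1 \<le> x" "x \<le> M" for x using r[OF that] by auto
  show "?g y mod 4 = y mod 4" if h: "1 \<le> y" "y \<le> M" "even y" for y
  proof -
    have "f (y + 2) mod 4 = (y + 2) mod 4" using alt_Baxter_even[OF A p[OF h(1,2)]] h(3) by simp
    moreover have "(y + 2) mod 4 = 0 \<longleftrightarrow> y mod 4 = 2" by presburger
    ultimately have "?g y mod 4 = 2 \<longleftrightarrow> y mod 4 = 2" using ge(1)[OF h(1,2)] by simp
    moreover have "even (?g y)" using ge(2)[OF h(1,2)] alt_Baxter_parity[OF A p[OF h(1,2)]] h(3) by simp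
    ultimately show ?thesis using e[of "?g y"] e[OF h(3)] by argo
  qed
  show "odd (?g y)" if h: "1 \<le> y" "y \<le> M" "odd y" for y
    using alt_Baxter_odd[OF A p[OF h(1,2)]] h(3) ge(2)[OF h(1,2)] by simp
  fix x y assume h: "1 \<le> x" "x \<le> M" "1 \<le> y" "y \<le> M" and "?g y = ?g x + 1"
  then have s: "f (x + 2) = f (y + 2) + 1" using g[OF h(1,2)] g[OF h(3,4)] by linarith
  have b: "between (y + 2) (z + 2) (x + 2)" "1 \<le> z" "z \<le> M" if "between x z y" for z
    using that h by (auto simp: between_def)
  have less: "?g u < ?g v \<longleftrightarrow> f (v + 2) < f (u + 2)" if "1 \<le> u" "u \<le> M" "1 \<le> v" "v \<le> M" for u v
    using g[OF that(1,2)] g[OF that(3,4)] by linarith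
  {
    assume ev0: "even (?g y)"
    then have ev: "even (f (y + 2))" using ge(2)[OF h(3,4)] by blast
    note * = alt_Baxter_above[OF A p[OF h(3,4)] p[OF h(1,2)] ev s]
    have "?g z < ?g y" if "between x z y" for z using * b[OF that] less[OF b(2,3)[OF that] h(3,4)] by blast
    then show "(if ?g y mod 4 = 2 then x < y else y < x) \<and> (\<forall>z. between x z y \<longrightarrow> ?g z < ?g y)"
      using conjunct1[OF *] unfolding ge(1)[OF h(3,4)] e[OF ev] add_less_cancel_right by argo
  }
  {
    assume ev0: "even (?g x)"
    then have ev: "even (f (x + 2))" using ge(2)[OF h(1,2)] by blast
    note * = alt_Baxter_below[OF A p[OF h(3,4)] p[OF h(1,2)] ev s]
    have "?g x < ?g z" if "between x z y" for z using * b[OF that] less[OF h(1,2) b(2,3)[OF that]] by blast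
    then show "(if ?g x mod 4 = 2 then x < y else y < x) \<and> (\<forall>z. between x z y \<longrightarrow> ?g x < ?g z)"
      using conjunct1[OF *] unfolding ge(1)[OF h(1,2)] e[OF ev] add_less_cancel_right by argo
  }
qed

section \<open>Assembling alternating Baxter functions\<close>

text \<open>
The two blocks are joined by the entry \<open>K + 1\<close>. Position and value of this entry are multiples of 4,
as the crossing from \<open>K + 2\<close> in the upper left block down to \<open>K\<close> in the lower right block requires.
\<close>

lemma alt_Baxter_skew:
  assumes A: "alt_Baxter M f" and B: "alt_Baxter K g"
  shows "alt_Baxter (M + 1 + K)
    (\<lambda>x. if x \<le> M then f x + (K + 1) else if x = M + 1 then K + 1 else g (x - (M + 1)))"
    (is "alt_Baxter ?N ?h")
proof -
  define h where "h = ?h"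
  have top: "h x = f x + (K + 1)" if "x \<le> M" for x using that by (simp add: h_def)
  have mid: "h (M + 1) = K + 1" by (simp add: h_def)
  have bot: "h (x + (M + 1)) = g x" if "1 \<le> x" for x using that by (simp add: h_def)
  have "alt_Baxter ?N h"
  proof (rule alt_BaxterI)
  have M: "M mod 4 = 3" "(M + 1) mod 4 = 0" using alt_Baxter_mod[OF A] by (simp_all add: mod_Suc)
  have K: "K mod 4 = 3" "(K + 1) mod 4 = 0" using alt_Baxter_mod[OF B] by (simp_all add: mod_Suc)
  have evK: "even (K + 1)" "odd K" using K(1) by presburger+
  have evM: "even (M + 1)" using M(1) by presburger
  have topr: "K + 1 < h x" if "1 \<le> x" "x \<le> M" for x using alt_Baxter_range[OF A that] top[OF that(2)] by simp
  have botr: "h (x + (M + 1)) \<le> K" "1 \<le> h (x + (M + 1))" if "1 \<le> x" "x \<le> K" for x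
    using alt_Baxter_range[OF B that] bot[OF that(1)] by simp_all
  have cases: thesis if "1 \<le> x" "x \<le> ?N" "x \<le> M \<Longrightarrow> thesis" "x = M + 1 \<Longrightarrow> thesis"
      "\<And>u. \<lbrakk>x = u + (M + 1); 1 \<le> u; u \<le> K\<rbrakk> \<Longrightarrow> thesis" for x thesis
    using that by (cases "x \<le> M + 1"; cases "x \<le> M") (auto dest!: meta_spec[of _ "x - (M + 1)"])
  show "?N mod 4 = 3" using M K by (metis add_mod4 add.commute)
  show "inj_on h {1..?N}"
  proof (rule inj_onI)
    fix x y assume "x \<in> {1..?N}" "y \<in> {1..?N}" and e: "h x = h y"
    then have x: "1 \<le> x" "x \<le> ?N" and y: "1 \<le> y" "y \<le> ?N" by auto
    show "x = y"
    proof (rule cases[OF x]; rule cases[OF y])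
      show "x \<le> M \<Longrightarrow> y \<le> M \<Longrightarrow> x = y" using e top[of x] top[of y] alt_Baxter_inj[OF A _ x(1) _ y(1)] by simp
      show "x \<le> M \<Longrightarrow> y = M + 1 \<Longrightarrow> x = y" using e topr[OF x(1)] mid by simp
      show "x = M + 1 \<Longrightarrow> y \<le> M \<Longrightarrow> x = y" using e topr[OF y(1)] mid by simp
      show "x = M + 1 \<Longrightarrow> y = M + 1 \<Longrightarrow> x = y" by simp
      fix u assume u: "x = u + (M + 1)" "1 \<le> u" "u \<le> K"
      then have hu: "h x \<le> K" using botr by simp
      show "y \<le> M \<Longrightarrow> x = y" using hu e topr[OF y(1)] by simp
      show "y = M + 1 \<Longrightarrow> x = y" using hu e mid by simp
      fix v assume v: "y = v + (M + 1)" "1 \<le> v" "v \<le> K"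
      then have "g u = g v" using e u bot by simp
      then show "x = y" using alt_Baxter_inj[OF B _ u(2,3) v(2,3)] u v by simp
    next
      fix v assume v: "y = v + (M + 1)" "1 \<le> v" "v \<le> K"
      then have hv: "h y \<le> K" using botr by simp
      show "x \<le> M \<Longrightarrow> x = y" using hv e topr[OF x(1)] by simp
      show "x = M + 1 \<Longrightarrow> x = y" using hv e mid by simp
    qed
  qed
  show "1 \<le> h x \<and> h x \<le> ?N" if "1 \<le> x" "x \<le> ?N" for x
  proof (rule cases[OF that])
    show "x \<le> M \<Longrightarrow> ?thesis" using top[of x] alt_Baxter_range[OF A that(1)] by simp
    show "x = M + 1 \<Longrightarrow> ?thesis" using mid by simp
    show ?thesis if "x = u + (M + 1)" "1 \<le> u" "u \<le> K" for u using botr[OF that(2,3)] that(1) by simp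
  qed
  show "h y mod 4 = y mod 4" if H: "1 \<le> y" "y \<le> ?N" "even y" for y
  proof (rule cases[OF H(1,2)])
    show "y \<le> M \<Longrightarrow> ?thesis" using alt_Baxter_even[OF A H(1) _ H(3)] unfolding top add_mod4[OF K(2)] by simp
    show "y = M + 1 \<Longrightarrow> ?thesis" using M(2) K(2) mid by simp
    fix u assume u: "y = u + (M + 1)" "1 \<le> u" "u \<le> K"
    then have "even u" using H evM by simp
    then show ?thesis using alt_Baxter_even[OF B u(2,3)] bot[OF u(2)] unfolding u(1) add_mod4[OF M(2)] by simp
  qed
  show "odd (h y)" if H: "1 \<le> y" "y \<le> ?N" "odd y" for y
  proof (rule cases[OF H(1,2)])
    show "y \<le> M \<Longrightarrow> ?thesis" using alt_Baxter_odd[OF A H(1) _ H(3)] top[of y] evK by simp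
    show "y = M + 1 \<Longrightarrow> ?thesis" using evM H by simp
    fix u assume u: "y = u + (M + 1)" "1 \<le> u" "u \<le> K"
    then have "odd u" using H evM by simp
    then show ?thesis using alt_Baxter_odd[OF B u(2,3)] bot[OF u(2)] unfolding u(1) by simp
  qed
  fix x y assume x: "1 \<le> x" "x \<le> ?N" and y: "1 \<le> y" "y \<le> ?N" and s: "h y = h x + 1"
  {
    assume ev: "even (h y)"
    show "(if h y mod 4 = 2 then x < y else y < x) \<and> (\<forall>z. between x z y \<longrightarrow> h z < h y)" (is ?G)
    proof (rule cases[OF y])
      assume yM: "y \<le> M"
      have xM: "x \<le> M"
      proof (rule cases[OF x])
        show "x = M + 1 \<Longrightarrow> x \<le> M" using s ev evK mid by simp
        fix u assume "x = u + (M + 1)" "1 \<le> u" "u \<le> K"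
        then show "x \<le> M" using botr(1)[of u] topr[OF y(1) yM] s by simp
      qed
      have "even (f y)" "f y = f x + 1" using ev s top[OF yM] top[OF xM] evK(1) by simp_all
      note * = alt_Baxter_below[OF A x(1) xM y(1) yM this]
      have "h z < h y" if z: "between x z y" for z
      proof -
        have "z \<le> M" using z xM yM by (auto simp: between_def)
        then show ?thesis using * z top[of z] top[OF yM] by simp
      qed
      then show ?G using conjunct1[OF *] unfolding top[OF yM] add_mod4[OF K(2)] by blast
    next
      assume yM: "y = M + 1"
      have hx: "h x = K" using s mid yM by simp
      show ?G
      proof (rule cases[OF x])
        show "x \<le> M \<Longrightarrow> ?G" using topr[OF x(1)] hx by simp
        show "x = M + 1 \<Longrightarrow> ?G" using hx mid by simp
        fix u assume u: "x = u + (M + 1)" "1 \<le> u" "u \<le> K"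
        have "h z < h y" if z: "between x z y" for z
        proof -
          define w where "w = z - (M + 1)"
          have "z = w + (M + 1)" "1 \<le> w" "w \<le> K" using z u yM by (auto simp: between_def w_def)
          then show ?thesis using botr(1)[of w] yM mid by simp
        qed
        moreover have "y < x" using u yM by simp
        moreover have "h y mod 4 = 0" using yM mid K(2) by simp
        ultimately show ?G by auto
      qed
    next
      fix v assume v: "y = v + (M + 1)" "1 \<le> v" "v \<le> K"
      have hy: "h y \<le> K" using v botr by simp
      show ?G
      proof (rule cases[OF x])
        show "x \<le> M \<Longrightarrow> ?G" using topr[OF x(1)] hy s by simp
        show "x = M + 1 \<Longrightarrow> ?G" using hy mid s by simp
        fix u assume u: "x = u + (M + 1)" "1 \<le> u" "u \<le> K"
        have hv: "h y = g v" and hu: "h x = g u" using bot u v by simp_all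
        have "even (g v)" "g v = g u + 1" using ev s hv hu by simp_all
        note * = alt_Baxter_below[OF B u(2,3) v(2,3) this]
        have "h z < h y" if z: "between x z y" for z
        proof -
          define w where "w = z - (M + 1)"
          have w: "z = w + (M + 1)" "1 \<le> w" "between u w v" using z u v by (auto simp: between_def w_def)
          then show ?thesis using * bot[of w] hv by simp
        qed
        moreover have "x < y \<longleftrightarrow> u < v" "y < x \<longleftrightarrow> v < u" using u v by simp_all
        ultimately show ?G using conjunct1[OF *] unfolding hv by simp
      qed
    qed
  }
  {
    assume ev: "even (h x)"
    show "(if h x mod 4 = 2 then x < y else y < x) \<and> (\<forall>z. between x z y \<longrightarrow> h x < h z)" (is ?G)
    proof (rule cases[OF x])
      assume xM: "x \<le> M"
      have yM: "y \<le> M"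
      proof (rule cases[OF y])
        show "y = M + 1 \<Longrightarrow> y \<le> M" using s topr[OF x(1) xM] mid by simp
        fix u assume "y = u + (M + 1)" "1 \<le> u" "u \<le> K"
        then show "y \<le> M" using botr(1)[of u] topr[OF x(1) xM] s by simp
      qed
      have "even (f x)" "f y = f x + 1" using ev s top[OF yM] top[OF xM] evK(1) by simp_all
      note * = alt_Baxter_above[OF A x(1) xM y(1) yM this]
      have "h x < h z" if z: "between x z y" for z
      proof -
        have "z \<le> M" using z xM yM by (auto simp: between_def)
        then show ?thesis using * z top[of z] top[OF xM] by simp
      qed
      then show ?G using conjunct1[OF *] unfolding top[OF xM] add_mod4[OF K(2)] by blast
    next
      assume xM: "x = M + 1"
      have hy: "h y = K + 2" using s mid xM by simp
      show ?G
      proof (rule cases[OF y])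
        show "y = M + 1 \<Longrightarrow> ?G" using hy mid by simp
        show ?G if "y = u + (M + 1)" "1 \<le> u" "u \<le> K" for u using hy botr(1)[OF that(2,3)] that(1) by simp
        assume yM: "y \<le> M"
        have "h x < h z" if z: "between x z y" for z
        proof -
          have "1 \<le> z" "z \<le> M" using z y yM xM by (auto simp: between_def)
          then show ?thesis using topr[of z] xM mid by simp
        qed
        moreover have "y < x" using yM xM by simp
        moreover have "h x mod 4 = 0" using xM mid K(2) by simp
        ultimately show ?G by auto
      qed
    next
      fix u assume u: "x = u + (M + 1)" "1 \<le> u" "u \<le> K"
      have hx: "h x \<le> K" using u botr by simp
      show ?G
      proof (rule cases[OF y])
        show "y \<le> M \<Longrightarrow> ?G" using topr[OF y(1)] hx s by simp
        show "y = M + 1 \<Longrightarrow> ?G" using mid s ev evK by simp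
        fix v assume v: "y = v + (M + 1)" "1 \<le> v" "v \<le> K"
        have hv: "h y = g v" and hu: "h x = g u" using bot u v by simp_all
        have "even (g u)" "g v = g u + 1" using ev s hv hu by simp_all
        note * = alt_Baxter_above[OF B u(2,3) v(2,3) this]
        have "h x < h z" if z: "between x z y" for z
        proof -
          define w where "w = z - (M + 1)"
          have w: "z = w + (M + 1)" "1 \<le> w" "between u w v" using z u v by (auto simp: between_def w_def)
          then show ?thesis using * bot[of w] hu by simp
        qed
        moreover have "x < y \<longleftrightarrow> u < v" "y < x \<longleftrightarrow> v < u" using u v by simp_all
        ultimately show ?G using conjunct1[OF *] unfolding hu by simp
      qed
    qed
  }
qed
  then show ?thesis by (simp only: h_def)
qed

lemma even_mod4_cases: "even a \<Longrightarrow> a mod 4 = 0 \<or> a mod 4 = 2" for a :: nat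
  by presburger

lemma even_mod4_add2: "even a \<Longrightarrow> (a + 2) mod 4 = 2 \<longleftrightarrow> a mod 4 \<noteq> 2" for a :: nat
  by presburger

lemma mod4_eqI: "\<lbrakk>even a; even b; a mod 4 = 2 \<longleftrightarrow> b mod 4 = 2\<rbrakk> \<Longrightarrow> a mod 4 = b mod 4" for a b :: nat
  using even_mod4_cases[of a] even_mod4_cases[of b] by auto

text \<open>
The double frame around the antipermutation.
\<close>

lemma alt_Baxter_123: "alt_Baxter 3 (\<lambda>x. x)"
proof (rule alt_BaxterI)
  fix x y z :: nat
  assume "1 \<le> x" "x \<le> 3" "1 \<le> y" "y \<le> 3" "y = x + 1"
  then have "x = 1 \<and> y = 2 \<or> x = 2 \<and> y = 3" by auto
  then show "even y \<Longrightarrow> (if y mod 4 = 2 then x < y else y < x) \<and> (\<forall>z. between x z y \<longrightarrow> z < y)"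
    and "even x \<Longrightarrow> (if x mod 4 = 2 then x < y else y < x) \<and> (\<forall>z. between x z y \<longrightarrow> x < z)"
    by (auto simp: between_def)
qed auto

text \<open>
Only the new even entries 2 and \<open>M + 3\<close> connect the frame with the core, through the values 3 and
\<open>M + 2\<close>. Both are 2 modulo 4, and only entries of the core stand between them and these values.
\<close>

lemma alt_Baxter_frame:
  assumes A: "alt_Baxter M f"
  shows "alt_Baxter (M + 4) (\<lambda>x. if x \<le> 2 \<or> M + 2 < x then x else M + 3 - f (x - 2))"
    (is "alt_Baxter ?N ?h")
proof -
  define h where "h = ?h"
  have M: "M mod 4 = 3" by (rule alt_Baxter_mod[OF A])
  have oM: "odd M" and M3: "(M + 3) mod 4 = 2" using M by presburger+
  have mid: "h (x + 2) + f x = M + 3" "3 \<le> h (x + 2)" "h (x + 2) \<le> M + 2" if "1 \<le> x" "x \<le> M" for x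
  proof -
    have "h (x + 2) = M + 3 - f x" using that by (simp add: h_def)
    then show "h (x + 2) + f x = M + 3" "3 \<le> h (x + 2)" "h (x + 2) \<le> M + 2"
      using alt_Baxter_range[OF A that] by linarith+
  qed
  have out: "h 1 = 1" "h 2 = 2" "h (M + 3) = M + 3" "h (M + 4) = M + 4" by (simp_all add: h_def)
  have out': "h x = x" if "x \<le> 2 \<or> M + 2 < x" for x using that by (simp add: h_def)
  have sum2: "u mod 4 = 2 \<longleftrightarrow> v mod 4 \<noteq> 2" if "u + v = M + 3" "even v" for u v
  proof -
    have "u mod 4 = 2 \<longleftrightarrow> v mod 4 = 0" using that(1) M by presburger
    then show ?thesis using even_mod4_cases[OF that(2)] by auto
  qed
  have sum_even: "even u \<longleftrightarrow> even v" if "u + v = M + 3" for u v using that oM by presburger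
  have cases: thesis if "1 \<le> x" "x \<le> ?N" "x = 1 \<Longrightarrow> thesis" "x = 2 \<Longrightarrow> thesis"
      "x = M + 3 \<Longrightarrow> thesis" "x = M + 4 \<Longrightarrow> thesis"
      "\<And>u. \<lbrakk>x = u + 2; 1 \<le> u; u \<le> M\<rbrakk> \<Longrightarrow> thesis" for x thesis
  proof -
    have "x = 1 \<or> x = 2 \<or> x = M + 3 \<or> x = M + 4 \<or> 3 \<le> x \<and> x \<le> M + 2"
      using that(1,2) by linarith
    then show thesis using that(3-6) that(7)[of "x - 2"] by (elim disjE) auto
  qed
  have side: "(x \<le> 2 \<or> M + 2 < x) \<or> (\<exists>u. x = u + 2 \<and> 1 \<le> u \<and> u \<le> M)" for x
    by (cases "x \<le> 2 \<or> M + 2 < x") (auto intro!: exI[of _ "x - 2"])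
  have "alt_Baxter ?N h"
  proof (rule alt_BaxterI)
    show "?N mod 4 = 3" using M by simp
    show "inj_on h {1..?N}"
    proof (rule inj_onI)
      fix x y assume "x \<in> {1..?N}" "y \<in> {1..?N}" and e: "h x = h y"
      show "x = y"
      proof (cases "x \<le> 2 \<or> M + 2 < x")
        case True
        then show ?thesis using out'[of x] out'[of y] e mid(2,3) side[of y] by fastforce
      next
        case False
        then obtain u where u: "x = u + 2" "1 \<le> u" "u \<le> M" using side[of x] by blast
        show ?thesis
        proof (cases "y \<le> 2 \<or> M + 2 < y")
          case True
          then show ?thesis using out'[of y] e mid(2,3)[OF u(2,3)] u by auto
        next
          case False
          then obtain v where v: "y = v + 2" "1 \<le> v" "v \<le> M" using side[of y] by blast
          have "f u = f v" using e mid(1)[OF u(2,3)] mid(1)[OF v(2,3)] u v by simp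
          then show ?thesis using alt_Baxter_inj[OF A _ u(2,3) v(2,3)] u v by simp
        qed
      qed
    qed
    show "1 \<le> h x \<and> h x \<le> ?N" if "1 \<le> x" "x \<le> ?N" for x
      using side[of x] out'[of x] mid(2,3) that by fastforce
    show "h y mod 4 = y mod 4" if H: "1 \<le> y" "y \<le> ?N" "even y" for y
    proof (cases "y \<le> 2 \<or> M + 2 < y")
      case True then show ?thesis using out' by simp
    next
      case False
      then obtain u where u: "y = u + 2" "1 \<le> u" "u \<le> M" using side[of y] by blast
      have ev: "even u" using u H by simp
      have f: "f u mod 4 = u mod 4" by (rule alt_Baxter_even[OF A u(2,3) ev])
      have evf: "even (f u)" using alt_Baxter_parity[OF A u(2,3)] ev by simp
      have "h y mod 4 = 2 \<longleftrightarrow> u mod 4 \<noteq> 2" using sum2[OF mid(1)[OF u(2,3)] evf] f u by simp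
      moreover have "even (h y)" using sum_even[OF mid(1)[OF u(2,3)]] evf u by simp
      moreover have "y mod 4 = 2 \<longleftrightarrow> u mod 4 \<noteq> 2" using even_mod4_add2[OF ev] u by simp
      ultimately show ?thesis using mod4_eqI[of "h y" y] H(3) by blast
    qed
    show "odd (h y)" if H: "1 \<le> y" "y \<le> ?N" "odd y" for y
    proof (cases "y \<le> 2 \<or> M + 2 < y")
      case True then show ?thesis using out' H by simp
    next
      case False
      then obtain u where u: "y = u + 2" "1 \<le> u" "u \<le> M" using side[of y] by blast
      then show ?thesis using alt_Baxter_odd[OF A u(2,3)] H sum_even[OF mid(1)[OF u(2,3)]] by simp
    qed
    have both: "x = u + 2 \<Longrightarrow> y = v + 2 \<Longrightarrow> 1 \<le> u \<Longrightarrow> u \<le> M \<Longrightarrow> 1 \<le> v \<Longrightarrow> v \<le> M \<Longrightarrow> h y = h x + 1 \<Longrightarrow>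
        (even (h y) \<longrightarrow> (if h y mod 4 = 2 then x < y else y < x) \<and> (\<forall>z. between x z y \<longrightarrow> h z < h y)) \<and>
        (even (h x) \<longrightarrow> (if h x mod 4 = 2 then x < y else y < x) \<and> (\<forall>z. between x z y \<longrightarrow> h x < h z))"
      for x y u v
    proof (intro conjI impI)
      assume xy: "x = u + 2" "y = v + 2" and u: "1 \<le> u" "u \<le> M" and v: "1 \<le> v" "v \<le> M" and s: "h y = h x + 1"
      have f: "f u = f v + 1" using s mid(1)[OF u] mid(1)[OF v] xy by simp
      have z: "\<exists>w. z = w + 2 \<and> between v w u \<and> h z + f w = M + 3" if "between x z y" for z
      proof -
        define w where "w = z - 2"
        have w: "z = w + 2" "1 \<le> w" "w \<le> M" "between v w u"
          using that xy u v by (auto simp: between_def w_def)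
        then show ?thesis using mid(1)[OF w(2,3)] by blast
      qed
      have o: "x < y \<longleftrightarrow> u < v" "y < x \<longleftrightarrow> v < u" using xy by auto
      {
        assume "even (h y)"
        then have e: "even (f v)" using sum_even[OF mid(1)[OF v]] xy by simp
        note * = alt_Baxter_above[OF A v u e f]
        show "if h y mod 4 = 2 then x < y else y < x"
          using conjunct1[OF *] sum2[OF mid(1)[OF v] e] o xy by (auto split: if_splits)
        show "\<forall>z. between x z y \<longrightarrow> h z < h y"
        proof (intro allI impI)
          fix z assume "between x z y"
          from z[OF this] obtain w where "between v w u" "h z + f w = M + 3" by blast
          moreover have "f v < f w" using * \<open>between v w u\<close> by blast
          ultimately show "h z < h y" using mid(1)[OF v] xy by simp
        qed
      }
      {
        assume "even (h x)"
        then have e: "even (f u)" using sum_even[OF mid(1)[OF u]] xy by simp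
        note * = alt_Baxter_below[OF A v u e f]
        show "if h x mod 4 = 2 then x < y else y < x"
          using conjunct1[OF *] sum2[OF mid(1)[OF u] e] o xy by (auto split: if_splits)
        show "\<forall>z. between x z y \<longrightarrow> h x < h z"
        proof (intro allI impI)
          fix z assume "between x z y"
          from z[OF this] obtain w where "between v w u" "h z + f w = M + 3" by blast
          moreover have "f w < f u" using * \<open>between v w u\<close> by blast
          ultimately show "h x < h z" using mid(1)[OF u] xy by simp
        qed
      }
    qed
    have btw: "3 \<le> h z \<and> h z \<le> M + 2" if "2 < z" "z < M + 3" for z
    proof -
      have z: "z - 2 + 2 = z" "1 \<le> z - 2" "z - 2 \<le> M" using that by auto
      then show ?thesis using mid(2,3)[OF z(2,3)] by simp
    qed
    fix x y assume x: "1 \<le> x" "x \<le> ?N" and y: "1 \<le> y" "y \<le> ?N" and s: "h y = h x + 1"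
    {
      assume ev: "even (h y)"
      show "(if h y mod 4 = 2 then x < y else y < x) \<and> (\<forall>z. between x z y \<longrightarrow> h z < h y)" (is ?G)
      proof (rule cases[OF y])
        show "y = 1 \<Longrightarrow> ?G" "y = M + 4 \<Longrightarrow> ?G" using ev out oM by simp_all
        assume y2: "y = 2"
        have "x = 1" by (rule cases[OF x]) (use s y2 out mid(2) in fastforce)+
        then show ?G using y2 out by (auto simp: between_def)
      next
        assume yM: "y = M + 3"
        show ?G
        proof (rule cases[OF x])
          show "x = 1 \<Longrightarrow> ?G" "x = 2 \<Longrightarrow> ?G" "x = M + 3 \<Longrightarrow> ?G" "x = M + 4 \<Longrightarrow> ?G" using s yM out oM by auto
          fix u assume u: "x = u + 2" "1 \<le> u" "u \<le> M"
          have "h z < h y" if "between x z y" for z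
            using btw[of z] that u yM out by (auto simp: between_def)
          then show ?G using u yM out M3 by simp
        qed
      next
        fix v assume v: "y = v + 2" "1 \<le> v" "v \<le> M"
        show ?G
        proof (rule cases[OF x])
          show "x = 1 \<Longrightarrow> ?G" "x = M + 3 \<Longrightarrow> ?G" "x = M + 4 \<Longrightarrow> ?G" using s v mid(2,3)[OF v(2,3)] out by auto
          show "x = 2 \<Longrightarrow> ?G" using s ev out by simp
          show ?G if "x = u + 2" "1 \<le> u" "u \<le> M" for u using both[OF that(1) v(1) that(2,3) v(2,3) s] ev by blast
        qed
      qed
    }
    {
      assume ev: "even (h x)"
      show "(if h x mod 4 = 2 then x < y else y < x) \<and> (\<forall>z. between x z y \<longrightarrow> h x < h z)" (is ?G)
      proof (rule cases[OF x])
        show "x = 1 \<Longrightarrow> ?G" "x = M + 4 \<Longrightarrow> ?G" using ev out oM by simp_all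
        assume xM: "x = M + 3"
        have "y = M + 4" by (rule cases[OF y]) (use s xM out mid(3) in fastforce)+
        then show ?G using xM out M3 by (auto simp: between_def)
      next
        assume x2: "x = 2"
        show ?G
        proof (rule cases[OF y])
          show "y = 1 \<Longrightarrow> ?G" "y = 2 \<Longrightarrow> ?G" "y = M + 3 \<Longrightarrow> ?G" "y = M + 4 \<Longrightarrow> ?G" using s x2 out oM by auto
          fix u assume u: "y = u + 2" "1 \<le> u" "u \<le> M"
          have "h x < h z" if "between x z y" for z
            using btw[of z] that u x2 out by (auto simp: between_def)
          then show ?G using u x2 out by simp
        qed
      next
        fix u assume u: "x = u + 2" "1 \<le> u" "u \<le> M"
        show ?G
        proof (rule cases[OF y])
          show "y = 1 \<Longrightarrow> ?G" "y = 2 \<Longrightarrow> ?G" "y = M + 4 \<Longrightarrow> ?G" using s u mid(2,3)[OF u(2,3)] out by auto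
          show ?G if "y = M + 3"
          proof -
            have "h x = M + 2" using s that out by simp
            then show ?thesis using ev oM by simp
          qed
          show ?G if "y = v + 2" "1 \<le> v" "v \<le> M" for v using both[OF u(1) that(1) u(2,3) that(2,3) s] ev by blast
        qed
      qed
    }
  qed
  then show ?thesis by (simp only: h_def)
qed

section \<open>A grammar for alternating Baxter permutations\<close>

declare upt_Suc [simp del]

definition frame :: "aperm \<Rightarrow> aperm" where
  "frame A = Perm [1] \<oplus> A \<oplus> Perm [1]"

lemma frame_Anti [simp]: "frame Anti = Perm [1]"
  by (simp add: frame_def)

lemma frame_Perm [simp]: "frame (Perm p) = Perm (1 # map Suc p @ [length p + 2])"
  by (simp add: frame_def)

text \<open>
A grammar for the complete Baxter permutations of length \<open>4k + 3\<close> whose odd entries are doubly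
alternating, with the antipermutation standing in for length \<open>-1\<close>.
\<close>

inductive framed :: "aperm \<Rightarrow> bool" where
  Anti: "framed Anti"
| node: "\<lbrakk>framed A; framed B\<rbrakk> \<Longrightarrow> framed (frame (frame (complement A)) \<ominus> Perm [1] \<ominus> B)"

text \<open>
Position 2 carries an even value that is 2 modulo 4, so the value below it stands further left, and
only position 1 is left.
\<close>

lemma second_entry:
  assumes A: "alt_Baxter N f"
  shows "f 2 = f 1 + 1"
proof -
  have N: "3 \<le> N" using alt_Baxter_mod[OF A] mod_less_eq_dividend[of N 4] by simp
  then have two: "1 \<le> (2::nat)" "2 \<le> N" by auto
  have m: "f 2 mod 4 = 2" using alt_Baxter_even[OF A two] by simp
  then have ev: "even (f 2)" by presburger
  have r: "1 \<le> f 2 - 1" "f 2 - 1 \<le> N" 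
  proof -
    have "f 2 \<noteq> 1" using ev by (metis odd_one)
    then show "1 \<le> f 2 - 1" "f 2 - 1 \<le> N" using alt_Baxter_range[OF A two] by linarith+
  qed
  then obtain x where x: "1 \<le> x" "x \<le> N" "f x = f 2 - 1" using alt_Baxter_position[OF A] by blast
  then have e: "f 2 = f x + 1" using r by simp
  have "x < 2" using alt_Baxter_below[OF A x(1,2) two ev e] m by simp
  then have "x = 1" using x by simp
  then show ?thesis using e by simp
qed

text \<open>
A half turn moves the 1 at the front to the maximum at the end. By \<open>first_entry_splits\<close> no entry
of the turned function is then smaller than its first entry, which is therefore 1. Turning back, the
last entry is the maximum.
\<close>

lemma min_first_ends:
  assumes A: "alt_Baxter N f" and f1: "f 1 = 1"
  shows "f 2 = 2" "f (N - 1) = N - 1" "f N = N"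
proof -
  let ?g = "\<lambda>x. N + 1 - f (N + 1 - x)"
  have B: "alt_Baxter N ?g" by (rule alt_Baxter_reverse_complement[OF A])
  have N: "3 \<le> N" using alt_Baxter_mod[OF A] mod_less_eq_dividend[of N 4] by simp
  have rN: "f N \<le> N" "f (N - 1) \<le> N" using alt_Baxter_range[OF A, of N] alt_Baxter_range[OF A, of "N - 1"] N by auto
  obtain P where P: "P \<le> N + 1" "P + ?g 1 = N + 2" "\<And>x. \<lbrakk>P \<le> x; x \<le> N\<rbrakk> \<Longrightarrow> ?g x < ?g 1"
    using first_entry_splits[OF B] by metis
  have "\<not> P \<le> N"
  proof
    assume "P \<le> N"
    then have "?g N < ?g 1" using P(3)[of N] by simp
    then have "N < N + 1 - f N" using f1 by simp
    moreover have "1 \<le> f N" using alt_Baxter_range[OF A, of N] N by simp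
    ultimately show False by linarith
  qed
  then have "P = N + 1" using P(1) by linarith
  then have "N + 1 - f N = 1" using P(2) by simp
  then show fN: "f N = N" using rN by linarith
  show "f 2 = 2" using second_entry[OF A] f1 by simp
  have "N + 1 - f (N - 1) = 2" using second_entry[OF B] fN N by simp
  then show "f (N - 1) = N - 1" using rN N by linarith
qed

text \<open>
The entries at both ends form two nested frames, and the complement of what they enclose is the
antipermutation or a shorter alternating Baxter function.
\<close>

lemma framed_top:
  assumes A: "alt_Baxter N f" and f1: "f 1 = 1"
    and IH: "\<And>M g. \<lbrakk>M < N; alt_Baxter M g\<rbrakk> \<Longrightarrow> framed (Perm (map g [1..<M + 1]))"
  shows "\<exists>A. framed A \<and> frame (frame (complement A)) = Perm (map f [1..<N + 1])"
proof -
  note ends = min_first_ends[OF A f1]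
  have N: "3 \<le> N" using alt_Baxter_mod[OF A] mod_less_eq_dividend[of N 4] by simp
  show ?thesis
  proof (cases "N = 3")
    case True
    then have "f 3 = 3" using ends by simp
    then have "frame (frame (complement Anti)) = Perm (map f [1..<N + 1])"
      using f1 ends True by (simp add: upt_rec numeral_2_eq_2 numeral_3_eq_3)
    then show ?thesis using framed.Anti by blast
  next
    case False
    define M where "M = N - 4"
    have "N \<noteq> 4" "N \<noteq> 5" "N \<noteq> 6" using alt_Baxter_mod[OF A] by auto
    then have NM: "N = M + 4" "M mod 4 = 3" using alt_Baxter_mod[OF A] N False by (auto simp: M_def le_mod_geq)
    have r: "3 \<le> f (x + 2) \<and> f (x + 2) \<le> M + 2" if x: "1 \<le> x" "x \<le> M" for x
    proof -
      have "f (x + 2) \<noteq> f y" if "1 \<le> y" "y \<le> N" "y \<noteq> x + 2" for y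
        using alt_Baxter_inj[OF A, of "x + 2" y] that x NM by auto
      from this[of 1] this[of 2] this[of "N - 1"] this[of N]
      have "f (x + 2) \<notin> {1, 2, N - 1, N}" using f1 ends x NM by auto
      moreover have "1 \<le> f (x + 2)" "f (x + 2) \<le> N" using alt_Baxter_range[OF A, of "x + 2"] x NM by auto
      ultimately show ?thesis using NM by auto
    qed
    let ?g = "\<lambda>x. M + 3 - f (x + 2)"
    have "alt_Baxter M ?g" by (rule alt_Baxter_core[OF A NM r])
    then have fr: "framed (Perm (map ?g [1..<M + 1]))" using IH NM by simp
    have c: "complement (Perm (map ?g [1..<M + 1])) = Perm (map (\<lambda>x. f (x + 2) - 2) [1..<M + 1])"
    proof -
      have "M + 1 - ?g x = f (x + 2) - 2" if "x \<in> set [1..<M + 1]" for x using r[of x] that by auto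
      then show ?thesis by simp
    qed
    have "frame (frame (complement (Perm (map ?g [1..<M + 1])))) =
        Perm (1 # 2 # map (\<lambda>x. f (x + 2)) [1..<M + 1] @ [M + 3, M + 4])"
    proof -
      have "Suc (Suc (f (x + 2) - 2)) = f (x + 2)" if "x \<in> set [1..<M + 1]" for x using r[of x] that by auto
      then show ?thesis unfolding c by (simp add: comp_def)
    qed
    also have "1 # 2 # map (\<lambda>x. f (x + 2)) [1..<M + 1] @ [M + 3, M + 4] = map f [1..<N + 1]"
      (is "?l = ?r")
    proof (rule nth_equalityI)
      show "length ?l = length ?r" using NM by simp
      fix i assume "i < length ?l"
      then have i: "i < M + 4" by simp
      consider "i = 0" | "i = 1" | j where "i = j + 2" "j < M" | "i = M + 2" | "i = M + 3"
      proof -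
        have "i = 0 \<or> i = 1 \<or> (2 \<le> i \<and> i < M + 2) \<or> i = M + 2 \<or> i = M + 3" using i by linarith
        then show thesis using that(1,2,4,5) that(3)[of "i - 2"] by (elim disjE) auto
      qed
      then show "?l ! i = ?r ! i"
        using f1 ends NM(1) by cases (simp_all add: nth_append nth_Cons' eval_nat_numeral)
    qed
    finally show ?thesis using fr by blast
  qed
qed

text \<open>
The entries before the splitting position start with their minimum, so \<open>framed_top\<close> applies to
them. The entry at that position is the separating single entry, and the rest is a shorter function.
\<close>

lemma alt_Baxter_imp_framed: "alt_Baxter N f \<Longrightarrow> framed (Perm (map f [1..<N + 1]))"
proof (induction N arbitrary: f rule: less_induct)
  case (less N)
  note A = less.prems
  obtain P where P: "P mod 4 = 0" "4 \<le> P" "P \<le> N + 1" "P + f 1 = N + 2"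
    and ge: "\<And>x. \<lbrakk>1 \<le> x; x < P\<rbrakk> \<Longrightarrow> f 1 \<le> f x" and lt: "\<And>x. \<lbrakk>P \<le> x; x \<le> N\<rbrakk> \<Longrightarrow> f x < f 1"
    and fP: "P \<le> N \<Longrightarrow> f P + 1 = f 1" and f1: "f 1 mod 4 = 1"
    using first_entry_splits[OF A] by metis
  define b where "b = f 1 - 1"
  have b: "b mod 4 = 0" "f 1 = b + 1" "P + b = N + 1"
  proof -
    have "1 \<le> f 1" using f1 by (cases "f 1") auto
    then show "f 1 = b + 1" by (simp add: b_def)
    then show "P + b = N + 1" using P by simp
    show "b mod 4 = 0" using f1 \<open>f 1 = b + 1\<close> by presburger
  qed
  obtain T where T: "P = T + 1" using P by (cases P) auto
  have T3: "T mod 4 = 3" using P(1) unfolding T by presburger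
  have rt: "b < f x \<and> f x \<le> b + T" if "1 \<le> x" "x \<le> T" for x
    using ge[of x] alt_Baxter_range[OF A, of x] that b T P by auto
  have AT: "alt_Baxter T (\<lambda>x. f (x + 0) - b)"
    by (rule alt_Baxter_restrict[OF A _ b(1) T3]) (use rt P T in auto)
  have "\<exists>B. framed B \<and> frame (frame (complement B)) = Perm (map (\<lambda>x. f (x + 0) - b) [1..<T + 1])"
  proof (rule framed_top[OF AT])
    show "f (1 + 0) - b = 1" using b(2) by simp
    show "framed (Perm (map g [1..<M + 1]))" if "M < T" "alt_Baxter M g" for M g
      by (rule less.IH[OF _ that(2)]) (use that(1) T P in linarith)
  qed
  then obtain B where "framed B"
    "frame (frame (complement B)) = Perm (map (\<lambda>x. f (x + 0) - b) [1..<T + 1])" by blast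
  then have B: "framed B" "frame (frame (complement B)) = Perm (map (\<lambda>x. f x - b) [1..<T + 1])" by simp_all
  have top: "map ((+) b) (map (\<lambda>x. f x - b) [1..<T + 1]) = map f [1..<P]"
    using rt T by (auto simp: less_imp_le)
  show ?case
  proof (cases "P \<le> N")
    case False
    then have PN: "P = N + 1" "b = 0" using P b by auto
    have "frame (frame (complement B)) \<ominus> Perm [1] \<ominus> Anti = Perm (map f [1..<N + 1])"
      using top unfolding B PN by (simp)
    then show ?thesis using framed.node[OF B(1) framed.Anti] by simp
  next
    case True
    define K where "K = N - P"
    have K: "N = K + P" "b = K + 1" using True b by (auto simp: K_def)
    have K3: "K mod 4 = 3" using b(1) unfolding K by presburger
    have "alt_Baxter K (\<lambda>x. f (x + P) - 0)"
    proof (rule alt_Baxter_restrict[OF A P(1) _ K3])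
      show "0 < f (x + P) \<and> f (x + P) \<le> 0 + K" if "1 \<le> x" "x \<le> K" for x
      proof -
        have "f (x + P) < f 1" "1 \<le> f (x + P)" using lt[of "x + P"] alt_Baxter_range[OF A, of "x + P"] that K by auto
        moreover have "f (x + P) \<noteq> f P" using alt_Baxter_inj[OF A, of "x + P" P] that K True P by auto
        ultimately show ?thesis using fP[OF True] b(2) K by simp
      qed
    qed (use K in auto)
    then have C: "framed (Perm (map (\<lambda>x. f (x + P)) [1..<K + 1]))" using less.IH[of K] K P by simp
    have "map f [1..<N + 1] = map f [1..<P] @ (K + 1) # map (\<lambda>x. f (x + P)) [1..<K + 1]"
      (is "?l = ?r")
    proof (rule nth_equalityI)
      show "length ?l = length ?r" using K P by simp
      fix i assume "i < length ?l"
      then have i: "i < N" by simp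
      have "f P = K + 1" using fP[OF True] b K by simp
      consider "i < P - 1" | "Suc i = P" | j where "i = j + P" "j < K"
      proof -
        have "i < P - 1 \<or> Suc i = P \<or> P \<le> i" by linarith
        then show thesis using that(1,2) that(3)[of "i - P"] i K by (elim disjE) auto
      qed
      then show "?l ! i = ?r ! i" using \<open>f P = K + 1\<close> K P(2)
        by cases (auto simp: nth_append nth_Cons')
    qed
    then have "frame (frame (complement B)) \<ominus> Perm [1] \<ominus> Perm (map (\<lambda>x. f (x + P)) [1..<K + 1])
        = Perm (map f [1..<N + 1])"
      using top unfolding B by (simp add: K(2))
    then show ?thesis using framed.node[OF B(1) C] by simp
  qed
qed

lemma map_add_0 [simp]: "map ((+) 0) xs = xs" for xs :: "nat list"
  by (simp add: map_idI)

lemma pval_append: "1 \<le> x \<Longrightarrow> pval (xs @ ys) x = (if x \<le> length xs then pval xs x else pval ys (x - length xs))"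
  by (auto simp: pval_def nth_append intro!: arg_cong[of _ _ "nth ys"])

lemma pval_Cons: "1 \<le> x \<Longrightarrow> pval (a # xs) x = (if x = 1 then a else pval xs (x - 1))"
  by (auto simp: pval_def nth_Cons')

lemma pval_map: "\<lbrakk>1 \<le> x; x \<le> length xs\<rbrakk> \<Longrightarrow> pval (map g xs) x = g (pval xs x)"
  by (auto simp: pval_def)

lemma pval_map_upt: "\<lbrakk>1 \<le> x; x \<le> n\<rbrakk> \<Longrightarrow> pval (map g [1..<n + 1]) x = g x"
  by (auto simp: pval_def)

lemma map_pval: "map (pval p) [1..<length p + 1] = p"
  by (rule nth_equalityI) (auto simp: pval_def)

lemma is_perm_iff: "is_perm p \<longleftrightarrow> set p = {1..length p} \<and> distinct p"
  by (auto simp: is_perm_def permutations_of_set_def)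

lemma is_perm_iff_bij: "is_perm p \<longleftrightarrow> bij_betw (pval p) {1..length p} {1..length p}"
proof -
  have s: "set [1..<length p + 1] = {1..length p}" by auto
  have "distinct p \<longleftrightarrow> inj_on (pval p) {1..length p}"
    using distinct_map[of "pval p" "[1..<length p + 1]"] unfolding map_pval s by simp
  moreover have "set p = pval p ` {1..length p}"
    using set_map[of "pval p" "[1..<length p + 1]"] unfolding map_pval s by simp
  ultimately show ?thesis by (auto simp: is_perm_iff bij_betw_def)
qed

lemma alt_Baxter_frame_list:
  assumes A: "alt_Baxter (length p) (pval p)"
  shows "alt_Baxter (length p + 4) (pval (1 # 2 # map (\<lambda>v. length p + 3 - v) p @ [length p + 3, length p + 4]))"
    (is "alt_Baxter _ (pval ?q)")
proof (rule alt_Baxter_cong[OF alt_Baxter_frame[OF A]])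
  fix x assume x: "1 \<le> x" "x \<le> length p + 4"
  have "x = 1 \<or> x = 2 \<or> x = length p + 3 \<or> x = length p + 4 \<or> 3 \<le> x \<and> x \<le> length p + 2"
    using x by linarith
  then show "pval ?q x = (if x \<le> 2 \<or> length p + 2 < x then x else length p + 3 - pval p (x - 2))"
    by (elim disjE) (auto simp: pval_def nth_Cons' nth_append numeral_3_eq_3)
qed

lemma alt_Baxter_skew_list:
  assumes A: "alt_Baxter (length p) (pval p)" and B: "alt_Baxter (length q) (pval q)"
  shows "alt_Baxter (length p + 1 + length q) (pval (map ((+) (length q + 1)) p @ (length q + 1) # q))"
    (is "alt_Baxter _ (pval ?r)")
proof (rule alt_Baxter_cong[OF alt_Baxter_skew[OF A B]])
  fix x assume x: "1 \<le> x" "x \<le> length p + 1 + length q"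
  have "x \<le> length p \<or> x = length p + 1 \<or> length p + 1 < x"
    by linarith
  then show "pval ?r x = (if x \<le> length p then pval p x + (length q + 1)
      else if x = length p + 1 then length q + 1 else pval q (x - (length p + 1)))"
    using x by (elim disjE) (auto simp: pval_append pval_Cons pval_map)
qed

lemma framed_imp_alt_Baxter:
  "framed A \<Longrightarrow> case A of Anti \<Rightarrow> True | Perm p \<Rightarrow> alt_Baxter (length p) (pval p)"
proof (induction rule: framed.induct)
  case Anti
  show ?case by simp
next
  case (node A B)
  have "\<exists>t. frame (frame (complement A)) = Perm t \<and> alt_Baxter (length t) (pval t)"
  proof (cases A)
    case Anti
    have "alt_Baxter 3 (pval [1, 2, 3])"
    proof (rule alt_Baxter_cong[OF alt_Baxter_123])
      fix x :: nat assume "1 \<le> x" "x \<le> 3"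
      then have "x = 1 \<or> x = 2 \<or> x = 3" by auto
      then show "pval [1, 2, 3] x = x" by (auto simp: pval_def)
    qed
    then show ?thesis using Anti by (simp add: numeral_3_eq_3 numeral_2_eq_2)
  next
    case (Perm p)
    then have A: "alt_Baxter (length p) (pval p)" using node.IH by simp
    have "map (Suc \<circ> (Suc \<circ> (\<lambda>v. length p + 1 - v))) p = map (\<lambda>v. length p + 3 - v) p"
    proof (rule map_cong[OF refl])
      fix v assume "v \<in> set p"
      then have "v \<le> length p"
        using alt_Baxter_bij[OF A] is_perm_iff_bij[of p] by (auto simp: is_perm_iff)
      then show "(Suc \<circ> (Suc \<circ> (\<lambda>v. length p + 1 - v))) v = length p + 3 - v" by simp
    qed
    then have "frame (frame (complement A)) =
        Perm (1 # 2 # map (\<lambda>v. length p + 3 - v) p @ [length p + 3, length p + 4])"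
      using Perm by simp
    moreover have "alt_Baxter (length (1 # 2 # map (\<lambda>v. length p + 3 - v) p @ [length p + 3, length p + 4]))
        (pval (1 # 2 # map (\<lambda>v. length p + 3 - v) p @ [length p + 3, length p + 4]))"
      using alt_Baxter_frame_list[OF A] by (simp add: eval_nat_numeral)
    ultimately show ?thesis by blast
  qed
  then obtain t where t: "frame (frame (complement A)) = Perm t" "alt_Baxter (length t) (pval t)" by blast
  show ?case
  proof (cases B)
    case Anti
    then show ?thesis using t by (simp add: comp_def)
  next
    case (Perm q)
    then have "alt_Baxter (length q) (pval q)" using node.IH by simp
    then show ?thesis using alt_Baxter_skew_list[OF t(2)] Perm t by (simp add: add.assoc)
  qed
qed

section \<open>Even and odd entries of a permutation\<close>

lemma card_odd_atMost: "card {y. odd y \<and> y \<le> x} = Suc x div 2" for x :: nat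
proof (induction x)
  case 0
  have "{y::nat. odd y \<and> y \<le> 0} = {}" by (auto dest: odd_pos)
  then show ?case by simp
next
  case (Suc x)
  have "{y. odd y \<and> y \<le> Suc x} = (if odd (Suc x) then insert (Suc x) {y. odd y \<and> y \<le> x} else {y. odd y \<and> y \<le> x})"
    by (auto simp: le_Suc_eq)
  then show ?case using Suc by simp
qed

lemma card_even_atMost: "card {y. even y \<and> 1 \<le> y \<and> y \<le> x} = x div 2" for x :: nat
proof (induction x)
  case 0
  have "{y::nat. even y \<and> 1 \<le> y \<and> y \<le> 0} = {}" by auto
  then show ?case by simp
next
  case (Suc x)
  have "{y. even y \<and> 1 \<le> y \<and> y \<le> Suc x} =
      (if even (Suc x) then insert (Suc x) {y. even y \<and> 1 \<le> y \<and> y \<le> x} else {y. even y \<and> 1 \<le> y \<and> y \<le> x})"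
    by (auto simp: le_Suc_eq)
  then show ?case using Suc by simp
qed

text \<open>
All numbers up to the length occur, so the rank of an even entry among the even entries is its half.
\<close>

lemma even_part_eq:
  assumes "is_perm p"
  shows "even_part p = map (\<lambda>v. v div 2) (filter even p)"
  unfolding even_part_def standardize_def
proof (rule map_cong[OF refl])
  fix x assume "x \<in> set (filter even p)"
  then have "{y \<in> set (filter even p). y \<le> x} = {y. even y \<and> 1 \<le> y \<and> y \<le> x}"
    using assms by (auto simp: is_perm_iff)
  then show "card {y \<in> set (filter even p). y \<le> x} = x div 2" by (simp only: card_even_atMost)
qed

lemma odd_part_eq:
  assumes "is_perm p"
  shows "odd_part p = map (\<lambda>v. Suc v div 2) (filter odd p)"
  unfolding odd_part_def standardize_def
proof (rule map_cong[OF refl])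
  fix x assume "x \<in> set (filter odd p)"
  then have "{y \<in> set (filter odd p). y \<le> x} = {y. odd y \<and> y \<le> x}"
    using assms by (auto simp: is_perm_iff Suc_le_eq dest: odd_pos)
  then show "card {y \<in> set (filter odd p). y \<le> x} = Suc x div 2" by (simp only: card_odd_atMost)
qed

lemma filter_odd_upt: "filter odd [1..<2 * n + 2] = map (\<lambda>j. 2 * j - 1) [1..<n + 2]"
proof (induction n)
  case 0
  show ?case by (simp add: upt_rec)
next
  case (Suc n)
  have "[1..<2 * Suc n + 2] = [1..<2 * n + 2] @ [2 * n + 2, 2 * n + 3]"
    by (simp add: upt_Suc numeral_3_eq_3)
  moreover have "[1..<Suc n + 2] = [1..<n + 2] @ [n + 2]" by (simp add: upt_Suc)
  ultimately show ?case using Suc by simp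
qed

text \<open>
Here the odd entries can be read off at the odd positions, which makes \<open>odd_part\<close> explicit.
\<close>

locale parity_perm =
  fixes p :: "nat list" and n :: nat
  assumes perm: "is_perm p" and len: "length p = 2 * n + 1"
    and par: "\<And>i. \<lbrakk>1 \<le> i; i \<le> 2 * n + 1\<rbrakk> \<Longrightarrow> even (pval p i) \<longleftrightarrow> even i"
begin

lemma odd_part_map: "odd_part p = map (\<lambda>j. Suc (pval p (2 * j - 1)) div 2) [1..<n + 2]"
proof -
  have "filter odd p = filter odd (map (pval p) [1..<2 * n + 2])"
    using map_pval[of p] len by simp
  also have "\<dots> = map (pval p) (filter odd [1..<2 * n + 2])"
    unfolding filter_map using par by (intro arg_cong[of _ _ "map (pval p)"] filter_cong refl) auto
  also have "\<dots> = map (\<lambda>j. pval p (2 * j - 1)) [1..<n + 2]"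
    unfolding filter_odd_upt by simp
  finally show ?thesis unfolding odd_part_eq[OF perm] by simp
qed

lemma length_odd_part: "length (odd_part p) = n + 1"
  by (simp add: odd_part_map)

lemma pval_odd_part:
  assumes "1 \<le> j" "j \<le> n + 1"
  shows "2 * pval (odd_part p) j = Suc (pval p (2 * j - 1))"
proof -
  have "odd (pval p (2 * j - 1))" using par[of "2 * j - 1"] assms by auto
  moreover have "pval (odd_part p) j = Suc (pval p (2 * j - 1)) div 2"
    using assms pval_map_upt[of j "n + 1"] by (simp add: odd_part_map)
  ultimately show ?thesis by simp
qed

lemma bij_p: "bij_betw (pval p) {1..2 * n + 1} {1..2 * n + 1}"
  using perm len by (simp add: is_perm_iff_bij)

lemma is_perm_odd_part: "is_perm (odd_part p)"
proof -
  have r: "1 \<le> pval (odd_part p) j \<and> pval (odd_part p) j \<le> n + 1" if "1 \<le> j" "j \<le> n + 1" for j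
  proof -
    have "pval p (2 * j - 1) \<in> {1..2 * n + 1}"
      using bij_p that by (intro bij_betwE[OF bij_p, rule_format]) auto
    then show ?thesis using pval_odd_part[OF that] by auto
  qed
  have "inj_on (pval (odd_part p)) {1..n + 1}"
  proof (rule inj_onI)
    fix i j assume h: "i \<in> {1..n + 1}" "j \<in> {1..n + 1}" "pval (odd_part p) i = pval (odd_part p) j"
    then have "pval p (2 * i - 1) = pval p (2 * j - 1)"
      using pval_odd_part[of i] pval_odd_part[of j] by simp
    then have "2 * i - 1 = 2 * j - 1"
      by (rule inj_onD[OF bij_betw_imp_inj_on[OF bij_p]]) (use h in auto)
    then show "i = j" using h by auto
  qed
  moreover have "pval (odd_part p) ` {1..n + 1} \<subseteq> {1..n + 1}" using r by fastforce
  ultimately show ?thesis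
    by (simp add: is_perm_iff_bij length_odd_part bij_betw_def endo_inj_surj)
qed

lemma alternating_odd_part:
  "alternating (odd_part p) \<longleftrightarrow>
    (\<forall>j. 1 \<le> j \<and> j < n + 1 \<longrightarrow> (if odd j then pval p (2 * j - 1) < pval p (2 * j + 1)
        else pval p (2 * j + 1) < pval p (2 * j - 1)))"
proof -
  have "pval (odd_part p) j < pval (odd_part p) (j + 1) \<longleftrightarrow> pval p (2 * j - 1) < pval p (2 * j + 1)"
    "pval (odd_part p) (j + 1) < pval (odd_part p) j \<longleftrightarrow> pval p (2 * j + 1) < pval p (2 * j - 1)"
    if "1 \<le> j \<and> j < n + 1" for j
    using pval_odd_part[of j] pval_odd_part[of "j + 1"] that by auto
  then show ?thesis unfolding alternating_def length_odd_part by (auto split: if_splits)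
qed

end

text \<open>
Consecutive positions of the inverse are consecutive values of the permutation.
\<close>

lemma alternating_perm_inverse:
  assumes "is_perm q"
  shows "alternating (perm_inverse q) \<longleftrightarrow>
    (\<forall>x\<in>{1..length q}. \<forall>y\<in>{1..length q}. pval q y = pval q x + 1 \<longrightarrow>
        (if odd (pval q x) then x < y else y < x))"
proof -
  let ?I = "inv_into {1..length q} (pval q)"
  have b: "bij_betw (pval q) {1..length q} {1..length q}" using assms by (simp add: is_perm_iff_bij)
  have l: "length (perm_inverse q) = length q" by (simp add: perm_inverse_def)
  have i: "pval (perm_inverse q) v = ?I v" if "1 \<le> v" "v \<le> length q" for v
    unfolding perm_inverse_def by (rule pval_map_upt[OF that])
  have "alternating (perm_inverse q) \<longleftrightarrow> (\<forall>v. 1 \<le> v \<and> v < length q \<longrightarrow>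
      (if odd v then ?I v < ?I (v + 1) else ?I (v + 1) < ?I v))" (is "_ \<longleftrightarrow> ?R")
    unfolding alternating_def l using i by (auto split: if_splits)
  also have "?R \<longleftrightarrow> (\<forall>x\<in>{1..length q}. \<forall>y\<in>{1..length q}. pval q y = pval q x + 1 \<longrightarrow>
        (if odd (pval q x) then x < y else y < x))" (is "_ \<longleftrightarrow> ?S")
  proof
    assume R: ?R
    show ?S
    proof (intro ballI impI)
      fix x y assume x: "x \<in> {1..length q}" and y: "y \<in> {1..length q}" and s: "pval q y = pval q x + 1"
      have "?I (pval q x) = x" "?I (pval q x + 1) = y"
        using b x y s[symmetric] by (simp_all add: bij_betw_inv_into_left)
      moreover have "1 \<le> pval q x \<and> pval q x < length q"
        using bij_betwE[OF b] x y s by fastforce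
      ultimately show "if odd (pval q x) then x < y else y < x" using R by metis
    qed
  next
    assume S: ?S
    show ?R
    proof (intro allI impI)
      fix v assume v: "1 \<le> v \<and> v < length q"
      have "?I v \<in> {1..length q}" "?I (v + 1) \<in> {1..length q}" "pval q (?I v) = v" "pval q (?I (v + 1)) = v + 1"
        using v b bij_betwE[OF bij_betw_inv_into[OF b]] by (auto simp: bij_betw_inv_into_right)
      then show "if odd v then ?I v < ?I (v + 1) else ?I (v + 1) < ?I v" using S by metis
    qed
  qed
  finally show ?thesis .
qed

context parity_perm
begin

text \<open>
The odd entries with index \<open>j\<close> and \<open>j + 1\<close> surround the even position \<open>2 * j\<close>, and two consecutive
odd values surround an even value. Half of an even number is odd iff the number is 2 modulo 4.
\<close>

lemma doubly_alternating_odd_part: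
  "doubly_alternating (odd_part p) \<longleftrightarrow>
    (\<forall>j. 1 \<le> j \<and> j < n + 1 \<longrightarrow> (if odd j then pval p (2 * j - 1) < pval p (2 * j + 1)
        else pval p (2 * j + 1) < pval p (2 * j - 1))) \<and>
    (\<forall>x\<in>{1..2 * n + 1}. \<forall>y\<in>{1..2 * n + 1}. odd (pval p x) \<and> pval p y = pval p x + 2 \<longrightarrow>
       (if (pval p x + 1) mod 4 = 2 then x < y else y < x))" (is "_ \<longleftrightarrow> ?A \<and> ?B")
proof -
  let ?q = "odd_part p"
  have "alternating (perm_inverse ?q) \<longleftrightarrow> ?B"
    unfolding alternating_perm_inverse[OF is_perm_odd_part] length_odd_part
  proof (intro iffI ballI impI)
    fix x y assume S: "\<forall>x\<in>{1..n + 1}. \<forall>y\<in>{1..n + 1}. pval ?q y = pval ?q x + 1 \<longrightarrow>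
        (if odd (pval ?q x) then x < y else y < x)"
      and x: "x \<in> {1..2 * n + 1}" and y: "y \<in> {1..2 * n + 1}"
      and s: "odd (pval p x) \<and> pval p y = pval p x + 2"
    have "odd x" "odd y" using par[of x] par[of y] x y s by auto
    then obtain i j where ij: "x = 2 * i + 1" "y = 2 * j + 1" by (auto elim!: oddE)
    have q: "2 * pval ?q (i + 1) = Suc (pval p x)" "2 * pval ?q (j + 1) = Suc (pval p y)"
      using pval_odd_part[of "i + 1"] pval_odd_part[of "j + 1"] x y ij by simp_all
    then have "pval ?q (j + 1) = pval ?q (i + 1) + 1" using s by simp
    moreover have "i + 1 \<in> {1..n + 1}" "j + 1 \<in> {1..n + 1}" using x y ij by auto
    ultimately have "if odd (pval ?q (i + 1)) then i + 1 < j + 1 else j + 1 < i + 1"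
      using S by blast
    moreover have "(pval p x + 1) mod 4 = 2 \<longleftrightarrow> odd (pval ?q (i + 1))" using q(1) by presburger
    ultimately show "if (pval p x + 1) mod 4 = 2 then x < y else y < x" using ij by (auto split: if_splits)
  next
    fix x y assume S: ?B and x: "x \<in> {1..n + 1}" and y: "y \<in> {1..n + 1}"
      and s: "pval ?q y = pval ?q x + 1"
    have q: "2 * pval ?q x = Suc (pval p (2 * x - 1))" "2 * pval ?q y = Suc (pval p (2 * y - 1))"
      using pval_odd_part[of x] pval_odd_part[of y] x y by simp_all
    have "odd (pval p (2 * x - 1))" using q(1) by presburger
    moreover have "pval p (2 * y - 1) = pval p (2 * x - 1) + 2" using q s by simp
    moreover have "2 * x - 1 \<in> {1..2 * n + 1}" "2 * y - 1 \<in> {1..2 * n + 1}" using x y by auto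
    ultimately have "if (pval p (2 * x - 1) + 1) mod 4 = 2 then 2 * x - 1 < 2 * y - 1 else 2 * y - 1 < 2 * x - 1"
      using S by blast
    moreover have "(pval p (2 * x - 1) + 1) mod 4 = 2 \<longleftrightarrow> odd (pval ?q x)" using q(1) by presburger
    moreover have "2 * x - 1 < 2 * y - 1 \<longleftrightarrow> x < y" "2 * y - 1 < 2 * x - 1 \<longleftrightarrow> y < x" using x y by auto
    ultimately show "if odd (pval ?q x) then x < y else y < x" by (auto split: if_splits)
  qed
  then show ?thesis unfolding doubly_alternating_def alternating_odd_part by blast
qed

end

section \<open>Complete Baxter permutations with doubly alternating odd entries\<close>

text \<open>
At an even position \<open>y\<close> the two adjacent entries lie on different sides of \<open>f y\<close>, because the positions
of \<open>f y - 1\<close> and \<open>f y + 1\<close> are on different sides of \<open>y\<close>; the side is known from \<open>y mod 4\<close>.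
\<close>

lemma alt_Baxter_imp_complete_Baxter:
  assumes A: "alt_Baxter (length p) (pval p)"
  shows "complete_Baxter p" "doubly_alternating (odd_part p)"
proof -
  let ?f = "pval p" and ?N = "length p"
  have odd_N: "odd ?N" using alt_Baxter_mod[OF A] by presburger
  then obtain n where n: "?N = 2 * n + 1" by (auto elim: oddE)
  have perm: "is_perm p" using alt_Baxter_bij[OF A] by (simp add: is_perm_iff_bij)
  have pare: "even (?f i) \<longleftrightarrow> even i" if "1 \<le> i" "i \<le> ?N" for i using alt_Baxter_parity[OF A that] .
  interpret parity_perm p n by unfold_locales (use perm n pare in auto)
  show "complete_Baxter p"
    unfolding complete_Baxter_def
  proof (intro conjI ballI allI impI)
    show "is_perm p" "odd ?N" by fact+
    show "even (?f i) \<longleftrightarrow> even i" if "i \<in> {1..?N}" for i using pare that by simp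
    fix x y z i
    assume x: "x \<in> {1..?N}" and y: "y \<in> {1..?N}"
      and h: "?f x = i \<and> ?f y = i + 1 \<and> (x < z \<and> z < y \<or> y < z \<and> z < x)"
    then have b: "between x z y" and e: "?f y = ?f x + 1" by (auto simp: between_def)
    have x': "1 \<le> x" "x \<le> ?N" and y': "1 \<le> y" "y \<le> ?N" and z': "1 \<le> z" "z \<le> ?N"
      using x y b by (auto simp: between_def)
    have ne: "z \<noteq> x" "z \<noteq> y" using b by (auto simp: between_def)
    have "?f z \<noteq> ?f x" "?f z \<noteq> ?f y"
      using alt_Baxter_inj[OF A _ z' x'] alt_Baxter_inj[OF A _ z' y'] ne by blast+
    moreover have "odd i \<Longrightarrow> ?f z < ?f y" using alt_Baxter_below[OF A x' y' _ e] b h by simp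
    moreover have "even i \<Longrightarrow> ?f x < ?f z" using alt_Baxter_above[OF A x' y' _ e] b h by simp
    ultimately show "if odd i then ?f z < i else ?f z > i + 1" using h by auto
  qed
  have nbr: "if y mod 4 = 2 then xl < y \<and> y < xr else xr < y \<and> y < xl"
    "\<And>z. between xl z y \<Longrightarrow> ?f z < ?f y" "\<And>z. between y z xr \<Longrightarrow> ?f y < ?f z"
    if y: "1 \<le> y" "y \<le> ?N" "even y" and xl: "1 \<le> xl" "xl \<le> ?N" "?f xl + 1 = ?f y"
      and xr: "1 \<le> xr" "xr \<le> ?N" "?f xr = ?f y + 1" for y xl xr
  proof -
    have ev: "even (?f y)" using pare y by simp
    have m: "?f y mod 4 = y mod 4" by (rule alt_Baxter_even[OF A y])
    note lo = alt_Baxter_below[OF A xl(1,2) y(1,2) ev xl(3)[symmetric]]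
    note hi = alt_Baxter_above[OF A y(1,2) xr(1,2) ev xr(3)]
    show "if y mod 4 = 2 then xl < y \<and> y < xr else xr < y \<and> y < xl"
      using conjunct1[OF lo] conjunct1[OF hi] unfolding m by argo
    show "?f z < ?f y" if "between xl z y" for z using lo that by blast
    show "?f y < ?f z" if "between y z xr" for z using hi that by blast
  qed
  have nbrs: "\<exists>xl xr. 1 \<le> xl \<and> xl \<le> ?N \<and> ?f xl + 1 = ?f y \<and> 1 \<le> xr \<and> xr \<le> ?N \<and> ?f xr = ?f y + 1"
    if y: "1 \<le> y" "y \<le> ?N" "even y" for y
  proof -
    have "even (?f y)" using pare y by simp
    then have "2 \<le> ?f y" "?f y + 1 \<le> ?N" using alt_Baxter_range[OF A y(1,2)] odd_N by presburger+
    then have "1 \<le> ?f y - 1" "?f y - 1 \<le> ?N" "?f y - 1 + 1 = ?f y" "1 \<le> ?f y + 1" by auto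
    then show ?thesis using alt_Baxter_position[OF A] \<open>?f y + 1 \<le> ?N\<close> by metis
  qed
  show "doubly_alternating (odd_part p)"
    unfolding doubly_alternating_odd_part
  proof (intro conjI allI impI ballI)
    fix j assume j: "1 \<le> j \<and> j < n + 1"
    have y: "1 \<le> 2 * j" "2 * j \<le> ?N" "even (2 * j)" using j n by auto
    have m: "(2 * j) mod 4 = 2 \<longleftrightarrow> odd j" by presburger
    obtain xl xr where xl: "1 \<le> xl" "xl \<le> ?N" "?f xl + 1 = ?f (2 * j)"
      and xr: "1 \<le> xr" "xr \<le> ?N" "?f xr = ?f (2 * j) + 1" using nbrs[OF y] by blast
    note nb = nbr[OF y xl xr]
    show "if odd j then ?f (2 * j - 1) < ?f (2 * j + 1) else ?f (2 * j + 1) < ?f (2 * j - 1)"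
    proof (cases "odd j")
      case True
      then have o: "xl < 2 * j" "2 * j < xr" using nb(1) m by auto
      then have "xl = 2 * j - 1 \<or> between xl (2 * j - 1) (2 * j)" "xr = 2 * j + 1 \<or> between (2 * j) (2 * j + 1) xr"
        by (auto simp: between_def)
      then have "?f (2 * j - 1) < ?f (2 * j)" "?f (2 * j) < ?f (2 * j + 1)"
        using nb(2,3) xl xr by (metis less_add_one)+
      then show ?thesis using True by simp
    next
      case False
      then have o: "xr < 2 * j" "2 * j < xl" using nb(1) m by auto
      then have "xr = 2 * j - 1 \<or> between (2 * j) (2 * j - 1) xr" "xl = 2 * j + 1 \<or> between xl (2 * j + 1) (2 * j)"
        by (auto simp: between_def)
      then have "?f (2 * j) < ?f (2 * j - 1)" "?f (2 * j + 1) < ?f (2 * j)"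
        using nb(2,3) xl xr by (metis less_add_one)+
      then show ?thesis using False by simp
    qed
  next
    fix x y assume "x \<in> {1..2 * n + 1}" "y \<in> {1..2 * n + 1}" and h: "odd (?f x) \<and> ?f y = ?f x + 2"
    then have x: "1 \<le> x" "x \<le> ?N" and y: "1 \<le> y" "y \<le> ?N" using n by auto
    have "1 \<le> ?f x + 1" "?f x + 1 \<le> ?N" using alt_Baxter_range[OF A y] h by auto
    then obtain m where m: "1 \<le> m" "m \<le> ?N" "?f m = ?f x + 1" using alt_Baxter_position[OF A] by blast
    have ev: "even m" using pare[OF m(1,2)] m(3) h by simp
    have "if m mod 4 = 2 then x < m \<and> m < y else y < m \<and> m < x"
      by (rule nbr(1)[OF m(1,2) ev x _ y]) (use m h in simp_all)
    moreover have "m mod 4 = (?f x + 1) mod 4" using alt_Baxter_even[OF A m(1,2) ev] m(3) by simp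
    ultimately show "if (?f x + 1) mod 4 = 2 then x < y else y < x" by (auto split: if_splits)
  qed
qed

text \<open>
An even value \<open>w\<close> stands between \<open>w - 1\<close> and \<open>w + 1\<close>: otherwise the closer of these two would stand
between \<open>w\<close> and the other one and violate the Baxter condition. Hence the entries next to \<open>w\<close> form
an ascent iff \<open>w - 1\<close> is to the left of \<open>w + 1\<close>. Alternation of the odd entries relates the former
to the position of \<open>w\<close> modulo 4, alternation of the inverse relates the latter to \<open>w mod 4\<close>.
\<close>

lemma complete_Baxter_imp_alt_Baxter:
  assumes B: "complete_Baxter p" and DA: "doubly_alternating (odd_part p)" and m4: "length p mod 4 = 3"
  shows "alt_Baxter (length p) (pval p)"
proof -
  let ?f = "pval p" and ?N = "length p"
  have odd_N: "odd ?N" and perm: "is_perm p" using B by (auto simp: complete_Baxter_def)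
  then obtain n where n: "?N = 2 * n + 1" by (auto elim: oddE)
  have pare: "even (?f i) \<longleftrightarrow> even i" if "1 \<le> i" "i \<le> ?N" for i
    using B that by (simp add: complete_Baxter_def)
  have bx: "if odd (?f x) then ?f z < ?f x else ?f x + 1 < ?f z"
    if "1 \<le> x" "x \<le> ?N" "1 \<le> y" "y \<le> ?N" "?f y = ?f x + 1" "between x z y" for x y z
    by (rule B[unfolded complete_Baxter_def, THEN conjunct2, THEN conjunct2, THEN conjunct2,
          THEN bspec, of x, THEN bspec, of y, THEN spec, of z, THEN spec, of "?f x", THEN mp])
      (use that in \<open>auto simp: between_def\<close>)
  interpret parity_perm p n by unfold_locales (use perm n pare in auto)
  have bij: "bij_betw ?f {1..?N} {1..?N}" using bij_p n by simp
  have rng: "1 \<le> ?f x \<and> ?f x \<le> ?N" if "1 \<le> x" "x \<le> ?N" for x using bij_betwE[OF bij] that by simp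
  have inj: "x = y" if "?f x = ?f y" "1 \<le> x" "x \<le> ?N" "1 \<le> y" "y \<le> ?N" for x y
    by (rule inj_onD[OF bij_betw_imp_inj_on[OF bij] that(1)]) (use that in auto)
  have pos: "\<exists>x. 1 \<le> x \<and> x \<le> ?N \<and> ?f x = v" if "1 \<le> v" "v \<le> ?N" for v
    using bij_betw_imp_surj_on[OF bij] that by (metis atLeastAtMost_iff imageE)
  have DA1: "if odd j then ?f (2 * j - 1) < ?f (2 * j + 1) else ?f (2 * j + 1) < ?f (2 * j - 1)"
    if "1 \<le> j" "j < n + 1" for j
    using DA that unfolding doubly_alternating_odd_part by blast
  have DA2: "if (?f x + 1) mod 4 = 2 then x < y else y < x"
    if "1 \<le> x" "x \<le> ?N" "1 \<le> y" "y \<le> ?N" "odd (?f x)" "?f y = ?f x + 2" for x y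
    using conjunct2[OF DA[unfolded doubly_alternating_odd_part]] that n by simp
  have ord: "if ?f y mod 4 = 2 then xl < y \<and> y < xr else xr < y \<and> y < xl"
    if y: "1 \<le> y" "y \<le> ?N" "even y" and xl: "1 \<le> xl" "xl \<le> ?N" "?f y = ?f xl + 1"
      and xr: "1 \<le> xr" "xr \<le> ?N" "?f xr = ?f y + 1" for y xl xr
  proof -
    have ev: "even (?f y)" using pare y by simp
    then have "odd (?f xl)" "?f xr = ?f xl + 2" using xl xr by auto
    from DA2[OF xl(1,2) xr(1,2) this]
    have o: "if ?f y mod 4 = 2 then xl < xr else xr < xl" using xl(3) by simp
    have "\<not> between y xl xr"
      using bx[OF y(1,2) xr(1,2) xr(3), of xl] ev xl(3) by auto
    moreover have "\<not> between xl xr y"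
      using bx[OF xl(1,2) y(1,2) xl(3), of xr] \<open>odd (?f xl)\<close> xl(3) xr(3) by auto
    moreover have "y \<noteq> xl" "y \<noteq> xr" using xl xr by auto
    ultimately show ?thesis using o by (auto simp: between_def split: if_splits)
  qed
  have nbrs: "\<exists>xl xr. 1 \<le> xl \<and> xl \<le> ?N \<and> ?f y = ?f xl + 1 \<and> 1 \<le> xr \<and> xr \<le> ?N \<and> ?f xr = ?f y + 1"
    if y: "1 \<le> y" "y \<le> ?N" "even y" for y
  proof -
    have "even (?f y)" using pare y by simp
    then have "2 \<le> ?f y" "?f y + 1 \<le> ?N" using rng[OF y(1,2)] odd_N by presburger+
    then have "1 \<le> ?f y - 1" "?f y - 1 \<le> ?N" "?f y = ?f y - 1 + 1" "1 \<le> ?f y + 1" by auto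
    then show ?thesis using pos \<open>?f y + 1 \<le> ?N\<close> by metis
  qed
  show ?thesis
  proof (rule alt_BaxterI)
    show "?N mod 4 = 3" by fact
    show "inj_on ?f {1..?N}" by (rule bij_betw_imp_inj_on[OF bij])
    show "1 \<le> ?f x \<and> ?f x \<le> ?N" if "1 \<le> x" "x \<le> ?N" for x using rng[OF that] .
    show "odd (?f y)" if "1 \<le> y" "y \<le> ?N" "odd y" for y using pare that by simp
    show "?f y mod 4 = y mod 4" if y: "1 \<le> y" "y \<le> ?N" "even y" for y
    proof -
      obtain xl xr where xl: "1 \<le> xl" "xl \<le> ?N" "?f y = ?f xl + 1"
        and xr: "1 \<le> xr" "xr \<le> ?N" "?f xr = ?f y + 1" using nbrs[OF y] by blast
      obtain j where j: "y = 2 * j" using y(3) by blast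
      have ev: "even (?f y)" using pare y by simp
      then have ol: "odd (?f xl)" using xl by simp
      have J: "1 \<le> j" "j < n + 1" using j y n by auto
      have lo: "?f z < ?f y" if "z = xl \<or> between xl z y" for z
        using that bx[OF xl(1,2) y(1,2) xl(3)] ol xl(3) by fastforce
      have hi: "?f y < ?f z" if "z = xr \<or> between y z xr" for z
        using that bx[OF y(1,2) xr(1,2) xr(3)] ev xr(3) by fastforce
      have "?f y mod 4 = 2 \<longleftrightarrow> odd j"
      proof (cases "?f y mod 4 = 2")
        case True
        then have o: "xl < y" "y < xr" using ord[OF y xl xr] by auto
        have "?f (2 * j - 1) < ?f y" by (rule lo) (use o j in \<open>auto simp: between_def\<close>)
        moreover have "?f y < ?f (2 * j + 1)" by (rule hi) (use o j in \<open>auto simp: between_def\<close>)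
        ultimately show ?thesis using DA1[OF J] True by (auto split: if_splits)
      next
        case False
        then have o: "xr < y" "y < xl" using ord[OF y xl xr] by auto
        have "?f (2 * j + 1) < ?f y" by (rule lo) (use o j in \<open>auto simp: between_def\<close>)
        moreover have "?f y < ?f (2 * j - 1)" by (rule hi) (use o j in \<open>auto simp: between_def\<close>)
        ultimately show ?thesis using DA1[OF J] False by (auto split: if_splits)
      qed
      moreover have "y mod 4 = 2 \<longleftrightarrow> odd j" unfolding j by presburger
      ultimately show ?thesis using mod4_eqI[OF ev y(3)] by blast
    qed
    fix x y assume x: "1 \<le> x" "x \<le> ?N" and y: "1 \<le> y" "y \<le> ?N" and s: "?f y = ?f x + 1"
    {
      assume ev: "even (?f y)"
      then have y2: "even y" using pare y by simp
      obtain xr where xr: "1 \<le> xr" "xr \<le> ?N" "?f xr = ?f y + 1" using nbrs[OF y y2] by blast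
      show "(if ?f y mod 4 = 2 then x < y else y < x) \<and> (\<forall>z. between x z y \<longrightarrow> ?f z < ?f y)"
        using ord[OF y y2 x s xr] bx[OF x y s] ev s by (auto split: if_splits dest: less_SucI)
    }
    {
      assume ev: "even (?f x)"
      then have x2: "even x" using pare x by simp
      obtain xl where xl: "1 \<le> xl" "xl \<le> ?N" "?f x = ?f xl + 1" using nbrs[OF x x2] by blast
      show "(if ?f x mod 4 = 2 then x < y else y < x) \<and> (\<forall>z. between x z y \<longrightarrow> ?f x < ?f z)"
        using ord[OF x x2 xl y s] bx[OF x y s] ev s by (auto split: if_splits dest: Suc_lessD)
    }
  qed
qed

section \<open>Snow leopard permutations and their threads\<close>

lemma framed_Perm_iff:
  "framed (Perm p) \<longleftrightarrow> complete_Baxter p \<and> doubly_alternating (odd_part p) \<and> length p mod 4 = 3"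
proof
  assume "framed (Perm p)"
  then have "alt_Baxter (length p) (pval p)" using framed_imp_alt_Baxter by fastforce
  then show "complete_Baxter p \<and> doubly_alternating (odd_part p) \<and> length p mod 4 = 3"
    using alt_Baxter_imp_complete_Baxter alt_Baxter_mod by blast
next
  assume "complete_Baxter p \<and> doubly_alternating (odd_part p) \<and> length p mod 4 = 3"
  then have "alt_Baxter (length p) (pval p)" using complete_Baxter_imp_alt_Baxter by blast
  from alt_Baxter_imp_framed[OF this] show "framed (Perm p)" unfolding map_pval .
qed

lemma length_even_part:
  assumes "is_perm p"
  shows "length (even_part p) = length p div 2"
proof -
  have "length (filter even p) = card (set (filter even p))"
    by (rule distinct_card[symmetric]) (use assms in \<open>simp add: is_perm_iff\<close>)
  also have "set (filter even p) = {y. even y \<and> 1 \<le> y \<and> y \<le> length p}"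
    using assms by (auto simp: is_perm_iff)
  finally show ?thesis by (simp only: card_even_atMost even_part_eq[OF assms] length_map)
qed

lemma length_odd_part_perm:
  assumes "is_perm p"
  shows "length (odd_part p) = Suc (length p) div 2"
proof -
  have "length (filter odd p) = card (set (filter odd p))"
    by (rule distinct_card[symmetric]) (use assms in \<open>simp add: is_perm_iff\<close>)
  also have "set (filter odd p) = {y. odd y \<and> y \<le> length p}"
    using assms by (auto simp: is_perm_iff Suc_le_eq dest: odd_pos)
  finally show ?thesis by (simp only: card_odd_atMost odd_part_eq[OF assms] length_map)
qed

fun odd_length_perm :: "aperm \<Rightarrow> bool" where
  "odd_length_perm Anti \<longleftrightarrow> True"
| "odd_length_perm (Perm p) \<longleftrightarrow> is_perm p \<and> odd (length p)"

lemma is_perm_frame: "is_perm p \<Longrightarrow> is_perm (1 # map Suc p @ [length p + 2])"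
proof -
  assume p: "is_perm p"
  then have "set (map Suc p) = {2..length p + 1}"
    by (simp add: is_perm_iff numeral_2_eq_2)
  then show ?thesis using p by (auto simp: is_perm_iff distinct_map)
qed

lemma is_perm_complement: "is_perm p \<Longrightarrow> is_perm (map (\<lambda>v. length p + 1 - v) p)"
proof -
  assume p: "is_perm p"
  have "inj_on (\<lambda>v. length p + 1 - v) {1..length p}" by (auto simp: inj_on_def)
  moreover have "(\<lambda>v. length p + 1 - v) ` {1..length p} = {1..length p}"
  proof (intro equalityI subsetI)
    fix v assume "v \<in> {1..length p}"
    then have "length p + 1 - v \<in> {1..length p}" "v = length p + 1 - (length p + 1 - v)" by auto
    then show "v \<in> (\<lambda>v. length p + 1 - v) ` {1..length p}" by blast
  qed auto
  ultimately show ?thesis using p by (simp add: is_perm_iff distinct_map)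
qed

lemma is_perm_skew:
  assumes "is_perm p" "is_perm q"
  shows "is_perm (map ((+) (length q)) p @ q)"
proof -
  have "set (map ((+) (length q)) p) = {length q + 1..length q + length p}"
    using assms(1) by (simp add: is_perm_iff add.commute)
  then show ?thesis using assms by (auto simp: is_perm_iff distinct_map)
qed

lemma is_perm_max: "is_perm q \<Longrightarrow> is_perm (Suc (length q) # q)"
  using is_perm_skew[of "[1]" q] by (simp add: is_perm_iff)

lemma odd_length_perm_frame [simp]: "odd_length_perm A \<Longrightarrow> odd_length_perm (frame A)"
  using is_perm_frame by (cases A) (auto simp: is_perm_iff)

lemma odd_length_perm_complement [simp]: "odd_length_perm A \<Longrightarrow> odd_length_perm (complement A)"
  using is_perm_complement by (cases A) auto

lemma odd_length_perm_node [simp]: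
  "\<lbrakk>odd_length_perm A; A \<noteq> Anti; odd_length_perm B\<rbrakk> \<Longrightarrow> odd_length_perm (A \<ominus> Perm [1] \<ominus> B)"
  using is_perm_skew[of _ "Suc _ # _", OF _ is_perm_max] by (cases A; cases B) auto

lemma frame_not_Anti [simp]: "frame A \<noteq> Anti"
  by (cases A) auto

lemma complement_eq_Anti [simp]: "complement A = Anti \<longleftrightarrow> A = Anti"
  by (cases A) auto

text \<open>
A frame raises all entries by one and thereby exchanges the parities; its two new entries are odd.
\<close>

lemma aeven_frame: "odd_length_perm A \<Longrightarrow> aeven (frame A) = aodd A"
proof (cases A)
  case Anti
  have "is_perm [1]" by (simp add: is_perm_iff)
  then show ?thesis using Anti by (simp add: even_part_eq)
next
  case (Perm p)
  assume "odd_length_perm A"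
  then have p: "is_perm p" "odd (length p)" using Perm by auto
  show ?thesis
    using p Perm by (simp add: even_part_eq[OF is_perm_frame[OF p(1), simplified]] odd_part_eq filter_map comp_def)
qed

lemma aodd_frame: "odd_length_perm A \<Longrightarrow> aodd (frame A) = frame (aeven A)"
proof (cases A)
  case Anti
  have "is_perm [1]" by (simp add: is_perm_iff)
  then show ?thesis using Anti by (simp add: odd_part_eq)
next
  case (Perm p)
  assume "odd_length_perm A"
  then have p: "is_perm p" "odd (length p)" using Perm by auto
  have "Suc (Suc (Suc (length p))) div 2 = length (even_part p) + 2"
    using p by (simp add: length_even_part)
  moreover have "length (filter even p) = length p div 2"
    using length_even_part[OF p(1)] by (simp add: even_part_eq[OF p(1)])
  ultimately show ?thesis
    using p Perm by (simp add: odd_part_eq[OF is_perm_frame[OF p(1), simplified]] even_part_eq filter_map comp_def)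
qed

lemma filter_map_complement:
  assumes p: "is_perm p" "odd (length p)"
  shows "filter even (map (\<lambda>v. length p + 1 - v) p) = map (\<lambda>v. length p + 1 - v) (filter even p)"
    and "filter odd (map (\<lambda>v. length p + 1 - v) p) = map (\<lambda>v. length p + 1 - v) (filter odd p)"
proof -
  have e: "even (length p + 1 - v) \<longleftrightarrow> even v" if "v \<in> set p" for v
    using that p by (intro complement_even) (auto simp: is_perm_iff)
  have "filter (even \<circ> (\<lambda>v. length p + 1 - v)) p = filter even p"
    "filter (odd \<circ> (\<lambda>v. length p + 1 - v)) p = filter odd p"
    by (rule filter_cong[OF refl], simp only: comp_def e)+
  then show "filter even (map (\<lambda>v. length p + 1 - v) p) = map (\<lambda>v. length p + 1 - v) (filter even p)"
    "filter odd (map (\<lambda>v. length p + 1 - v) p) = map (\<lambda>v. length p + 1 - v) (filter odd p)"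
    by (simp_all only: filter_map)
qed

text \<open>
Complementation in odd length \<open>m\<close> preserves parity and acts on the halved entries as complementation
in length \<open>m div 2\<close> or \<open>Suc m div 2\<close>.
\<close>

lemma complement_halves:
  assumes "v \<le> m" "odd m"
  shows "even v \<Longrightarrow> (m + 1 - v) div 2 = m div 2 + 1 - v div 2"
    and "odd v \<Longrightarrow> Suc (m + 1 - v) div 2 = Suc m div 2 + 1 - Suc v div 2"
  using assms by (auto elim!: oddE evenE)

lemma aeven_complement: "odd_length_perm A \<Longrightarrow> aeven (complement A) = complement (aeven A)"
proof (cases A)
  case (Perm p)
  assume "odd_length_perm A"
  then have p: "is_perm p" "odd (length p)" using Perm by auto
  have "even_part (map (\<lambda>v. length p + 1 - v) p) = map (\<lambda>v. (length p + 1 - v) div 2) (filter even p)"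
    using filter_map_complement[OF p] by (simp add: even_part_eq[OF is_perm_complement[OF p(1), simplified]] comp_def)
  also have "\<dots> = map (\<lambda>v. length p div 2 + 1 - v div 2) (filter even p)"
    using p by (intro map_cong refl complement_halves(1)) (auto simp: is_perm_iff)
  also have "\<dots> = map (\<lambda>v. length (even_part p) + 1 - v) (even_part p)"
    unfolding length_even_part[OF p(1)] by (simp add: even_part_eq[OF p(1)])
  finally show ?thesis using Perm by simp
qed auto

lemma aodd_complement: "odd_length_perm A \<Longrightarrow> aodd (complement A) = complement (aodd A)"
proof (cases A)
  case (Perm p)
  assume "odd_length_perm A"
  then have p: "is_perm p" "odd (length p)" using Perm by auto
  have "odd_part (map (\<lambda>v. length p + 1 - v) p) = map (\<lambda>v. Suc (length p + 1 - v) div 2) (filter odd p)"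
    using filter_map_complement[OF p] by (simp add: odd_part_eq[OF is_perm_complement[OF p(1), simplified]] comp_def)
  also have "\<dots> = map (\<lambda>v. Suc (length p) div 2 + 1 - Suc v div 2) (filter odd p)"
    using p by (intro map_cong refl complement_halves(2)) (auto simp: is_perm_iff)
  also have "\<dots> = map (\<lambda>v. length (odd_part p) + 1 - v) (odd_part p)"
    unfolding length_odd_part_perm[OF p(1)] by (simp add: odd_part_eq[OF p(1)])
  finally show ?thesis using Perm by simp
qed auto

text \<open>
The entries of \<open>A\<close> are raised by the even number \<open>|B| + 1\<close>, which is also the value of the separating
entry; so the latter survives among the even entries only.
\<close>

lemma parts_node:
  assumes "odd_length_perm A" "A \<noteq> Anti" "odd_length_perm B"
  shows "aeven (A \<ominus> Perm [1] \<ominus> B) = aeven A \<ominus> Perm [1] \<ominus> aeven B"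
    and "aodd (A \<ominus> Perm [1] \<ominus> B) = aodd A \<ominus> aodd B"
proof -
  obtain p where A: "A = Perm p" and p: "is_perm p" using assms by (cases A) auto
  have "aeven (A \<ominus> Perm [1] \<ominus> B) = aeven A \<ominus> Perm [1] \<ominus> aeven B \<and>
    aodd (A \<ominus> Perm [1] \<ominus> B) = aodd A \<ominus> aodd B"
  proof (cases B)
    case Anti
    then show ?thesis using A by simp
  next
    case (Perm q)
    then have q: "is_perm q" "odd (length q)" using assms by auto
    then obtain k where k: "length q = 2 * k + 1" by (auto elim: oddE)
    have pq: "is_perm (map ((+) (Suc (length q))) p @ Suc (length q) # q)"
      using is_perm_skew[OF p is_perm_max[OF q(1)]] by simp
    have le: "length (even_part q) = k" "length (odd_part q) = k + 1"
      using length_even_part[OF q(1)] length_odd_part_perm[OF q(1)] k by simp_all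
    have lf: "length (filter odd q) = k + 1" "length (filter even q) = k"
      using le by (simp_all add: even_part_eq[OF q(1)] odd_part_eq[OF q(1)])
    have f: "filter even (map ((+) (Suc (length q))) p) = map ((+) (Suc (length q))) (filter even p)"
      "filter odd (map ((+) (Suc (length q))) p) = map ((+) (Suc (length q))) (filter odd p)"
      using k by (simp_all add: filter_map comp_def)
    have "even_part (map ((+) (Suc (length q))) p @ Suc (length q) # q) =
        map ((+) (Suc k)) (even_part p) @ Suc k # even_part q"
      unfolding even_part_eq[OF pq] even_part_eq[OF p] even_part_eq[OF q(1)] filter_append f
      using k by simp
    moreover have "odd_part (map ((+) (Suc (length q))) p @ Suc (length q) # q) =
        map ((+) (Suc k)) (odd_part p) @ odd_part q"
      unfolding odd_part_eq[OF pq] odd_part_eq[OF p] odd_part_eq[OF q(1)] filter_append f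
      using k by simp
    ultimately show ?thesis using A Perm le by simp
  qed
  then show "aeven (A \<ominus> Perm [1] \<ominus> B) = aeven A \<ominus> Perm [1] \<ominus> aeven B"
    "aodd (A \<ominus> Perm [1] \<ominus> B) = aodd A \<ominus> aodd B" by auto
qed

text \<open>
A grammar for the snow leopard permutations of odd length.
\<close>

inductive leopard :: "aperm \<Rightarrow> bool" where
  Anti: "leopard Anti"
| node: "\<lbrakk>leopard A; leopard B\<rbrakk> \<Longrightarrow> leopard (frame (complement A) \<ominus> Perm [1] \<ominus> B)"

lemma odd_length_perm_framed: "framed A \<Longrightarrow> odd_length_perm A"
  by (induction rule: framed.induct) (simp_all del: One_nat_def)

lemma odd_length_perm_leopard: "leopard A \<Longrightarrow> odd_length_perm A"
  by (induction rule: leopard.induct) (simp_all del: One_nat_def)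

lemma aeven_framed_node:
  assumes "odd_length_perm A" "odd_length_perm B"
  shows "aeven (frame (frame (complement A)) \<ominus> Perm [1] \<ominus> B) =
    frame (complement (aeven A)) \<ominus> Perm [1] \<ominus> aeven B"
  using assms by (simp only: parts_node odd_length_perm_frame odd_length_perm_complement frame_not_Anti not_False_eq_True
      aeven_frame aodd_frame aeven_complement)

lemma parts_leopard_node:
  assumes "odd_length_perm A" "odd_length_perm B"
  shows "aeven (frame (complement A) \<ominus> Perm [1] \<ominus> B) = complement (aodd A) \<ominus> Perm [1] \<ominus> aeven B"
    and "aodd (frame (complement A) \<ominus> Perm [1] \<ominus> B) = frame (complement (aeven A)) \<ominus> aodd B"
  using assms by (simp_all only: parts_node odd_length_perm_frame odd_length_perm_complement frame_not_Anti not_False_eq_True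
      aeven_frame aodd_frame aeven_complement aodd_complement)

text \<open>
The even entries of a double frame are the odd entries of the inner frame, and these form a single
frame around the even entries of the core.
\<close>

lemma leopard_iff_framed: "leopard \<sigma> \<longleftrightarrow> (\<exists>A. framed A \<and> \<sigma> = aeven A)"
proof
  assume "leopard \<sigma>"
  then show "\<exists>A. framed A \<and> \<sigma> = aeven A"
  proof (induction rule: leopard.induct)
    case Anti
    then show ?case using framed.Anti by force
  next
    case (node X Y)
    then obtain A B where AB: "framed A" "X = aeven A" "framed B" "Y = aeven B" by blast
    then show ?case
      using framed.node[OF AB(1,3)] aeven_framed_node[OF AB(1,3)[THEN odd_length_perm_framed]] by metis
  qed
next
  assume "\<exists>A. framed A \<and> \<sigma> = aeven A"
  then obtain A where "framed A" "\<sigma> = aeven A" by blast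
  then show "leopard \<sigma>"
  proof (induction arbitrary: \<sigma> rule: framed.induct)
    case Anti
    then show ?case using leopard.Anti by simp
  next
    case (node A B)
    then show ?case
      using leopard.node aeven_framed_node[OF node(1,2)[THEN odd_length_perm_framed]] by metis
  qed
qed

lemma snow_leopard_iff_leopard: "snow_leopard \<sigma> \<and> odd (plength \<sigma>) \<longleftrightarrow> leopard \<sigma>"
proof (cases \<sigma>)
  case Anti
  then show ?thesis using leopard.Anti by simp
next
  case (Perm s)
  have "snow_leopard \<sigma> \<and> odd (plength \<sigma>) \<longleftrightarrow> (\<exists>\<pi>. framed (Perm \<pi>) \<and> s = even_part \<pi>)"
  proof
    assume h: "snow_leopard \<sigma> \<and> odd (plength \<sigma>)"
    then obtain \<pi> where \<pi>: "complete_Baxter \<pi>" "length \<pi> = 2 * length s + 1" "even_part \<pi> = s"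
      "doubly_alternating (odd_part \<pi>)" using Perm by auto
    moreover have "odd (length s)" using h Perm by simp
    then have "length \<pi> mod 4 = 3" using \<pi>(2) by presburger
    ultimately show "\<exists>\<pi>. framed (Perm \<pi>) \<and> s = even_part \<pi>" unfolding framed_Perm_iff by blast
  next
    assume "\<exists>\<pi>. framed (Perm \<pi>) \<and> s = even_part \<pi>"
    then obtain \<pi> where \<pi>: "complete_Baxter \<pi>" "doubly_alternating (odd_part \<pi>)" "length \<pi> mod 4 = 3"
      "s = even_part \<pi>" unfolding framed_Perm_iff by blast
    have "length s = length \<pi> div 2"
      using \<pi> length_even_part by (simp add: complete_Baxter_def)
    then have "length \<pi> = 2 * length s + 1" "odd (length s)" using \<pi>(3) by presburger+
    then show "snow_leopard \<sigma> \<and> odd (plength \<sigma>)" using \<pi> Perm by auto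
  qed
  also have "\<dots> \<longleftrightarrow> leopard \<sigma>"
  proof -
    have "Perm s = aeven A \<longleftrightarrow> (\<exists>\<pi>. A = Perm \<pi> \<and> s = even_part \<pi>)" for A by (cases A) auto
    then show ?thesis unfolding leopard_iff_framed Perm by auto
  qed
  finally show ?thesis .
qed

text \<open>
The grammars that threads inherit from \<open>leopard\<close>. They refer to each other because the frame in
\<open>leopard\<close> exchanges the parities.
\<close>

inductive ethread :: "aperm \<Rightarrow> bool" and othread :: "aperm \<Rightarrow> bool" where
  ethread_Anti: "ethread Anti"
| ethread_node: "\<lbrakk>othread p; ethread e\<rbrakk> \<Longrightarrow> ethread (complement p \<ominus> Perm [1] \<ominus> e)"
| othread_empty: "othread (Perm [])"
| othread_node: "\<lbrakk>ethread e; othread p\<rbrakk> \<Longrightarrow> othread (frame (complement e) \<ominus> p)"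

lemma leopard_imp_threads: "leopard \<sigma> \<Longrightarrow> ethread (aeven \<sigma>) \<and> othread (aodd \<sigma>)"
proof (induction rule: leopard.induct)
  case Anti
  then show ?case using ethread_Anti othread_empty by simp
next
  case (node A B)
  then show ?case
    using ethread_node othread_node parts_leopard_node[OF node(1,2)[THEN odd_length_perm_leopard]] by simp
qed

lemma threads_imp_leopard:
  "ethread \<gamma> \<Longrightarrow> \<exists>\<sigma>. leopard \<sigma> \<and> \<gamma> = aeven \<sigma>"
  "othread \<gamma> \<Longrightarrow> \<exists>\<sigma>. leopard \<sigma> \<and> \<gamma> = aodd \<sigma>"
proof (induction rule: ethread_othread.inducts)
  case ethread_Anti
  then show ?case using leopard.Anti by force
next
  case (ethread_node p e)
  then show ?case using leopard.node parts_leopard_node odd_length_perm_leopard by metis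
next
  case othread_empty
  then show ?case using leopard.Anti by force
next
  case (othread_node e p)
  then show ?case using leopard.node parts_leopard_node odd_length_perm_leopard by metis
qed

lemma Janus_thread_iff: "Janus_thread \<gamma> \<longleftrightarrow> \<gamma> = Anti \<or> ethread \<gamma> \<and> othread \<gamma>"
proof -
  have "even_thread \<gamma> \<longleftrightarrow> ethread \<gamma>" "odd_thread \<gamma> \<longleftrightarrow> othread \<gamma>"
    using leopard_imp_threads threads_imp_leopard snow_leopard_iff_leopard
    unfolding even_thread_def odd_thread_def by blast+
  then show ?thesis unfolding Janus_thread_def by blast
qed

section \<open>Closure properties of threads\<close>

fun valid :: "aperm \<Rightarrow> bool" where
  "valid Anti \<longleftrightarrow> True"
| "valid (Perm p) \<longleftrightarrow> is_perm p"

lemma skew_one_Perm: "\<exists>q. Perm [1] \<ominus> A = Perm q"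
  by (cases A) auto

lemma skew_assoc: "(Perm p \<ominus> Perm q) \<ominus> Perm r = Perm p \<ominus> (Perm q \<ominus> Perm r)"
  by (simp add: comp_def add.assoc)

lemma frame_Perm_ex: "\<exists>p. frame A = Perm p"
  by (cases A) auto

lemma valid_frame [simp]: "valid A \<Longrightarrow> valid (frame A)"
  using is_perm_frame by (cases A) (auto simp: is_perm_iff)

lemma valid_complement [simp]: "valid A \<Longrightarrow> valid (complement A)"
  using is_perm_complement by (cases A) auto

lemma valid_skew: "\<lbrakk>valid (Perm p); valid (Perm q)\<rbrakk> \<Longrightarrow> valid (Perm p \<ominus> Perm q)"
  using is_perm_skew by simp

lemma valid_skew_one: "valid A \<Longrightarrow> valid (Perm [1] \<ominus> A)"
  using is_perm_max by (cases A) (auto simp: is_perm_iff)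

lemma othread_Perm: "othread p \<Longrightarrow> \<exists>q. p = Perm q"
proof -
  have "ethread e \<Longrightarrow> True" and "othread p \<Longrightarrow> \<exists>q. p = Perm q" for e p
  proof (induction rule: ethread_othread.inducts)
    case (othread_node e p)
    then obtain q where "p = Perm q" by blast
    then show ?case using frame_Perm_ex[of "complement e"] by auto
  qed auto
  then show "othread p \<Longrightarrow> \<exists>q. p = Perm q" by blast
qed

lemma valid_threads: "ethread e \<Longrightarrow> valid e" "othread p \<Longrightarrow> valid p"
proof (induction rule: ethread_othread.inducts)
  case (ethread_node p e)
  obtain c where c: "complement p = Perm c" using othread_Perm[OF ethread_node(1)] by auto
  obtain r where r: "Perm [1] \<ominus> e = Perm r" using skew_one_Perm by blast
  show ?case
    using valid_complement[OF ethread_node.IH(1)] valid_skew_one[OF ethread_node.IH(2)]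
    unfolding c r by (rule valid_skew)
next
  case (othread_node e p)
  obtain f where f: "frame (complement e) = Perm f" using frame_Perm_ex by blast
  obtain q where q: "p = Perm q" using othread_Perm[OF othread_node(2)] by blast
  have "valid (Perm f)" using valid_frame[OF valid_complement[OF othread_node.IH(1)]] unfolding f .
  then show ?case using othread_node.IH(2) unfolding f q by (rule valid_skew)
qed (auto simp: is_perm_iff)

text \<open>
An even thread other than the antipermutation is a list of complemented odd threads separated by single
entries, and an odd thread is a skew sum of frames, so such lists can be concatenated.
\<close>

lemma threads_append:
  assumes e': "ethread e'" and q: "othread q"
  shows "ethread e \<Longrightarrow> e \<noteq> Anti \<Longrightarrow> ethread (e \<ominus> Perm [1] \<ominus> e')"
    and "othread p \<Longrightarrow> othread (p \<ominus> q)"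
proof (induction rule: ethread_othread.inducts)
  case (ethread_node p e)
  obtain c where c: "complement p = Perm c" using othread_Perm[OF ethread_node(1)] by auto
  obtain r where r: "Perm [1] \<ominus> e' = Perm r" using skew_one_Perm by blast
  show ?case
  proof (cases e)
    case Anti
    then have "complement p \<ominus> Perm [1] \<ominus> e = complement p" using c by simp
    then show ?thesis using ethread_othread.ethread_node[OF ethread_node(1) e'] by simp
  next
    case (Perm f)
    have "(complement p \<ominus> Perm [1] \<ominus> e) \<ominus> Perm [1] \<ominus> e' = complement p \<ominus> Perm [1] \<ominus> (e \<ominus> Perm [1] \<ominus> e')"
      unfolding c r Perm by (simp add: comp_def add.assoc)
    then show ?thesis
      using ethread_othread.ethread_node[OF ethread_node(1) ethread_node.IH(2)] Perm by simp
  qed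
next
  case othread_empty
  then show ?case using q othread_Perm[OF q] by auto
next
  case (othread_node e p)
  obtain f where f: "frame (complement e) = Perm f" using frame_Perm_ex by blast
  obtain r where r: "p = Perm r" using othread_Perm[OF othread_node(2)] by blast
  obtain s where s: "q = Perm s" using othread_Perm[OF q] by blast
  have "othread (frame (complement e) \<ominus> (p \<ominus> q))"
    using ethread_othread.othread_node[OF othread_node(1) othread_node.IH(2)] .
  then show ?case unfolding f r s skew_assoc .
qed simp

lemma othread_frame: "ethread e \<Longrightarrow> othread (frame (complement e))"
  using othread_node[OF _ othread_empty] frame_Perm_ex[of "complement e"] by fastforce

lemma othread_one: "othread (Perm [1])"
  using othread_frame[OF ethread_Anti] by simp

lemma ethread_skew_one: "ethread e \<Longrightarrow> ethread (Perm [1] \<ominus> e)"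
  using ethread_node[OF othread_empty, of e] skew_one_Perm[of e] by auto

lemma othread_skew_one: "othread p \<or> p = Anti \<Longrightarrow> othread (Perm [1] \<ominus> p)"
  using othread_node[OF ethread_Anti, of p] othread_empty by auto

lemma complement_complement: "valid A \<Longrightarrow> complement (complement A) = A"
proof (cases A)
  case (Perm p)
  assume "valid A"
  then have "map (\<lambda>v. length p + 1 - (length p + 1 - v)) p = p"
    using Perm by (intro map_idI) (auto simp: is_perm_iff)
  then show ?thesis using Perm by (simp add: comp_def)
qed simp

lemma complement_frame:
  assumes "valid (Perm p)"
  shows "complement (frame (complement (Perm p))) = Perm [1] \<ominus> Perm p \<ominus> Perm [1]"
proof -
  have "map (\<lambda>v. Suc (Suc (length p)) - (length p + 1 - v)) p = map Suc p"
    using assms by (intro map_cong) (auto simp: is_perm_iff)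
  then show ?thesis by (simp add: comp_def)
qed

text \<open>
The first entry reveals the length of the second summand.
\<close>

lemma list_split_unique:
  assumes "map ((+) (length q)) (1 # p) @ q = map ((+) (length q')) (1 # p') @ q'"
  shows "p = p' \<and> q = q'"
proof -
  have l: "length q = length q'" using assms by simp
  have "map ((+) (length q')) (1 # p) @ q = map ((+) (length q')) (1 # p') @ q'"
    using assms unfolding l .
  then have "map ((+) (length q')) (1 # p) = map ((+) (length q')) (1 # p')" "q = q'"
    using append_eq_append_conv l by blast+
  then show ?thesis by auto
qed

lemma frame_Cons: "\<exists>r. frame A = Perm (1 # r)"
  by (cases A) auto

lemma frame_skew_unique:
  assumes "frame A \<ominus> Perm q = frame B \<ominus> Perm q'"
  shows "frame A = frame B \<and> q = q'"
proof -
  obtain a b where ab: "frame A = Perm (1 # a)" "frame B = Perm (1 # b)" using frame_Cons by metis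
  then have "map ((+) (length q)) (1 # a) @ q = map ((+) (length q')) (1 # b) @ q'"
    using assms by (simp only: pskew.simps aperm.inject)
  from list_split_unique[OF this] show ?thesis using ab by simp
qed

lemma frame_inject: "frame A = frame B \<longleftrightarrow> A = B"
  by (cases A; cases B) (auto dest: map_injective)

text \<open>
In a skew sum of frames, a smallest entry at the end is a frame by itself, since every larger frame
ends with its maximum.
\<close>

lemma othread_strip_last: "othread (Perm (map Suc q @ [1])) \<Longrightarrow> othread (Perm q)"
proof (induction "length q" arbitrary: q rule: less_induct)
  case less
  from less.prems show ?case
  proof (cases rule: othread.cases)
    case (othread_node e p)
    obtain s where s: "p = Perm s" using othread_Perm[OF othread_node(3)] by blast
    obtain f where f: "frame (complement e) = Perm (1 # f)" using frame_Cons by blast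
    have eq: "map Suc q @ [1] = map ((+) (length s)) (1 # f) @ s"
      using othread_node(1) unfolding f s by simp
    show ?thesis
    proof (cases s rule: rev_cases)
      case Nil
      then have "map Suc q @ [1] = 1 # f" using eq by simp
      moreover have "e = Anti"
      proof (rule ccontr)
        assume "e \<noteq> Anti"
        then obtain r where "e = Perm r" by (cases e) auto
        then have "last (1 # f) = length r + 2" using f by auto
        then show False using calculation by (metis One_nat_def add_2_eq_Suc' last_snoc nat.simps(3) old.nat.inject)
      qed
      ultimately show ?thesis using f othread_empty by simp
    next
      case (snoc t x)
      then have x: "x = 1" and "map Suc q = map ((+) (length s)) (1 # f) @ t" using eq by auto
      then obtain q1 q2 where q: "q = q1 @ q2" "map Suc q1 = map ((+) (length s)) (1 # f)" "map Suc q2 = t"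
        by (auto simp: map_eq_append_conv)
      have "map Suc q1 = map Suc (map ((+) (length q2)) (1 # f))"
        using q(2,3) snoc by auto
      then have q1: "q1 = map ((+) (length q2)) (1 # f)" by (simp only: inj_map_eq_map[OF inj_Suc])
      then have "length q2 < length q" using q(1) by simp
      moreover have "othread (Perm (map Suc q2 @ [1]))" using othread_node(3) s snoc x q(3) by simp
      ultimately have "othread (Perm q2)" by (rule less.hyps)
      from ethread_othread.othread_node[OF othread_node(2) this] show ?thesis
        unfolding f using q(1) q1 by simp
    qed
  qed simp
qed

lemma othread_skew_oneD:
  assumes "othread (Perm [1] \<ominus> Perm q)"
  shows "othread (Perm q)"
  using assms
proof (cases rule: othread.cases)
  case (othread_node e p)
  obtain s where s: "p = Perm s" using othread_Perm[OF othread_node(3)] by blast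
  have "frame Anti \<ominus> Perm q = frame (complement e) \<ominus> Perm s" using othread_node(1) s by simp
  from frame_skew_unique[OF this] show ?thesis using othread_node(3) s by simp
qed auto

section \<open>Janus threads and trees\<close>

text \<open>
These trees index both sides of the bijection. The condition in \<open>proper\<close> says that no arch is empty:
this excludes the peaks \<open>UD\<close> of a path, and on the side of permutations it requires the enclosed
Janus thread to have nonnegative length.
\<close>

datatype jtree = Tip | Lev jtree | Up jtree jtree

fun perm_of :: "jtree \<Rightarrow> aperm" where
  "perm_of Tip = Anti"
| "perm_of (Lev t) = Perm [1] \<ominus> perm_of t"
| "perm_of (Up t u) = frame (complement (perm_of t)) \<ominus> Perm [1] \<ominus> perm_of u"

fun word_of :: "jtree \<Rightarrow> step list" where
  "word_of Tip = []"
| "word_of (Lev t) = L # word_of t"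
| "word_of (Up t u) = U # word_of t @ D # word_of u"

fun proper :: "jtree \<Rightarrow> bool" where
  "proper Tip \<longleftrightarrow> True"
| "proper (Lev t) \<longleftrightarrow> proper t"
| "proper (Up t u) \<longleftrightarrow> t \<noteq> Tip \<and> proper t \<and> proper u"

lemma perm_of_eq_Anti [simp]: "perm_of t = Anti \<longleftrightarrow> t = Tip"
proof (cases t)
  case (Lev s)
  then show ?thesis by (cases "perm_of s") auto
next
  case (Up s u)
  then show ?thesis using frame_Perm_ex[of "complement (perm_of s)"] skew_one_Perm[of "perm_of u"] by auto
qed simp

text \<open>
For \<open>Up\<close>, the block \<open>1 \<oplus> c(p) \<oplus> 1\<close> is a frame around the complement of an even thread and
also the complement of the odd thread \<open>1 \<ominus> p \<ominus> 1\<close>.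
\<close>

lemma Janus_thread_perm_of: "proper t \<Longrightarrow> Janus_thread (perm_of t)"
proof (induction t)
  case Tip
  show ?case by (simp add: Janus_thread_iff)
next
  case (Lev t)
  then have "ethread (perm_of t)" "othread (perm_of t) \<or> perm_of t = Anti"
    using ethread_Anti by (auto simp: Janus_thread_iff)
  then show ?case
    using ethread_skew_one othread_skew_one by (simp add: Janus_thread_iff del: One_nat_def)
next
  case (Up t u)
  obtain p where p: "perm_of t = Perm p" using Up.prems by (cases "perm_of t") auto
  have t: "ethread (Perm p)" "othread (Perm p)"
    using Up p by (auto simp: Janus_thread_iff)
  have u: "ethread (perm_of u)" "othread (perm_of u) \<or> perm_of u = Anti"
    using Up ethread_Anti by (auto simp: Janus_thread_iff)
  have "othread (Perm p \<ominus> Perm [1])" by (rule threads_append(2)[OF ethread_Anti othread_one t(2)])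
  then have "othread (complement (frame (complement (Perm p))))"
    unfolding complement_frame[OF valid_threads(1)[OF t(1)]]
    using othread_skew_one by blast
  from ethread_node[OF this u(1)]
  have "ethread (frame (complement (Perm p)) \<ominus> Perm [1] \<ominus> perm_of u)"
    unfolding complement_complement[OF valid_frame[OF valid_complement[OF valid_threads(1)[OF t(1)]]]] .
  moreover have "othread (frame (complement (Perm p)) \<ominus> Perm [1] \<ominus> perm_of u)"
    by (rule othread_node[OF t(1) othread_skew_one[OF u(2)]])
  ultimately show ?case unfolding perm_of.simps p Janus_thread_iff by blast
qed

text \<open>
On the right, the entries of the first block are exactly those that are at least as large as the
first entry. On the left, the first summand is \<open>(1 \<ominus> q \<ominus> 1) \<oplus> c(p)\<close>: it contains an entry below
its first one, and its last entry, further right, is larger than its first one.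
\<close>

lemma thread_splits_incompatible:
  assumes e: "valid (Perm p)" "p \<noteq> []" and s: "valid (Perm s)"
    and g: "complement (frame (complement (Perm q)) \<ominus> Perm p) \<ominus> Perm r = frame A \<ominus> Perm s"
  shows False
proof -
  define n where "n = length q + 2 + length p"
  obtain a where a: "frame A = Perm (1 # a)" using frame_Cons by blast
  define b where "b = map (\<lambda>v. n + 1 - v) (map ((+) (length p)) (1 # map Suc (map (\<lambda>v. length q + 1 - v) q) @ [length q + 2]))"
  define c where "c = map (\<lambda>v. n + 1 - v) p"
  have "complement (frame (complement (Perm q)) \<ominus> Perm p) = Perm (b @ c)"
    by (simp add: b_def c_def n_def add.commute)
  then have eq: "map ((+) (length r)) (b @ c) @ r = map ((+) (length s)) (1 # a) @ s"
    using g unfolding a by (simp only: pskew.simps aperm.inject)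
  have lb: "length b = length q + 2" by (simp add: b_def)
  have hb: "b ! 0 = length q + 2" by (simp add: b_def n_def)
  have ls: "length s + 1 = length r + length q + 2"
    using arg_cong[OF eq, of "\<lambda>x. x ! 0"] hb lb by (simp add: nth_append)
  have "length r < length s" using ls by simp
  obtain us where "map ((+) (length r)) (b @ c) = map ((+) (length s)) (1 # a) @ us \<and> us @ r = s \<or>
      map ((+) (length r)) (b @ c) @ us = map ((+) (length s)) (1 # a) \<and> r = us @ s"
    using append_eq_append_conv2[THEN iffD1, OF eq] by blast
  moreover have "\<not> r = us @ s" using \<open>length r < length s\<close> by auto
  ultimately have us: "us @ r = s" "map ((+) (length r)) (b @ c) = map ((+) (length s)) (1 # a) @ us" by blast+
  have "us \<noteq> []" using us(1) \<open>length r < length s\<close> by auto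
  then have "last us = length r + last c"
    using arg_cong[OF us(2), of last] e(2) by (simp add: c_def last_map)
  moreover have "last c = n + 1 - last p" using e(2) by (simp add: c_def last_map)
  moreover have "last p \<le> length p" using e last_in_set[of p] by (auto simp: is_perm_iff)
  ultimately have "last us > length s" using ls by (simp add: n_def)
  moreover have "last us \<in> set s" using \<open>us \<noteq> []\<close> us(1) by auto
  ultimately show False using s by (auto simp: is_perm_iff)
qed

lemma plength_frame: "plength (frame A) = plength A + 2"
  by (cases A) auto

lemma plength_complement [simp]: "plength (complement A) = plength A"
  by (cases A) auto

lemma plength_skew_one: "plength (Perm [1] \<ominus> A) = plength A + 1"
  by (cases A) auto

lemma complement_skew_one:
  "complement (Perm [1] \<ominus> Perm l) = Perm (1 # map Suc (map (\<lambda>v. length l + 1 - v) l))" if "valid (Perm l)"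
  using that by (auto simp: is_perm_iff)

text \<open>
Parse \<open>\<gamma>\<close> both as an odd thread, with first frame \<open>1 \<oplus> c(e) \<oplus> 1\<close>, and as an even thread, with
first block \<open>c(p)\<close>. If \<open>p\<close> is empty or a single frame, then \<open>\<gamma>\<close> is empty or begins with
its maximum; in the latter case the first frame of the odd parse is a single entry, and removing it
leaves a Janus thread. If \<open>p\<close> has several frames,
its first one is a single entry by \<open>thread_splits_incompatible\<close>. Then \<open>c(p)\<close> and
\<open>1 \<oplus> c(e) \<oplus> 1\<close> both consist of the entries that are at least as large as the first one, so they
coincide. Hence \<open>p = 1 \<ominus> e \<ominus> 1\<close>, which makes \<open>e\<close> an odd thread as well, and what follows the first
block is \<open>1 \<ominus> e2\<close> with a Janus thread \<open>e2\<close>.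
\<close>

lemma threads_imp_tree: "\<lbrakk>ethread \<gamma>; othread \<gamma>\<rbrakk> \<Longrightarrow> \<exists>t. proper t \<and> perm_of t = \<gamma>"
proof (induction "nat (plength \<gamma>)" arbitrary: \<gamma> rule: less_induct)
  case less
  have empty: ?case if "\<gamma> = Perm []" using that by (intro exI[of _ "Lev Tip"]) simp
  from less.prems(2) show ?case
  proof (cases rule: othread.cases)
    case othread_empty
    then show ?thesis by (rule empty)
  next
    case (othread_node e os)
    obtain s where s: "os = Perm s" using othread_Perm[OF othread_node(3)] by blast
    note \<gamma> = othread_node(1)[unfolded s] and os = othread_node(3)[unfolded s]
    obtain f where f: "frame (complement e) = Perm (1 # f)" using frame_Cons by blast
    have size: "plength \<gamma> = plength (frame (complement e)) + int (length s)"
      unfolding \<gamma> f by simp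
    have IH_s: "\<exists>t. proper t \<and> perm_of t = Perm s" if "ethread (Perm s)"
      by (rule less.hyps) (use that os size f in auto)
    have lev: ?thesis if h: "\<gamma> = Perm [1] \<ominus> Perm s'" "ethread (Perm s')" for s'
    proof -
      have "frame Anti \<ominus> Perm s' = frame (complement e) \<ominus> Perm s" using h(1) \<gamma> by simp
      then have "s' = s" using frame_skew_unique by blast
      then obtain t where "proper t" "perm_of t = Perm s" using IH_s h(2) by blast
      then show ?thesis using h(1) \<open>s' = s\<close> by (intro exI[of _ "Lev t"]) simp
    qed
    from less.prems(1) show ?thesis
    proof (cases rule: ethread.cases)
      case ethread_Anti
      then show ?thesis using \<gamma> f by simp
    next
      case (ethread_node p e2)
      note \<gamma>2 = ethread_node(1) and p = ethread_node(2) and e2 = ethread_node(3)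
      obtain r where r: "Perm [1] \<ominus> e2 = Perm r" using skew_one_Perm by blast
      have er: "ethread (Perm r)" using ethread_skew_one[OF e2] r by simp
      from p show ?thesis
      proof (cases rule: othread.cases)
        case othread_empty
        then have "\<gamma> = Perm [1] \<ominus> e2" using \<gamma>2 r by simp
        then show ?thesis using empty lev e2 by (cases e2) auto
      next
        case (othread_node e3 p3)
        obtain l where l: "p3 = Perm l" using othread_Perm[OF othread_node(3)] by blast
        have vl: "valid (Perm l)" using valid_threads(2)[OF othread_node(3)] l by simp
        have fe3: "frame (complement e3) \<ominus> Perm [] = frame (complement e3)"
          using frame_Perm_ex[of "complement e3"] by auto
        show ?thesis
        proof (cases "l = []"; cases e3)
          assume "l = []" "e3 = Anti"
          then have "complement p = Perm [1]" using othread_node(1) l by simp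
          then show ?thesis using lev[of r] \<gamma>2 r er by simp
        next
          fix x assume x: "l = []" "e3 = Perm x"
          then have "complement p = Perm [1] \<ominus> Perm x \<ominus> Perm [1]"
            using othread_node(1,2) l fe3 complement_frame valid_threads(1) by metis
          then have "\<gamma> = Perm [1] \<ominus> (Perm x \<ominus> Perm [1] \<ominus> Perm r)"
            using \<gamma>2 r by (simp add: comp_def)
          moreover have "ethread (Perm x \<ominus> Perm [1] \<ominus> Perm r)"
            using threads_append(1)[OF er othread_one, of "Perm x"] othread_node(2) x by simp
          ultimately show ?thesis using lev by simp
        next
          fix x assume x: "l \<noteq> []" "e3 = Perm x"
          have "complement (frame (complement (Perm x)) \<ominus> Perm l) \<ominus> Perm r = frame (complement e) \<ominus> Perm s"
            using \<gamma> \<gamma>2 othread_node(1) l x r by simp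
          then show ?thesis using thread_splits_incompatible[OF vl x(1) valid_threads(2)[OF os]] by blast
        next
          assume x: "l \<noteq> []" "e3 = Anti"
          define cl where "cl = map (\<lambda>v. length l + 1 - v) l"
          have cp: "complement p = Perm (1 # map Suc cl)"
            using complement_skew_one[OF vl] othread_node(1) l x unfolding cl_def by simp
          have "complement p \<ominus> Perm r = frame (complement e) \<ominus> Perm s"
            using \<gamma> \<gamma>2 unfolding r by simp
          then have "Perm (1 # map Suc cl) \<ominus> Perm r = Perm (1 # f) \<ominus> Perm s"
            unfolding cp f .
          then have "map Suc cl = f \<and> r = s"
            unfolding pskew.simps aperm.inject by (rule list_split_unique)
          then have fr: "f = map Suc cl" "s = r" by auto
          show ?thesis
          proof (cases e)
            case Anti
            then show ?thesis using f fr x by (simp add: cl_def)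
          next
            case (Perm y)
            have vy: "valid (Perm y)" using \<open>ethread e\<close> valid_threads(1) Perm by blast
            have "map Suc cl = map Suc (map (\<lambda>v. length y + 1 - v) y @ [length y + 1])"
              using f fr Perm by simp
            then have cl: "cl = map (\<lambda>v. length y + 1 - v) y @ [length y + 1]"
              by (simp only: inj_map_eq_map[OF inj_Suc])
            have ll: "length l = length y + 1" using arg_cong[OF cl, of length] by (simp add: cl_def)
            have "l = map (\<lambda>v. length l + 1 - v) cl"
              using complement_complement[OF vl] by (simp add: cl_def)
            also have "\<dots> = map Suc y @ [1]"
              using vy unfolding cl ll by (auto simp: is_perm_iff)
            finally have "othread (Perm y)" using othread_strip_last[of y] othread_node(3) l by simp
            moreover have ey: "ethread (Perm y)" using \<open>ethread e\<close> Perm by simp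
            moreover have "nat (plength (Perm y)) < nat (plength \<gamma>)"
              using size Perm by (simp only: plength_frame plength_complement plength.simps)
            ultimately obtain t where t: "proper t" "perm_of t = Perm y"
              using less.hyps[of "Perm y"] by blast
            have "\<exists>u. proper u \<and> perm_of u = e2"
            proof (cases e2)
              case Anti
              then show ?thesis by (intro exI[of _ Tip]) simp
            next
              case (Perm z)
              then have "othread (Perm z)" using othread_skew_oneD[of z] os fr r by simp
              moreover have "length z < length s" using fr r Perm by auto
              then have "nat (plength (Perm z)) < nat (plength \<gamma>)"
                using size \<open>e = Perm y\<close> by (simp only: plength_frame plength_complement plength.simps)
              ultimately show ?thesis
                using less.hyps[of "Perm z"] e2 Perm by blast
            qed
            then obtain u where u: "proper u" "perm_of u = e2" by blast
            have "\<gamma> = perm_of (Up t u)" using \<gamma> Perm fr r t u by simp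
            moreover have "proper (Up t u)" using t u by auto
            ultimately show ?thesis by blast
          qed
        qed
      qed
    qed
  qed
qed

lemma Janus_thread_iff_tree: "Janus_thread \<gamma> \<longleftrightarrow> (\<exists>t. proper t \<and> perm_of t = \<gamma>)"
  using Janus_thread_perm_of threads_imp_tree
  by (metis Janus_thread_iff perm_of.simps(1) proper.simps(1))

lemma skew_one_inject: "Perm [1] \<ominus> A = Perm [1] \<ominus> B \<longleftrightarrow> A = B"
  by (cases A; cases B) auto

lemma valid_perm_of: "proper t \<Longrightarrow> valid (perm_of t)"
  using Janus_thread_perm_of[of t] valid_threads by (auto simp: Janus_thread_iff)

lemma Lev_neq_Up:
  assumes "t \<noteq> Tip"
  shows "perm_of (Lev s) \<noteq> perm_of (Up t u)"
proof
  assume e: "perm_of (Lev s) = perm_of (Up t u)"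
  obtain r where r: "Perm [1] \<ominus> perm_of u = Perm r" using skew_one_Perm by blast
  obtain f where f: "frame (complement (perm_of t)) = Perm (1 # f)" using frame_Cons by blast
  show False
  proof (cases "perm_of s")
    case Anti
    then show False using e r f by simp
  next
    case (Perm p)
    then have "frame Anti \<ominus> Perm p = frame (complement (perm_of t)) \<ominus> Perm r"
      using e r by simp
    then have "frame Anti = frame (complement (perm_of t))" using frame_skew_unique by blast
    then have "Anti = complement (perm_of t)" by (simp only: frame_inject)
    then show False using assms by (metis complement_eq_Anti perm_of_eq_Anti)
  qed
qed

lemma perm_of_inject: "\<lbrakk>proper t; proper t'; perm_of t = perm_of t'\<rbrakk> \<Longrightarrow> t = t'"
proof (induction t arbitrary: t')
  case Tip
  then show ?case by (metis perm_of.simps(1) perm_of_eq_Anti)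
next
  case (Lev s)
  show ?case
  proof (cases t')
    case Tip
    then show ?thesis using Lev.prems(3) perm_of_eq_Anti by (metis perm_of.simps(1))
  next
    case (Lev s')
    then show ?thesis using Lev.prems Lev.IH[of s'] by (simp add: skew_one_inject del: One_nat_def)
  next
    case (Up s' u')
    then show ?thesis using Lev.prems Lev_neq_Up[of s' s u'] by simp
  qed
next
  case (Up s u)
  show ?case
  proof (cases t')
    case Tip
    then show ?thesis using Up.prems(3) perm_of_eq_Anti by (metis perm_of.simps(1))
  next
    case (Lev s')
    then show ?thesis using Up.prems Lev_neq_Up[of s s' u] by simp
  next
    case (Up s' u')
    obtain r where r: "Perm [1] \<ominus> perm_of u = Perm r" using skew_one_Perm by blast
    obtain r' where r': "Perm [1] \<ominus> perm_of u' = Perm r'" using skew_one_Perm by blast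
    have "frame (complement (perm_of s)) \<ominus> Perm r = frame (complement (perm_of s')) \<ominus> Perm r'"
      using Up.prems(3) unfolding Up perm_of.simps r r' .
    then have e: "frame (complement (perm_of s)) = frame (complement (perm_of s'))" "r = r'"
      using frame_skew_unique by blast+
    have pr: "proper s" "proper s'" "proper u" "proper u'" using Up.prems(1,2) Up by auto
    have "complement (perm_of s) = complement (perm_of s')" using e(1) by (simp only: frame_inject)
    then have "perm_of s = perm_of s'" using complement_complement[OF valid_perm_of] pr by metis
    moreover have "perm_of u = perm_of u'" using r r' e(2) skew_one_inject by metis
    ultimately show ?thesis using Up.IH pr Up by blast
  qed
qed

lemma plength_perm_of: "plength (perm_of t) = int (length (word_of t)) - 1"
proof (induction t)
  case (Up t u)
  obtain r where r: "Perm [1] \<ominus> perm_of u = Perm r" using skew_one_Perm by blast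
  obtain f where f: "frame (complement (perm_of t)) = Perm f" using frame_Perm_ex by blast
  have "plength (perm_of (Up t u)) = plength (Perm f) + plength (Perm r)" unfolding perm_of.simps r f by simp
  also have "\<dots> = plength (perm_of t) + 2 + (plength (perm_of u) + 1)"
    unfolding r[symmetric] f[symmetric] plength_frame plength_skew_one plength_complement ..
  finally show ?case using Up by simp
qed (simp_all add: plength_skew_one del: One_nat_def)

section \<open>Peakless Motzkin paths and trees\<close>

lemma height_simps [simp]:
  "height [] = 0" "height (s # w) = rise s + height w" "height (u @ v) = height u + height v"
  by (simp_all add: height_def)

lemma Motzkin_path_prefix: "Motzkin_path w \<longleftrightarrow> height w = 0 \<and> (\<forall>u v. w = u @ v \<longrightarrow> 0 \<le> height u)"
proof -
  have "(\<forall>k\<le>length w. 0 \<le> height (take k w)) \<longleftrightarrow> (\<forall>u v. w = u @ v \<longrightarrow> 0 \<le> height u)"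
  proof (intro iffI allI impI)
    fix u v assume "\<forall>k\<le>length w. 0 \<le> height (take k w)" "w = u @ v"
    then show "0 \<le> height u" by (metis append_eq_conv_conj le_add1 length_append)
  next
    fix k assume "\<forall>u v. w = u @ v \<longrightarrow> 0 \<le> height u"
    then show "0 \<le> height (take k w)" by (metis append_take_drop_id)
  qed
  then show ?thesis unfolding Motzkin_path_def by blast
qed

lemma Motzkin_height: "Motzkin_path w \<Longrightarrow> height w = 0"
  by (simp add: Motzkin_path_def)

lemma Motzkin_prefix: "Motzkin_path (u @ v) \<Longrightarrow> 0 \<le> height u"
  by (simp add: Motzkin_path_prefix)

lemma Motzkin_Nil [simp]: "Motzkin_path []"
  by (simp add: Motzkin_path_prefix)

lemma Motzkin_level [simp]: "Motzkin_path (L # w) \<longleftrightarrow> Motzkin_path w"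
proof
  assume "Motzkin_path (L # w)"
  then show "Motzkin_path w"
    unfolding Motzkin_path_prefix by (metis append_Cons height_simps(2) rise.simps(3) add_0)
next
  assume "Motzkin_path w"
  then show "Motzkin_path (L # w)"
    unfolding Motzkin_path_prefix by (auto simp: Cons_eq_append_conv)
qed

lemma Motzkin_arch:
  assumes "Motzkin_path u"
  shows "Motzkin_path (U # u @ D # v) \<longleftrightarrow> Motzkin_path v"
proof
  assume M: "Motzkin_path (U # u @ D # v)"
  have "0 \<le> height x" if "v = x @ y" for x y
    using Motzkin_prefix[of "U # u @ D # x" y] M that Motzkin_height[OF assms] by simp
  then show "Motzkin_path v"
    using Motzkin_height[OF M] Motzkin_height[OF assms] by (simp add: Motzkin_path_prefix)
next
  assume v: "Motzkin_path v"
  have "0 \<le> height x" if "U # u @ D # v = x @ y" for x y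
  proof (cases x)
    case (Cons s x')
    then have s: "s = U" and e: "u @ D # v = x' @ y" using that by auto
    then consider us where "u = x' @ us" | us where "x' = u @ us" "D # v = us @ y"
      by (auto simp: append_eq_append_conv2)
    then show ?thesis
    proof cases
      case 1
      then have "0 \<le> height x'" using assms Motzkin_prefix by blast
      then show ?thesis using Cons s by simp
    next
      case 2
      show ?thesis
      proof (cases us)
        case Nil
        then show ?thesis using 2 Cons s Motzkin_height[OF assms] by simp
      next
        case (Cons a us')
        then have "a = D" "v = us' @ y" using 2 by auto
        then have "0 \<le> height us'" using v Motzkin_prefix by blast
        then show ?thesis
          using 2 \<open>x = s # x'\<close> s Cons \<open>a = D\<close> Motzkin_height[OF assms] by simp
      qed
    qed
  qed simp
  then show "Motzkin_path (U # u @ D # v)"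
    using Motzkin_height[OF v] Motzkin_height[OF assms] by (simp add: Motzkin_path_prefix)
qed

text \<open>
The starting height \<open>h\<close> is arbitrary to make the induction along \<open>w\<close> possible.
\<close>

lemma first_descent:
  assumes "0 \<le> h" "h + height w < 0"
  shows "\<exists>u v. w = u @ D # v \<and> h + height u = 0 \<and> (\<forall>x y. u = x @ y \<longrightarrow> 0 \<le> h + height x)"
  using assms
proof (induction w arbitrary: h)
  case (Cons s w)
  show ?case
  proof (cases "h + rise s < 0")
    case True
    then have "s = D" "h = 0" using Cons.prems by (cases s; simp)+
    then show ?thesis by (intro exI[of _ "[]"] exI[of _ w]) simp
  next
    case False
    then obtain u v where uv: "w = u @ D # v" "h + rise s + height u = 0"
      "\<forall>x y. u = x @ y \<longrightarrow> 0 \<le> h + rise s + height x"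
      using Cons.IH[of "h + rise s"] Cons.prems by (auto simp: add.assoc)
    have "0 \<le> h + height x" if "s # u = x @ y" for x y
      using that uv(3) Cons.prems(1) by (auto simp: Cons_eq_append_conv add.assoc)
    then show ?thesis using uv by (intro exI[of _ "s # u"] exI[of _ v]) auto
  qed
qed simp

text \<open>
If \<open>u\<close> were shorter than \<open>u'\<close>, then \<open>u'\<close> would have the prefix \<open>u @ [D]\<close>, which ends below the axis.
\<close>

lemma arch_unique:
  assumes "Motzkin_path u" "Motzkin_path u'" "u @ D # v = u' @ D # v'"
  shows "u = u' \<and> v = v'"
proof -
  have no: False if "Motzkin_path x" "Motzkin_path y" "y = x @ D # z" for x y z
    using Motzkin_prefix[of "x @ [D]" z] that Motzkin_height by fastforce
  from assms(3) obtain us where us: "u = u' @ us \<and> us @ D # v = D # v' \<or> u @ us = u' \<and> D # v = us @ D # v'"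
    by (auto simp: append_eq_append_conv2)
  then show ?thesis
  proof (cases us)
    case Nil
    then show ?thesis using us by auto
  next
    case (Cons a as)
    then have "u = u' @ D # as \<or> u' = u @ D # as" using us by auto
    then show ?thesis using no assms by blast
  qed
qed

lemma peakless_successively: "peakless w \<longleftrightarrow> successively (\<lambda>s t. \<not> (s = U \<and> t = D)) w"
  unfolding peakless_def successively_conv_nth by auto

lemma peakless_simps:
  "peakless []" "peakless (L # w) \<longleftrightarrow> peakless w"
  "peakless (U # w) \<longleftrightarrow> peakless w \<and> (w = [] \<or> hd w \<noteq> D)"
  "peakless (u @ D # v) \<longleftrightarrow> peakless u \<and> peakless v \<and> (u = [] \<or> last u \<noteq> U)"
  unfolding peakless_successively
  by (auto simp: successively_append_iff successively_Cons)

lemma Motzkin_ends: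
  assumes "Motzkin_path w" "w \<noteq> []"
  shows "hd w \<noteq> D" "last w \<noteq> U"
proof -
  show "hd w \<noteq> D"
    using Motzkin_prefix[of "[hd w]" "tl w"] assms by auto
  have w: "w = butlast w @ [last w]" using assms(2) by simp
  then have "0 \<le> height (butlast w)" using Motzkin_prefix assms(1) by metis
  then show "last w \<noteq> U"
    using Motzkin_height[OF assms(1)] arg_cong[OF w, of height] by auto
qed

text \<open>
A Motzkin path neither begins with \<open>D\<close> nor ends with \<open>U\<close>, so only an empty \<open>u\<close> creates a new peak.
\<close>

lemma peakless_arch:
  assumes "Motzkin_path u"
  shows "peakless (U # u @ D # v) \<longleftrightarrow> u \<noteq> [] \<and> peakless u \<and> peakless v"
  using Motzkin_ends[OF assms] by (cases "u = []") (auto simp: peakless_simps hd_append)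

lemma word_of_eq_Nil [simp]: "word_of t = [] \<longleftrightarrow> t = Tip"
  by (cases t) auto

lemma Motzkin_word_of: "Motzkin_path (word_of t)"
  by (induction t) (auto simp: Motzkin_arch)

lemma peakless_word_of: "proper t \<Longrightarrow> peakless (word_of t)"
  by (induction t) (auto simp: peakless_simps(1,2) peakless_arch Motzkin_word_of)

lemma word_of_inject: "word_of t = word_of t' \<Longrightarrow> t = t'"
proof (induction t arbitrary: t')
  case Tip
  then show ?case by (metis word_of.simps(1) word_of_eq_Nil)
next
  case (Lev t)
  then show ?case by (cases t') auto
next
  case (Up t u)
  then show ?case using arch_unique[OF Motzkin_word_of Motzkin_word_of] by (cases t') auto
qed

lemma Motzkin_imp_tree: "\<lbrakk>Motzkin_path w; peakless w\<rbrakk> \<Longrightarrow> \<exists>t. proper t \<and> word_of t = w"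
proof (induction "length w" arbitrary: w rule: less_induct)
  case less
  show ?case
  proof (cases w)
    case Nil
    then show ?thesis by (intro exI[of _ Tip]) simp
  next
    case (Cons s w')
    show ?thesis
    proof (cases s)
      case U
      have "0 + height w' < 0" using Motzkin_height[OF less.prems(1)] Cons U by simp
      then obtain u v where w': "w' = u @ D # v" and u: "height u = 0" "\<forall>x y. u = x @ y \<longrightarrow> 0 \<le> height x"
        using first_descent[of 0 w'] by auto
      have Mu: "Motzkin_path u" using u by (simp add: Motzkin_path_prefix)
      have w: "w = U # u @ D # v" using Cons U w' by simp
      then have Mv: "Motzkin_path v" using less.prems(1) Motzkin_arch[OF Mu] by simp
      have pl: "u \<noteq> []" "peakless u" "peakless v" using less.prems(2) peakless_arch[OF Mu] w by auto
      obtain t where "proper t" "word_of t = u" using less.hyps[OF _ Mu pl(2)] w by auto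
      moreover obtain t' where "proper t'" "word_of t' = v" using less.hyps[OF _ Mv pl(3)] w by auto
      ultimately show ?thesis using pl(1) w by (intro exI[of _ "Up t t'"]) auto
    next
      case D
      then show ?thesis using Motzkin_ends(1)[OF less.prems(1)] Cons by simp
    next
      case L
      then obtain t where "proper t" "word_of t = w'"
        using less.hyps[of w'] less.prems Cons by (auto simp: peakless_simps(2))
      then show ?thesis using Cons L by (intro exI[of _ "Lev t"]) simp
    qed
  qed
qed

section \<open>The bijection\<close>

definition tree_of :: "aperm \<Rightarrow> jtree" where
  "tree_of \<gamma> = (THE t. proper t \<and> perm_of t = \<gamma>)"

lemma tree_of_perm_of: "proper t \<Longrightarrow> tree_of (perm_of t) = t"
  unfolding tree_of_def using perm_of_inject by (intro the_equality) auto

lemma JT_iff: "\<gamma> \<in> JT n \<longleftrightarrow> (\<exists>t. proper t \<and> \<gamma> = perm_of t \<and> int (length (word_of t)) = n + 1)"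
proof -
  have "plength (perm_of t) = n \<longleftrightarrow> int (length (word_of t)) = n + 1" for t
    unfolding plength_perm_of by linarith
  then show ?thesis unfolding JT_def Janus_thread_iff_tree by auto
qed

lemma UD_iff: "w \<in> UD n \<longleftrightarrow> (\<exists>t. proper t \<and> w = word_of t \<and> int (length (word_of t)) = n)"
  unfolding UD_def using Motzkin_imp_tree Motzkin_word_of peakless_word_of by blast

lemma bij_betw_JT_UD: "bij_betw (\<lambda>\<gamma>. word_of (tree_of \<gamma>)) (JT n) (UD (n + 1))"
  unfolding bij_betw_def
proof
  show "inj_on (\<lambda>\<gamma>. word_of (tree_of \<gamma>)) (JT n)"
    by (auto simp: inj_on_def JT_iff tree_of_perm_of intro!: arg_cong[where f = perm_of] word_of_inject)
  show "(\<lambda>\<gamma>. word_of (tree_of \<gamma>)) ` JT n = UD (n + 1)"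
    by (force simp: JT_iff UD_iff tree_of_perm_of image_iff)
qed

text \<open>
Restricting both arguments puts this family into the extensional function spaces, where the values
on Janus threads determine it.
\<close>

definition thread_word :: "int \<Rightarrow> aperm \<Rightarrow> step list" where
  "thread_word = (\<lambda>n\<in>{-1..}. \<lambda>\<gamma>\<in>JT n. word_of (tree_of \<gamma>))"

lemma perm_of_in_JT: "proper t \<Longrightarrow> perm_of t \<in> JT (plength (perm_of t))"
  by (auto simp: JT_def Janus_thread_perm_of)

lemma plength_ge: "-1 \<le> plength \<gamma>"
  by (cases \<gamma>) auto

lemma thread_word_perm_of: "proper t \<Longrightarrow> thread_word (plength (perm_of t)) (perm_of t) = word_of t"
  using perm_of_in_JT by (simp add: thread_word_def plength_ge tree_of_perm_of)

definition Janus_recursive :: "(int \<Rightarrow> aperm \<Rightarrow> step list) \<Rightarrow> bool" where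
  "Janus_recursive K \<longleftrightarrow> K (-1) Anti = [] \<and>
    (\<forall>t. proper t \<longrightarrow> K (plength (perm_of (Lev t))) (perm_of (Lev t)) = L # K (plength (perm_of t)) (perm_of t)) \<and>
    (\<forall>t u. proper (Up t u) \<longrightarrow> K (plength (perm_of (Up t u))) (perm_of (Up t u)) =
       U # K (plength (perm_of t)) (perm_of t) @ D # K (plength (perm_of u)) (perm_of u))"

lemma Janus_recursive_perm_of:
  assumes "Janus_recursive K" "proper t"
  shows "K (plength (perm_of t)) (perm_of t) = word_of t"
  using assms(2)
proof (induction t)
  case Tip
  then show ?case using assms(1) by (simp add: Janus_recursive_def)
next
  case (Lev t)
  have "K (plength (perm_of (Lev t))) (perm_of (Lev t)) = L # K (plength (perm_of t)) (perm_of t)"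
    using assms(1) Lev.prems unfolding Janus_recursive_def by (metis proper.simps(2))
  then show ?case using Lev by (simp del: perm_of.simps)
next
  case (Up t u)
  have "K (plength (perm_of (Up t u))) (perm_of (Up t u)) =
       U # K (plength (perm_of t)) (perm_of t) @ D # K (plength (perm_of u)) (perm_of u)"
    using assms(1) Up.prems unfolding Janus_recursive_def by blast
  then show ?case using Up by (simp del: perm_of.simps)
qed

lemma Janus_clauses_imp_recursive:
  assumes K1: "K (-1) Anti = []"
    and K2: "\<forall>\<gamma> \<gamma>1. Janus_thread \<gamma> \<and> Janus_thread \<gamma>1 \<and> \<gamma> = Perm [1] \<ominus> \<gamma>1 \<longrightarrow>
        K (plength \<gamma>) \<gamma> = [L] @ K (plength \<gamma>1) \<gamma>1"
    and K3: "\<forall>\<gamma> \<gamma>1 \<gamma>2. Janus_thread \<gamma> \<and> Janus_thread \<gamma>1 \<and> Janus_thread \<gamma>2 \<and> plength \<gamma>1 \<ge> 0 \<and>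
        \<gamma> = (Perm [1] \<oplus> complement \<gamma>1 \<oplus> Perm [1]) \<ominus> Perm [1] \<ominus> \<gamma>2 \<longrightarrow>
        K (plength \<gamma>) \<gamma> = [U] @ K (plength \<gamma>1) \<gamma>1 @ [D] @ K (plength \<gamma>2) \<gamma>2"
  shows "Janus_recursive K"
  unfolding Janus_recursive_def
proof (intro conjI allI impI)
  show "K (-1) Anti = []" by (rule K1)
  fix t
  {
    assume t: "proper t"
    have "Janus_thread (perm_of (Lev t)) \<and> Janus_thread (perm_of t) \<and> perm_of (Lev t) = Perm [1] \<ominus> perm_of t"
      using t Janus_thread_perm_of[of t] Janus_thread_perm_of[of "Lev t"] by simp
    from K2[rule_format, OF this]
    show "K (plength (perm_of (Lev t))) (perm_of (Lev t)) = L # K (plength (perm_of t)) (perm_of t)" by simp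
  }
  fix u assume tu: "proper (Up t u)"
  then have "perm_of t \<noteq> Anti" by simp
  then have "plength (perm_of t) \<ge> 0" by (cases "perm_of t") simp_all
  moreover have "Janus_thread (perm_of t)" "Janus_thread (perm_of u)" "Janus_thread (perm_of (Up t u))"
    using tu Janus_thread_perm_of[of t] Janus_thread_perm_of[of u] Janus_thread_perm_of[OF tu] by auto
  ultimately have "Janus_thread (perm_of (Up t u)) \<and> Janus_thread (perm_of t) \<and> Janus_thread (perm_of u) \<and>
      plength (perm_of t) \<ge> 0 \<and>
      perm_of (Up t u) = (Perm [1] \<oplus> complement (perm_of t) \<oplus> Perm [1]) \<ominus> Perm [1] \<ominus> perm_of u"
    by (simp add: frame_def)
  from K3[rule_format, OF this]
  show "K (plength (perm_of (Up t u))) (perm_of (Up t u)) =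
       U # K (plength (perm_of t)) (perm_of t) @ D # K (plength (perm_of u)) (perm_of u)" by simp
qed

theorem theorem6p5:
  "\<exists>!K :: int \<Rightarrow> aperm \<Rightarrow> step list.
     K \<in> (\<Pi>\<^sub>E n\<in>{-1..}. JT n \<rightarrow>\<^sub>E UD (n + 1)) \<and>
     (\<forall>n\<ge>-1. bij_betw (K n) (JT n) (UD (n + 1))) \<and>
     K (-1) Anti = [] \<and>
     K 0 (Perm []) = [L] \<and>
     (\<forall>\<gamma> \<gamma>\<^sub>1. Janus_thread \<gamma> \<and> Janus_thread \<gamma>\<^sub>1 \<and> \<gamma> = Perm [1] \<ominus> \<gamma>\<^sub>1 \<longrightarrow>
        K (plength \<gamma>) \<gamma> = [L] @ K (plength \<gamma>\<^sub>1) \<gamma>\<^sub>1) \<and>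
     (\<forall>\<gamma> \<gamma>\<^sub>1 \<gamma>\<^sub>2. Janus_thread \<gamma> \<and> Janus_thread \<gamma>\<^sub>1 \<and> Janus_thread \<gamma>\<^sub>2 \<and> plength \<gamma>\<^sub>1 \<ge> 0 \<and>
        \<gamma> = (Perm [1] \<oplus> complement \<gamma>\<^sub>1 \<oplus> Perm [1]) \<ominus> Perm [1] \<ominus> \<gamma>\<^sub>2 \<longrightarrow>
        K (plength \<gamma>) \<gamma> =
          [U] @ K (plength \<gamma>\<^sub>1) \<gamma>\<^sub>1 @ [D] @ K (plength \<gamma>\<^sub>2) \<gamma>\<^sub>2)"
proof (rule ex1I[of _ thread_word], intro conjI allI impI)
  have bij: "bij_betw (thread_word n) (JT n) (UD (n + 1))" if "n \<ge> -1" for n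
    using bij_betw_JT_UD[of n] that by (simp add: thread_word_def cong: bij_betw_cong)
  show "bij_betw (thread_word n) (JT n) (UD (n + 1))" if "n \<ge> -1" for n using bij that .
  show "thread_word \<in> (\<Pi>\<^sub>E n\<in>{-1..}. JT n \<rightarrow>\<^sub>E UD (n + 1))"
  proof (rule PiE_I)
    show "thread_word n \<in> JT n \<rightarrow>\<^sub>E UD (n + 1)" if "n \<in> {-1..}" for n
    proof (rule PiE_I)
      show "thread_word n \<gamma> \<in> UD (n + 1)" if "\<gamma> \<in> JT n" for \<gamma>
        using bij_betwE[OF bij] that \<open>n \<in> {-1..}\<close> by simp
    qed (use that in \<open>simp add: thread_word_def\<close>)
  qed (simp add: thread_word_def)
  show "thread_word (-1) Anti = []" using thread_word_perm_of[of Tip] by simp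
  show "thread_word 0 (Perm []) = [L]" using thread_word_perm_of[of "Lev Tip"] by simp
next
  fix \<gamma> \<gamma>\<^sub>1 assume h: "Janus_thread \<gamma> \<and> Janus_thread \<gamma>\<^sub>1 \<and> \<gamma> = Perm [1] \<ominus> \<gamma>\<^sub>1"
  then obtain t where t: "proper t" "perm_of t = \<gamma>\<^sub>1" using Janus_thread_iff_tree by blast
  then have "perm_of (Lev t) = \<gamma>" using h by simp
  then show "thread_word (plength \<gamma>) \<gamma> = [L] @ thread_word (plength \<gamma>\<^sub>1) \<gamma>\<^sub>1"
    using thread_word_perm_of[of t] thread_word_perm_of[of "Lev t"] t by (simp del: perm_of.simps)
next
  fix \<gamma> \<gamma>\<^sub>1 \<gamma>\<^sub>2
  assume h: "Janus_thread \<gamma> \<and> Janus_thread \<gamma>\<^sub>1 \<and> Janus_thread \<gamma>\<^sub>2 \<and> plength \<gamma>\<^sub>1 \<ge> 0 \<and>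
        \<gamma> = (Perm [1] \<oplus> complement \<gamma>\<^sub>1 \<oplus> Perm [1]) \<ominus> Perm [1] \<ominus> \<gamma>\<^sub>2"
  then obtain t u where t: "proper t" "perm_of t = \<gamma>\<^sub>1" and u: "proper u" "perm_of u = \<gamma>\<^sub>2"
    using Janus_thread_iff_tree by meson
  have "t \<noteq> Tip" using t h by auto
  then have p: "proper (Up t u)" using t u by simp
  have "perm_of (Up t u) = \<gamma>" using h t u by (simp add: frame_def)
  then show "thread_word (plength \<gamma>) \<gamma> =
          [U] @ thread_word (plength \<gamma>\<^sub>1) \<gamma>\<^sub>1 @ [D] @ thread_word (plength \<gamma>\<^sub>2) \<gamma>\<^sub>2"
    using thread_word_perm_of[OF t(1)] thread_word_perm_of[OF u(1)] thread_word_perm_of[OF p] t u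
    by (simp del: perm_of.simps)
next
  fix K :: "int \<Rightarrow> aperm \<Rightarrow> step list"
  assume "K \<in> (\<Pi>\<^sub>E n\<in>{-1..}. JT n \<rightarrow>\<^sub>E UD (n + 1)) \<and>
     (\<forall>n\<ge>-1. bij_betw (K n) (JT n) (UD (n + 1))) \<and>
     K (-1) Anti = [] \<and>
     K 0 (Perm []) = [L] \<and>
     (\<forall>\<gamma> \<gamma>\<^sub>1. Janus_thread \<gamma> \<and> Janus_thread \<gamma>\<^sub>1 \<and> \<gamma> = Perm [1] \<ominus> \<gamma>\<^sub>1 \<longrightarrow>
        K (plength \<gamma>) \<gamma> = [L] @ K (plength \<gamma>\<^sub>1) \<gamma>\<^sub>1) \<and>
     (\<forall>\<gamma> \<gamma>\<^sub>1 \<gamma>\<^sub>2. Janus_thread \<gamma> \<and> Janus_thread \<gamma>\<^sub>1 \<and> Janus_thread \<gamma>\<^sub>2 \<and> plength \<gamma>\<^sub>1 \<ge> 0 \<and>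
        \<gamma> = (Perm [1] \<oplus> complement \<gamma>\<^sub>1 \<oplus> Perm [1]) \<ominus> Perm [1] \<ominus> \<gamma>\<^sub>2 \<longrightarrow>
        K (plength \<gamma>) \<gamma> =
          [U] @ K (plength \<gamma>\<^sub>1) \<gamma>\<^sub>1 @ [D] @ K (plength \<gamma>\<^sub>2) \<gamma>\<^sub>2)"
  then have PiE: "K \<in> (\<Pi>\<^sub>E n\<in>{-1..}. JT n \<rightarrow>\<^sub>E UD (n + 1))" and "Janus_recursive K"
    using Janus_clauses_imp_recursive[of K] by blast+
  note rec = Janus_recursive_perm_of[OF this(2)]
  show "K = thread_word"
  proof
    fix n
    show "K n = thread_word n"
    proof (cases "n \<ge> -1")
      case False
      then show ?thesis using PiE_arb[OF PiE, of n] by (simp add: thread_word_def)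
    next
      case True
      then have Kn: "K n \<in> JT n \<rightarrow>\<^sub>E UD (n + 1)" using PiE by auto
      show ?thesis
      proof
        fix \<gamma>
        show "K n \<gamma> = thread_word n \<gamma>"
        proof (cases "\<gamma> \<in> JT n")
          case False
          then show ?thesis using PiE_arb[OF Kn, of \<gamma>] True by (simp add: thread_word_def)
        next
          case g: True
          then obtain t where t: "proper t" "\<gamma> = perm_of t" using JT_iff by blast
          moreover have "n = plength \<gamma>" using g by (simp add: JT_def)
          ultimately show ?thesis using rec[OF t(1)] thread_word_perm_of[OF t(1)] by simp
        qed
      qed
    qed
  qed
qed

end
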